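(* Let $\Phi$ be a field of characteristic $\ne 2,3$. The free $(-1,1)$-superalgebra $F_{(-1,1)}[\emptyset;x]$ over $\Phi$ on one odd generator $x$ (and no even generators) is isomorphic to the superalgebra $B_0(\Phi[T],D,t_0)$, with the free generator $\bar 1$.
   Context: $(x,y,z)=(xy)z-x(yz)$. A $(-1,1)$-algebra is an algebra satisfying $(x,y,y)=0$ and $(x,y,z)+(y,z,x)+(z,x,y)=0$. A superalgebra $X=X_0\oplus X_1$ is a $(-1,1)$-superalgebra if its Grassmann envelope $G(X)=X_0\otimes G_0\oplus X_1\otimes G_1$ is a $(-1,1)$-algebra, where $G=G_0\oplus G_1$ is the associative Grassmann algebra on countably many generators. Free superalgebras are not assumed unital. For an associative commutative algebra $\Gamma$ (purely even), a derivation $D$ of $\Gamma$ and $\gamma\in\Gamma$, the twisted superalgebra of vector type $B(\Gamma,D,\gamma)=\Gamma\oplus\bar\Gamma$ has even part $\Gamma$, odd part $\bar\Gamma$ (a copy of the space $\Gamma$ via $a\mapsto\bar a$), and product $$a\times b=ab,\quad a\times\bar b=\bar a\times b=\overline{ab},\quad \bar a\times\bar b=\gamma ab+2D(a)b+aD(b)\qquad(a,b\in\Gamma).$$ $\Phi[T]$ is the algebra of polynomials in the variables $T=\{t_0,t_1,\dots,t_n,\dots\}$, $D$ is the derivation of $\Phi[T]$ with $D(t_i)=t_{i+1}$ for $i=0,1,\dots$, $\Phi_0[T]$ is the subalgebra of polynomials without constant term, and $B_0(\Phi[T],D,t_0)=\Phi_0[T]\oplus\overline{\Phi[T]}$, a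 subsuperalgebra of $B(\Phi[T],D,t_0)$. *)

theory Defs
  imports Complex_Main "HOL-Library.Poly_Mapping" "HOL-Library.FSet" "HOL-Library.Product_Plus"
begin

section \<open>Algebras and superalgebras over a field\<close>

text \<open>
  The carrier is a subspace of an ambient vector space, whose addition is that of the type.
  No unit is assumed.
\<close>

record ('f, 'a) alg =
  carrier :: "'a set"
  scalar :: "'f \<Rightarrow> 'a \<Rightarrow> 'a"
  mul :: "'a \<Rightarrow> 'a \<Rightarrow> 'a"

record ('f, 'a) superalg = "('f, 'a) alg" +
  even_part :: "'a set"
  odd_part :: "'a set"

locale algebra = vector_space "scalar A"
  for A :: "('f::field, 'a::ab_group_add, 'z) alg_scheme" +
  assumes subspace_carrier: "subspace (carrier A)"
    and mul_closed: "x \<in> carrier A \<Longrightarrow> y \<in> carrier A \<Longrightarrow> mul A x y \<in> carrier A"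
    and mul_add_left: "x \<in> carrier A \<Longrightarrow> y \<in> carrier A \<Longrightarrow> z \<in> carrier A \<Longrightarrow>
      mul A (x + y) z = mul A x z + mul A y z"
    and mul_add_right: "x \<in> carrier A \<Longrightarrow> y \<in> carrier A \<Longrightarrow> z \<in> carrier A \<Longrightarrow>
      mul A x (y + z) = mul A x y + mul A x z"
    and mul_scalar_left: "x \<in> carrier A \<Longrightarrow> y \<in> carrier A \<Longrightarrow>
      mul A (scalar A c x) y = scalar A c (mul A x y)"
    and mul_scalar_right: "x \<in> carrier A \<Longrightarrow> y \<in> carrier A \<Longrightarrow>
      mul A x (scalar A c y) = scalar A c (mul A x y)"

definition part :: "('f, 'a, 'z) superalg_scheme \<Rightarrow> nat \<Rightarrow> 'a set" where
  "part X n = (if even n then even_part X else odd_part X)"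

locale superalgebra = algebra X
  for X :: "('f::field, 'a::ab_group_add, 'z) superalg_scheme" +
  assumes subspace_even: "subspace (even_part X)"
    and subspace_odd: "subspace (odd_part X)"
    and direct: "even_part X \<inter> odd_part X = {0}"
    and carrier_eq: "carrier X = {x + y |x y. x \<in> even_part X \<and> y \<in> odd_part X}"
    and mul_part: "x \<in> part X i \<Longrightarrow> y \<in> part X j \<Longrightarrow> mul X x y \<in> part X (i + j)"

definition associator :: "('f, 'a::ab_group_add, 'z) alg_scheme \<Rightarrow> 'a \<Rightarrow> 'a \<Rightarrow> 'a \<Rightarrow> 'a" where
  "associator A x y z = mul A (mul A x y) z - mul A x (mul A y z)"

definition minus_one_one_algebra :: "('f::field, 'a::ab_group_add, 'z) alg_scheme \<Rightarrow> bool" where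
  "minus_one_one_algebra A \<longleftrightarrow> algebra A \<and>
     (\<forall>x\<in>carrier A. \<forall>y\<in>carrier A. associator A x y y = 0) \<and>
     (\<forall>x\<in>carrier A. \<forall>y\<in>carrier A. \<forall>z\<in>carrier A.
        associator A x y z + associator A y z x + associator A z x y = 0)"


section \<open>Grassmann envelope\<close>

text \<open>
  The Grassmann algebra \<open>G\<close> on the generators \<open>e\<^sub>0, e\<^sub>1, \<dots>\<close> has the basis
  \<open>e\<^sub>A = e\<^sub>a\<^sub>1 \<cdots> e\<^sub>a\<^sub>k\<close>, one vector for each finite set \<open>A = {a\<^sub>1 < \<dots> < a\<^sub>k}\<close>
  (with \<open>e\<^sub>A = 1\<close> for \<open>A\<close> empty), and \<open>e\<^sub>A e\<^sub>B = \<plusminus> e\<^bsub>A \<union> B\<^esub>\<close> or \<open>0\<close>; the coefficient is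
  \<open>grassmann_sign A B\<close>.  The vector \<open>e\<^sub>A\<close> has the parity of the cardinality of \<open>A\<close>.
\<close>

definition grassmann_sign :: "nat fset \<Rightarrow> nat fset \<Rightarrow> 'f::field" where
  "grassmann_sign A B =
     (if A |\<inter>| B = {||} then (-1) ^ card {(a, b). a |\<in>| A \<and> b |\<in>| B \<and> b < a} else 0)"

text \<open>
  An element \<open>u\<close> of \<open>nat fset \<Rightarrow>\<^sub>0 'a\<close> stands for the tensor \<open>\<Sum>\<^sub>A u(A) \<otimes> e\<^sub>A\<close>; every element of
  \<open>X \<otimes> G\<close> is of this form for a unique \<open>u\<close>.
\<close>

definition grassmann_envelope ::
  "('f::field, 'a::ab_group_add, 'z) superalg_scheme \<Rightarrow> ('f, nat fset \<Rightarrow>\<^sub>0 'a) alg" where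
  "grassmann_envelope X =
     \<lparr>carrier = {u. \<forall>A. Poly_Mapping.lookup u A \<in> part X (fcard A)},
      scalar = (\<lambda>c. Poly_Mapping.map (scalar X c)),
      mul = (\<lambda>u v. \<Sum>A\<in>Poly_Mapping.keys u. \<Sum>B\<in>Poly_Mapping.keys v.
        Poly_Mapping.single (A |\<union>| B)
          (scalar X (grassmann_sign A B) (mul X (Poly_Mapping.lookup u A) (Poly_Mapping.lookup v B))))\<rparr>"

definition minus_one_one_superalgebra ::
  "('f::field, 'a::ab_group_add, 'z) superalg_scheme \<Rightarrow> bool" where
  "minus_one_one_superalgebra X \<longleftrightarrow>
     superalgebra X \<and> minus_one_one_algebra (grassmann_envelope X)"


section \<open>Homomorphisms\<close>

definition superalg_hom ::
  "('a::ab_group_add \<Rightarrow> 'b::ab_group_add) \<Rightarrow> ('f, 'a, 'y) superalg_scheme \<Rightarrow>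
   ('f, 'b, 'z) superalg_scheme \<Rightarrow> bool" where
  "superalg_hom \<phi> X Y \<longleftrightarrow>
     (\<forall>x\<in>carrier X. \<forall>y\<in>carrier X. \<phi> (x + y) = \<phi> x + \<phi> y) \<and>
     (\<forall>c. \<forall>x\<in>carrier X. \<phi> (scalar X c x) = scalar Y c (\<phi> x)) \<and>
     (\<forall>x\<in>carrier X. \<forall>y\<in>carrier X. \<phi> (mul X x y) = mul Y (\<phi> x) (\<phi> y)) \<and>
     \<phi> ` even_part X \<subseteq> even_part Y \<and> \<phi> ` odd_part X \<subseteq> odd_part Y"

definition superalg_iso ::
  "('a::ab_group_add \<Rightarrow> 'b::ab_group_add) \<Rightarrow> ('f, 'a, 'y) superalg_scheme \<Rightarrow>
   ('f, 'b, 'z) superalg_scheme \<Rightarrow> bool" where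
  "superalg_iso \<phi> X Y \<longleftrightarrow> superalg_hom \<phi> X Y \<and> bij_betw \<phi> (carrier X) (carrier Y)"


section \<open>The free $(-1,1)$-superalgebra on one odd generator\<close>

text \<open>Nonassociative (nonempty) monomials in the single odd generator \<open>Gen\<close>.\<close>

datatype monomial = Gen | Prod monomial monomial

primrec monomial_degree :: "monomial \<Rightarrow> nat" where
  "monomial_degree Gen = 1"
| "monomial_degree (Prod s t) = monomial_degree s + monomial_degree t"

definition free_superalg :: "('f::field, monomial \<Rightarrow>\<^sub>0 'f) superalg" where
  "free_superalg =
     \<lparr>carrier = UNIV,
      scalar = (\<lambda>c. Poly_Mapping.map (\<lambda>d. c * d)),
      mul = (\<lambda>p q. \<Sum>s\<in>Poly_Mapping.keys p. \<Sum>t\<in>Poly_Mapping.keys q.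
        Poly_Mapping.single (Prod s t) (Poly_Mapping.lookup p s * Poly_Mapping.lookup q t)),
      even_part = {p. \<forall>t\<in>Poly_Mapping.keys p. even (monomial_degree t)},
      odd_part = {p. \<forall>t\<in>Poly_Mapping.keys p. odd (monomial_degree t)}\<rparr>"

text \<open>
  The smallest ideal of the free superalgebra whose quotient is a $(-1,1)$-superalgebra: it is
  generated by the coefficients, at the basis vectors \<open>e\<^sub>A\<close>, of the values of the two defining
  identities on the Grassmann envelope.
\<close>

inductive_set minus_one_one_ideal :: "(monomial \<Rightarrow>\<^sub>0 'f::field) set" where
  right_alt: "u \<in> carrier (grassmann_envelope free_superalg) \<Longrightarrow>
    v \<in> carrier (grassmann_envelope free_superalg) \<Longrightarrow>
    Poly_Mapping.lookup (associator (grassmann_envelope free_superalg) u v v) A \<in> minus_one_one_ideal"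
| cyclic: "u \<in> carrier (grassmann_envelope free_superalg) \<Longrightarrow>
    v \<in> carrier (grassmann_envelope free_superalg) \<Longrightarrow>
    w \<in> carrier (grassmann_envelope free_superalg) \<Longrightarrow>
    Poly_Mapping.lookup
      (associator (grassmann_envelope free_superalg) u v w +
       associator (grassmann_envelope free_superalg) v w u +
       associator (grassmann_envelope free_superalg) w u v) A \<in> minus_one_one_ideal"
| add: "p \<in> minus_one_one_ideal \<Longrightarrow> q \<in> minus_one_one_ideal \<Longrightarrow> p + q \<in> minus_one_one_ideal"
| scalar: "p \<in> minus_one_one_ideal \<Longrightarrow> scalar free_superalg c p \<in> minus_one_one_ideal"
| mul_left: "p \<in> minus_one_one_ideal \<Longrightarrow> mul free_superalg q p \<in> minus_one_one_ideal"
| mul_right: "p \<in> minus_one_one_ideal \<Longrightarrow> mul free_superalg p q \<in> minus_one_one_ideal"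


subsection \<open>Sums over the support\<close>

definition ksum :: "('k \<Rightarrow> 'v::zero \<Rightarrow> 'w::comm_monoid_add) \<Rightarrow> ('k \<Rightarrow>\<^sub>0 'v) \<Rightarrow> 'w" where
  "ksum h u = (\<Sum>k\<in>Poly_Mapping.keys u. h k (Poly_Mapping.lookup u k))"

lemma ksum_superset:
  assumes "finite S" "Poly_Mapping.keys u \<subseteq> S" "\<And>k. h k 0 = 0"
  shows "ksum h u = (\<Sum>k\<in>S. h k (Poly_Mapping.lookup u k))"
  unfolding ksum_def using assms
  by (intro sum.mono_neutral_left) (auto simp: in_keys_iff)

lemma ksum_zero [simp]: "ksum h 0 = 0"
  by (simp add: ksum_def)

lemma ksum_add:
  assumes "\<And>k. h k 0 = 0"
    and "\<And>k. h k (Poly_Mapping.lookup u k + Poly_Mapping.lookup v k) =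
          h k (Poly_Mapping.lookup u k) + h k (Poly_Mapping.lookup v k)"
  shows "ksum h (u + v) = ksum h u + ksum h v"
proof -
  let ?S = "Poly_Mapping.keys u \<union> Poly_Mapping.keys v"
  have "Poly_Mapping.keys (u + v) \<subseteq> ?S" by (rule Poly_Mapping.keys_add)
  then show ?thesis
    using assms by (simp add: ksum_superset[of ?S] lookup_add sum.distrib)
qed

lemma ksum_single:
  assumes "h k 0 = 0"
  shows "ksum h (Poly_Mapping.single k a) = h k a"
  using assms by (cases "a = 0") (simp_all add: ksum_def)

lemma ksum_map:
  assumes "f 0 = 0" "\<And>k. h k 0 = 0"
  shows "ksum h (Poly_Mapping.map f u) = ksum (\<lambda>k a. h k (f a)) u"
proof -
  have l: "Poly_Mapping.lookup (Poly_Mapping.map f u) k = f (Poly_Mapping.lookup u k)" for k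
    using assms(1) by (simp add: map.rep_eq when_def)
  have "Poly_Mapping.keys (Poly_Mapping.map f u) \<subseteq> Poly_Mapping.keys u"
    using assms(1) by (auto simp: in_keys_iff l)
  then show ?thesis
    using assms(2) by (subst ksum_superset[of "Poly_Mapping.keys u"]) (simp_all add: l ksum_def)
qed

lemma lookup_map0: "f 0 = 0 \<Longrightarrow>
  Poly_Mapping.lookup (Poly_Mapping.map f u) k = f (Poly_Mapping.lookup u k)"
  by (simp add: map.rep_eq when_def)

lemma ksum_cong:
  "(\<And>k. k \<in> Poly_Mapping.keys u \<Longrightarrow> h k (Poly_Mapping.lookup u k) = h' k (Poly_Mapping.lookup u k)) \<Longrightarrow> ksum h u = ksum h' u"
  by (simp add: ksum_def)

lemma ksum_fun_add: "ksum (\<lambda>k a. h k a + h' k a) u = ksum h u + ksum h' u"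
  by (simp add: ksum_def sum.distrib)

lemma ksum_hom:
  fixes h :: "'k \<Rightarrow> 'v::zero \<Rightarrow> 'w::comm_monoid_add" and g :: "'w \<Rightarrow> 'w2::comm_monoid_add"
  assumes "g 0 = 0" "\<And>x y. g (x + y) = g x + g y"
  shows "g (ksum h u) = ksum (\<lambda>k a. g (h k a)) u"
proof -
  have "g (sum f S) = (\<Sum>k\<in>S. g (f k))" for f :: "'k \<Rightarrow> 'w" and S
    using assms by (induction S rule: infinite_finite_induct) simp_all
  then show ?thesis by (simp add: ksum_def)
qed

lemma ksum_id: "ksum Poly_Mapping.single u = u"
  by (rule poly_mapping_eqI)
     (simp add: ksum_def lookup_sum lookup_single when_def sum.delta in_keys_iff)


lemma poly_mapping_add_induct [case_names zero single plus]:
  fixes p :: "'k \<Rightarrow>\<^sub>0 'v::ab_group_add"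
  assumes "P 0" "\<And>t c. P (Poly_Mapping.single t c)" "\<And>p q. P p \<Longrightarrow> P q \<Longrightarrow> P (p + q)"
  shows "P p"
proof -
  have "P (\<Sum>t\<in>S. Poly_Mapping.single t (Poly_Mapping.lookup p t))" for S
    by (induction S rule: infinite_finite_induct) (simp_all add: assms)
  then show ?thesis by (metis ksum_def ksum_id)
qed


subsection \<open>The free nonassociative superalgebra\<close>

lemma free_carrier [simp]: "carrier free_superalg = UNIV"
  by (simp add: free_superalg_def)

lemma free_scalar: "scalar free_superalg c = Poly_Mapping.map (\<lambda>d. c * d)"
  by (simp add: free_superalg_def)

lemma lookup_free_scalar [simp]:
  "Poly_Mapping.lookup (scalar free_superalg c p) t = c * Poly_Mapping.lookup p t"
  by (simp add: free_scalar lookup_map0)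

lemma free_mul: "mul free_superalg p q =
    ksum (\<lambda>s a. ksum (\<lambda>t b. Poly_Mapping.single (Prod s t) (a * b)) q) p"
  by (simp add: free_superalg_def ksum_def)

lemma ksum_fun_0 [simp]: "ksum (\<lambda>_ _. 0) q = 0"
  by (simp add: ksum_def)

lemma free_mul_add_left: "mul free_superalg (p + p') q = mul free_superalg p q + mul free_superalg p' q"
  unfolding free_mul by (rule ksum_add) (simp_all add: distrib_right single_add ksum_fun_add)

lemma free_mul_add_right: "mul free_superalg p (q + q') = mul free_superalg p q + mul free_superalg p q'"
  unfolding free_mul ksum_fun_add[symmetric]
  by (rule ksum_cong, rule ksum_add) (simp_all add: distrib_left single_add)

lemma free_scalar_add: "scalar free_superalg c (p + q) = scalar free_superalg c p + scalar free_superalg c q"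
  by (rule poly_mapping_eqI) (simp add: lookup_add distrib_left)

lemma free_scalar_0 [simp]: "scalar free_superalg c 0 = 0"
  by (rule poly_mapping_eqI) simp

lemma free_scalar_single:
  "scalar free_superalg c (Poly_Mapping.single t a) = Poly_Mapping.single t (c * a)"
  by (rule poly_mapping_eqI) (simp add: lookup_single when_def)

lemma ksum_free_scalar: "scalar free_superalg c (ksum h u) = ksum (\<lambda>k a. scalar free_superalg c (h k a)) u"
  by (rule ksum_hom) (simp_all add: free_scalar_add)

lemma ksum_free_scalar_arg:
  "(\<And>k. h k 0 = 0) \<Longrightarrow> ksum h (scalar free_superalg c p) = ksum (\<lambda>k a. h k (c * a)) p"
  unfolding free_scalar by (rule ksum_map) simp_all

lemma free_mul_scalar_left:
  "mul free_superalg (scalar free_superalg c p) q = scalar free_superalg c (mul free_superalg p q)"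
  unfolding free_mul
  by (simp add: ksum_free_scalar ksum_free_scalar_arg mult.assoc free_scalar_single)

lemma free_mul_scalar_right:
  "mul free_superalg p (scalar free_superalg c q) = scalar free_superalg c (mul free_superalg p q)"
  unfolding free_mul
  by (simp add: ksum_free_scalar ksum_free_scalar_arg mult.left_commute free_scalar_single)

lemma free_vector_space: "vector_space (scalar free_superalg)"
  by unfold_locales (auto intro!: poly_mapping_eqI simp: lookup_add algebra_simps)

lemma free_part: "part free_superalg n =
    {p. \<forall>t\<in>Poly_Mapping.keys p. even (monomial_degree t) = even n}"
  by (auto simp: part_def free_superalg_def)

lemma free_part_iff: "p \<in> part free_superalg n \<longleftrightarrow>
    (\<forall>t. even (monomial_degree t) \<noteq> even n \<longrightarrow> Poly_Mapping.lookup p t = 0)"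
  by (auto simp: free_part in_keys_iff)

lemma free_part_subspace: "module.subspace (scalar free_superalg) (part free_superalg n)"
proof -
  interpret vector_space "scalar free_superalg" by (rule free_vector_space)
  show ?thesis by (rule subspaceI) (auto simp: free_part_iff lookup_add)
qed

lemma free_superalgebra: "superalgebra (free_superalg :: ('f::field, monomial \<Rightarrow>\<^sub>0 'f) superalg)"
proof -
  interpret vector_space "scalar (free_superalg :: ('f::field, monomial \<Rightarrow>\<^sub>0 'f) superalg)"
    by (rule free_vector_space)
  let ?F = "free_superalg :: ('f::field, monomial \<Rightarrow>\<^sub>0 'f) superalg"
  have ev: "even_part ?F = part ?F 0" and od: "odd_part ?F = part ?F 1"
    by (simp_all add: part_def)
  have dec: "\<exists>x y. p = x + y \<and> x \<in> part ?F 0 \<and> y \<in> part ?F 1" for p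
  proof -
    define x where "x = ksum (\<lambda>t a. if even (monomial_degree t) then Poly_Mapping.single t a else 0) p"
    define y where "y = ksum (\<lambda>t a. if even (monomial_degree t) then 0 else Poly_Mapping.single t a) p"
    have "x + y = p"
      unfolding x_def y_def ksum_fun_add[symmetric]
      by (subst (2) ksum_id[symmetric], rule ksum_cong) simp
    moreover have "x \<in> part ?F 0" "y \<in> part ?F 1"
      by (auto simp: free_part_iff x_def y_def ksum_def lookup_sum lookup_single when_def
          intro!: sum.neutral)
    ultimately show ?thesis by blast
  qed
  have ml: "mul ?F x y \<in> part ?F (i + j)" if "x \<in> part ?F i" "y \<in> part ?F j" for x y i j
    unfolding free_mul ksum_def
    using that
    by (intro subspace_sum[OF free_part_subspace])
       (auto simp: free_part lookup_single when_def split: if_splits)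
  show ?thesis
  proof
    show "subspace (carrier ?F)" by simp
    show "subspace (even_part ?F)" "subspace (odd_part ?F)"
      unfolding ev od by (rule free_part_subspace)+
    show "even_part ?F \<inter> odd_part ?F = {0}"
    proof -
      have "p = 0" if "p \<in> part ?F 0" "p \<in> part ?F 1" for p
        by (rule poly_mapping_eqI) (use that in \<open>auto simp: free_part_iff\<close>)
      then show ?thesis
        unfolding ev od by (auto simp: free_part_iff)
    qed
    show "carrier ?F = {x + y |x y. x \<in> even_part ?F \<and> y \<in> odd_part ?F}"
      using dec unfolding ev od by auto
  qed (simp_all add: free_mul_add_left free_mul_add_right free_mul_scalar_left free_mul_scalar_right ml)
qed


subsection \<open>The quotient\<close>

lemma ideal_zero: "0 \<in> minus_one_one_ideal"
proof -
  have "0 \<in> carrier (grassmann_envelope free_superalg)"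
    by (simp add: grassmann_envelope_def free_part_iff)
  from right_alt[OF this this, of "{||}"] show ?thesis
    by (simp add: associator_def grassmann_envelope_def)
qed

lemma ideal_uminus: "p \<in> minus_one_one_ideal \<Longrightarrow> - p \<in> minus_one_one_ideal"
proof -
  assume "p \<in> minus_one_one_ideal"
  then have "scalar free_superalg (-1) p \<in> minus_one_one_ideal" by (rule minus_one_one_ideal.scalar)
  also have "scalar free_superalg (-1) p = - p" by (rule poly_mapping_eqI) simp
  finally show ?thesis .
qed

lemma ideal_diff: "p \<in> minus_one_one_ideal \<Longrightarrow> q \<in> minus_one_one_ideal \<Longrightarrow> p - q \<in> minus_one_one_ideal"
  using add[OF _ ideal_uminus] by fastforce

quotient_type (overloaded) 'f free11 = "monomial \<Rightarrow>\<^sub>0 ('f::field)" /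
  "\<lambda>p q. p - q \<in> minus_one_one_ideal"
proof (rule equivpI)
  show "reflp (\<lambda>p q :: monomial \<Rightarrow>\<^sub>0 'f. p - q \<in> minus_one_one_ideal)"
    by (simp add: reflp_def ideal_zero)
  show "symp (\<lambda>p q :: monomial \<Rightarrow>\<^sub>0 'f. p - q \<in> minus_one_one_ideal)"
    by (rule sympI) (use ideal_uminus in fastforce)
  show "transp (\<lambda>p q :: monomial \<Rightarrow>\<^sub>0 'f. p - q \<in> minus_one_one_ideal)"
    by (rule transpI) (use add in fastforce)
qed

instantiation free11 :: (field) ab_group_add
begin

lift_definition zero_free11 :: "'a free11" is 0 .
lift_definition plus_free11 :: "'a free11 \<Rightarrow> 'a free11 \<Rightarrow> 'a free11" is "(+)"
  by (simp add: add_diff_add add)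
lift_definition minus_free11 :: "'a free11 \<Rightarrow> 'a free11 \<Rightarrow> 'a free11" is "(-)"
proof -
  fix p p' q q' :: "monomial \<Rightarrow>\<^sub>0 'a"
  assume "p - p' \<in> minus_one_one_ideal" "q - q' \<in> minus_one_one_ideal"
  then have "(p - p') - (q - q') \<in> minus_one_one_ideal" by (rule ideal_diff)
  then show "p - q - (p' - q') \<in> minus_one_one_ideal" by (simp add: algebra_simps)
qed
lift_definition uminus_free11 :: "'a free11 \<Rightarrow> 'a free11" is uminus
proof -
  fix p p' :: "monomial \<Rightarrow>\<^sub>0 'a"
  assume "p - p' \<in> minus_one_one_ideal"
  then have "- (p - p') \<in> minus_one_one_ideal" by (rule ideal_uminus)
  then show "- p - - p' \<in> minus_one_one_ideal" by simp
qed

instance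
proof
  fix a b c :: "'a free11"
  show "a + b + c = a + (b + c)" by transfer (simp add: add.assoc ideal_zero)
  show "a + b = b + a" by transfer (simp add: add.commute ideal_zero)
  show "0 + a = a" by transfer (simp add: ideal_zero)
  show "- a + a = 0" by transfer (simp add: ideal_zero)
  show "a - b = a + - b" by transfer (simp add: ideal_zero)
qed

end

lift_definition free11_scalar :: "'f::field \<Rightarrow> 'f free11 \<Rightarrow> 'f free11" is "scalar free_superalg"
proof -
  fix c :: 'f and p q :: "monomial \<Rightarrow>\<^sub>0 'f"
  assume "p - q \<in> minus_one_one_ideal"
  then have "scalar free_superalg c (p - q) \<in> minus_one_one_ideal" by (rule minus_one_one_ideal.scalar)
  also have "scalar free_superalg c (p - q) = scalar free_superalg c p - scalar free_superalg c q"
    by (rule poly_mapping_eqI) (simp add: lookup_minus right_diff_distrib)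
  finally show "scalar free_superalg c p - scalar free_superalg c q \<in> minus_one_one_ideal" .
qed

lift_definition free11_mul :: "'f::field free11 \<Rightarrow> 'f free11 \<Rightarrow> 'f free11" is "mul free_superalg"
proof -
  fix p p' q q' :: "monomial \<Rightarrow>\<^sub>0 'f"
  assume "p - p' \<in> minus_one_one_ideal" "q - q' \<in> minus_one_one_ideal"
  then have "mul free_superalg (p - p') q + mul free_superalg p' (q - q') \<in> minus_one_one_ideal"
    by (intro minus_one_one_ideal.intros)
  also have "mul free_superalg (p - p') q + mul free_superalg p' (q - q') =
      mul free_superalg p q - mul free_superalg p' q'"
    using free_mul_add_left[of "p - p'" p' q] free_mul_add_right[of p' "q - q'" q'] by simp
  finally show "mul free_superalg p q - mul free_superalg p' q' \<in> minus_one_one_ideal" .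
qed

lift_definition free11_gen :: "'f::field free11" is "Poly_Mapping.single Gen 1" .

definition free11_superalg :: "('f::field, 'f free11) superalg" where
  "free11_superalg =
     \<lparr>carrier = UNIV,
      scalar = free11_scalar,
      mul = free11_mul,
      even_part = abs_free11 ` even_part free_superalg,
      odd_part = abs_free11 ` odd_part free_superalg\<rparr>"


subsection \<open>The Grassmann envelope is an algebra\<close>

context algebra
begin

lemma zero_carrier: "0 \<in> carrier A"
  using subspace_carrier by (rule subspace_0)

lemma mul_zero_left: "y \<in> carrier A \<Longrightarrow> mul A 0 y = 0"
  using mul_add_left[OF zero_carrier zero_carrier] by simp

lemma mul_zero_right: "x \<in> carrier A \<Longrightarrow> mul A x 0 = 0"
  using mul_add_right[OF _ zero_carrier zero_carrier] by simp

end

context superalgebra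
begin

lemma part_subspace: "subspace (part X n)"
  by (simp add: part_def subspace_even subspace_odd)

lemma part_carrier: "x \<in> part X n \<Longrightarrow> x \<in> carrier X"
  unfolding carrier_eq part_def
  using subspace_0[OF subspace_even] subspace_0[OF subspace_odd]
  by (metis (mono_tags, lifting) add.left_neutral add.right_neutral mem_Collect_eq)

end

lemma env_carrier: "u \<in> carrier (grassmann_envelope X) \<longleftrightarrow>
    (\<forall>A. Poly_Mapping.lookup u A \<in> part X (fcard A))"
  by (simp add: grassmann_envelope_def)

lemma env_mul: "mul (grassmann_envelope X) u v =
    ksum (\<lambda>A a. ksum (\<lambda>B b. Poly_Mapping.single (A |\<union>| B)
      (scalar X (grassmann_sign A B) (mul X a b))) v) u"
  by (simp add: grassmann_envelope_def ksum_def)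

lemma env_scalar: "scalar (grassmann_envelope X) c = Poly_Mapping.map (scalar X c)"
  by (simp add: grassmann_envelope_def)

context superalgebra
begin

lemma lookup_env_scalar:
  "Poly_Mapping.lookup (scalar (grassmann_envelope X) c u) A = scalar X c (Poly_Mapping.lookup u A)"
  by (simp add: env_scalar lookup_map0)

lemma env_scalar_add:
  "scalar (grassmann_envelope X) c (u + v) =
   scalar (grassmann_envelope X) c u + scalar (grassmann_envelope X) c v"
  by (rule poly_mapping_eqI) (simp add: lookup_env_scalar lookup_add scale_right_distrib)

lemma env_scalar_single:
  "scalar (grassmann_envelope X) c (Poly_Mapping.single A a) = Poly_Mapping.single A (scalar X c a)"
  by (rule poly_mapping_eqI) (simp add: lookup_env_scalar lookup_single when_def)

lemma env_scalar_ksum: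
  "scalar (grassmann_envelope X) c (ksum h u) = ksum (\<lambda>k a. scalar (grassmann_envelope X) c (h k a)) u"
  by (rule ksum_hom) (auto intro!: poly_mapping_eqI simp: lookup_env_scalar env_scalar_add)

lemma env_lookup_carrier:
  "u \<in> carrier (grassmann_envelope X) \<Longrightarrow> Poly_Mapping.lookup u A \<in> carrier X"
  using part_carrier env_carrier by blast

lemma env_mul_add_left:
  assumes "u \<in> carrier (grassmann_envelope X)" "u' \<in> carrier (grassmann_envelope X)"
    "v \<in> carrier (grassmann_envelope X)"
  shows "mul (grassmann_envelope X) (u + u') v =
    mul (grassmann_envelope X) u v + mul (grassmann_envelope X) u' v"
  unfolding env_mul
proof (rule ksum_add)
  show "ksum (\<lambda>B b. Poly_Mapping.single (k |\<union>| B) (scalar X (grassmann_sign k B) (mul X 0 b))) v = 0" for k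
    by (simp add: ksum_def mul_zero_left env_lookup_carrier assms)
qed (simp add: ksum_def mul_add_left env_lookup_carrier assms scale_right_distrib single_add sum.distrib)

lemma env_mul_add_right:
  assumes "u \<in> carrier (grassmann_envelope X)" "v \<in> carrier (grassmann_envelope X)"
    "v' \<in> carrier (grassmann_envelope X)"
  shows "mul (grassmann_envelope X) u (v + v') =
    mul (grassmann_envelope X) u v + mul (grassmann_envelope X) u v'"
  unfolding env_mul ksum_fun_add[symmetric]
  by (rule ksum_cong, rule ksum_add)
     (simp_all add: mul_add_right mul_zero_right env_lookup_carrier assms scale_right_distrib single_add)

lemma env_mul_scalar_left:
  assumes "u \<in> carrier (grassmann_envelope X)" "v \<in> carrier (grassmann_envelope X)"
  shows "mul (grassmann_envelope X) (scalar (grassmann_envelope X) c u) v =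
    scalar (grassmann_envelope X) c (mul (grassmann_envelope X) u v)"
  unfolding env_mul env_scalar_ksum env_scalar_single
proof (subst env_scalar, subst ksum_map)
  show "ksum (\<lambda>B b. Poly_Mapping.single (k |\<union>| B) (scalar X (grassmann_sign k B) (mul X 0 b))) v = 0" for k
    by (simp add: ksum_def mul_zero_left env_lookup_carrier assms)
qed (simp_all add: ksum_def mul_scalar_left env_lookup_carrier assms mult.commute)

lemma env_mul_scalar_right:
  assumes "u \<in> carrier (grassmann_envelope X)" "v \<in> carrier (grassmann_envelope X)"
  shows "mul (grassmann_envelope X) u (scalar (grassmann_envelope X) c v) =
    scalar (grassmann_envelope X) c (mul (grassmann_envelope X) u v)"
  unfolding env_mul env_scalar_ksum env_scalar_single
  by (rule ksum_cong, subst env_scalar, subst ksum_map)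
     (simp_all add: ksum_def mul_zero_right mul_scalar_right env_lookup_carrier assms mult.commute)

lemma env_mul_closed:
  assumes u: "u \<in> carrier (grassmann_envelope X)" and v: "v \<in> carrier (grassmann_envelope X)"
  shows "mul (grassmann_envelope X) u v \<in> carrier (grassmann_envelope X)"
  unfolding env_carrier
proof
  fix C
  have *: "Poly_Mapping.lookup (Poly_Mapping.single (A |\<union>| B) (scalar X (grassmann_sign A B)
      (mul X (Poly_Mapping.lookup u A) (Poly_Mapping.lookup v B)))) C \<in> part X (fcard C)" for A B
  proof (cases "A |\<inter>| B = {||} \<and> A |\<union>| B = C")
    case True
    then have "fcard C = fcard A + fcard B" by (auto simp: fcard_funion_disjoint)
    moreover have "mul X (Poly_Mapping.lookup u A) (Poly_Mapping.lookup v B) \<in> part X (fcard A + fcard B)"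
      using u v unfolding env_carrier by (intro mul_part) auto
    ultimately show ?thesis
      using True by (simp add: lookup_single subspace_scale[OF part_subspace])
  next
    case False
    then show ?thesis
      using subspace_0[OF part_subspace] by (auto simp: lookup_single when_def grassmann_sign_def)
  qed
  show "Poly_Mapping.lookup (mul (grassmann_envelope X) u v) C \<in> part X (fcard C)"
    unfolding env_mul ksum_def lookup_sum by (intro subspace_sum[OF part_subspace] *)
qed

lemma env_algebra: "algebra (grassmann_envelope X)"
proof -
  interpret E: vector_space "scalar (grassmann_envelope X)"
    by unfold_locales
       (auto intro!: poly_mapping_eqI simp: lookup_env_scalar lookup_add scale_right_distrib scale_left_distrib)
  show ?thesis
  proof
    show "E.subspace (carrier (grassmann_envelope X))"
      by (rule E.subspaceI)
         (auto simp: env_carrier lookup_add lookup_env_scalar subspace_0 subspace_add subspace_scale part_subspace)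
  qed (simp_all add: env_mul_closed env_mul_add_left env_mul_add_right env_mul_scalar_left env_mul_scalar_right)
qed

lemma env_associator_closed:
  assumes "u \<in> carrier (grassmann_envelope X)" "v \<in> carrier (grassmann_envelope X)"
    "w \<in> carrier (grassmann_envelope X)"
  shows "associator (grassmann_envelope X) u v w \<in> carrier (grassmann_envelope X)"
proof -
  interpret E: algebra "grassmann_envelope X" by (rule env_algebra)
  show ?thesis
    unfolding associator_def
    using assms by (intro E.subspace_diff[OF E.subspace_carrier] env_mul_closed)
qed

end

lemma env_hom:
  fixes X :: "('f::field, 'b::ab_group_add, 'y) superalg_scheme"
    and Y :: "('f, 'c::ab_group_add, 'z) superalg_scheme"
  assumes Y: "superalgebra Y" and UX: "carrier X = UNIV" and h: "superalg_hom \<phi> X Y"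
    and im: "\<And>x. \<phi> x \<in> carrier Y"
  shows "Poly_Mapping.map \<phi> (mul (grassmann_envelope X) u v) =
    mul (grassmann_envelope Y) (Poly_Mapping.map \<phi> u) (Poly_Mapping.map \<phi> v)"
proof -
  interpret Y: superalgebra Y by (rule Y)
  have add: "\<phi> (x + y) = \<phi> x + \<phi> y" for x y using h UX by (simp add: superalg_hom_def)
  have [simp]: "\<phi> 0 = 0" using add[of 0 0] by simp
  have sm: "\<phi> (scalar X c (mul X x y)) = scalar Y c (mul Y (\<phi> x) (\<phi> y))" for c x y
    using h UX by (simp add: superalg_hom_def)
  let ?m = "Poly_Mapping.map \<phi>"
  have mk: "?m (ksum f w) = ksum (\<lambda>k a. ?m (f k a)) w" for f and w :: "nat fset \<Rightarrow>\<^sub>0 'b"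
    by (rule ksum_hom) (auto intro!: poly_mapping_eqI simp: lookup_map0 lookup_add add)
  have ms: "?m (Poly_Mapping.single k a) = Poly_Mapping.single k (\<phi> a)" for k a
    by simp
  have "mul (grassmann_envelope Y) (?m u) (?m v) =
      ksum (\<lambda>A a. ksum (\<lambda>B b. Poly_Mapping.single (A |\<union>| B)
        (scalar Y (grassmann_sign A B) (mul Y (\<phi> a) b))) (?m v)) u"
    unfolding env_mul
    by (rule ksum_map) (simp, subst ksum_def, simp add: lookup_map0 Y.mul_zero_left im)
  also have "\<dots> = ksum (\<lambda>A a. ksum (\<lambda>B b. Poly_Mapping.single (A |\<union>| B)
        (scalar Y (grassmann_sign A B) (mul Y (\<phi> a) (\<phi> b)))) v) u"
    by (rule ksum_cong, rule ksum_map) (simp_all add: Y.mul_zero_right im)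
  also have "\<dots> = ?m (mul (grassmann_envelope X) u v)"
    unfolding env_mul mk ms sm ..
  finally show ?thesis ..
qed

lemma env_hom_associator:
  assumes "superalgebra Y" "carrier X = UNIV" "superalg_hom \<phi> X Y" "\<And>x. \<phi> x \<in> carrier Y"
  shows "Poly_Mapping.map \<phi> (associator (grassmann_envelope X) u v w) =
    associator (grassmann_envelope Y) (Poly_Mapping.map \<phi> u) (Poly_Mapping.map \<phi> v) (Poly_Mapping.map \<phi> w)"
proof -
  have add: "\<phi> (x + y) = \<phi> x + \<phi> y" for x y using assms(2,3) by (simp add: superalg_hom_def)
  have z: "\<phi> 0 = 0" using add[of 0 0] by simp
  have d: "\<phi> (x - y) = \<phi> x - \<phi> y" for x y using add[of "x - y" y] by simp
  have "Poly_Mapping.map \<phi> (p - q) = Poly_Mapping.map \<phi> p - Poly_Mapping.map \<phi> q" for p q :: "nat fset \<Rightarrow>\<^sub>0 _"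
    by (rule poly_mapping_eqI) (simp add: lookup_map0 lookup_minus z d)
  then show ?thesis by (simp add: associator_def env_hom[OF assms])
qed

lemma env_hom_carrier:
  assumes "superalg_hom \<phi> X Y" "\<phi> 0 = 0" "u \<in> carrier (grassmann_envelope X)"
  shows "Poly_Mapping.map \<phi> u \<in> carrier (grassmann_envelope Y)"
proof -
  have "\<phi> x \<in> part Y n" if "x \<in> part X n" for x n
    using assms(1) that by (auto simp: superalg_hom_def part_def split: if_splits)
  then show ?thesis using assms(2,3) by (simp add: env_carrier lookup_map0)
qed


subsection \<open>\<open>free11_superalg\<close> is a $(-1,1)$-superalgebra\<close>

interpretation F: superalgebra free_superalg by (rule free_superalgebra)

lemma ideal_graded:
  assumes "p \<in> minus_one_one_ideal"
  shows "\<exists>x y. p = x + y \<and> x \<in> minus_one_one_ideal \<inter> part free_superalg 0 \<and>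
    y \<in> minus_one_one_ideal \<inter> part free_superalg 1"
proof -
  let ?T = minus_one_one_ideal and ?P = "part free_superalg"
  have hom: "\<exists>x y. p = x + y \<and> x \<in> ?T \<inter> ?P 0 \<and> y \<in> ?T \<inter> ?P 1"
    if "p \<in> ?T" "p \<in> ?P n" for p n
  proof (cases "even n")
    case True
    then have "p \<in> ?P 0" using that by (simp add: part_def)
    then show ?thesis
      using that ideal_zero F.subspace_0[OF F.part_subspace] by (intro exI[of _ p] exI[of _ 0]) auto
  next
    case False
    then have "p \<in> ?P 1" using that by (simp add: part_def)
    then show ?thesis
      using that ideal_zero F.subspace_0[OF F.part_subspace] by (intro exI[of _ 0] exI[of _ p]) auto
  qed
  have split: "\<exists>q0 q1. q = q0 + q1 \<and> q0 \<in> ?P 0 \<and> q1 \<in> ?P 1" for q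
  proof -
    have "q \<in> {x + y |x y. x \<in> even_part free_superalg \<and> y \<in> odd_part free_superalg}"
      unfolding F.carrier_eq[symmetric] by simp
    then show ?thesis by (auto simp: part_def)
  qed
  from assms show ?thesis
  proof induction
    case (right_alt u v A)
    then show ?case
      by (intro hom[of _ "fcard A"] minus_one_one_ideal.right_alt)
         (use F.env_associator_closed env_carrier in blast)+
  next
    case (cyclic u v w A)
    have "associator (grassmann_envelope free_superalg) u v w +
       associator (grassmann_envelope free_superalg) v w u +
       associator (grassmann_envelope free_superalg) w u v \<in> carrier (grassmann_envelope free_superalg)"
    proof -
      interpret E: algebra "grassmann_envelope free_superalg" by (rule F.env_algebra)
      show ?thesis
        by (intro E.subspace_add[OF E.subspace_carrier] F.env_associator_closed cyclic)
    qed
    then show ?case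
      using cyclic by (intro hom[of _ "fcard A"] minus_one_one_ideal.cyclic) (auto simp: env_carrier)
  next
    case (add p q)
    then obtain x y x' y' where "p = x + y" "x \<in> ?T \<inter> ?P 0" "y \<in> ?T \<inter> ?P 1"
      "q = x' + y'" "x' \<in> ?T \<inter> ?P 0" "y' \<in> ?T \<inter> ?P 1" by blast
    then show ?case
      by (intro exI[of _ "x + x'"] exI[of _ "y + y'"])
         (auto intro: minus_one_one_ideal.add F.subspace_add[OF F.part_subspace])
  next
    case (scalar p c)
    then obtain x y where "p = x + y" "x \<in> ?T \<inter> ?P 0" "y \<in> ?T \<inter> ?P 1" by blast
    then show ?case
      by (intro exI[of _ "scalar free_superalg c x"] exI[of _ "scalar free_superalg c y"])
         (auto simp: free_scalar_add intro: minus_one_one_ideal.scalar F.subspace_scale[OF F.part_subspace])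
  next
    case (mul_left p q)
    then obtain x y where p: "p = x + y" "x \<in> ?T" "x \<in> ?P 0" "y \<in> ?T" "y \<in> ?P 1" by blast
    obtain q0 q1 where q: "q = q0 + q1" "q0 \<in> ?P 0" "q1 \<in> ?P 1" using split by blast
    let ?m = "mul free_superalg"
    have "?m q0 x \<in> ?P 0" "?m q1 y \<in> ?P 0" "?m q0 y \<in> ?P 1" "?m q1 x \<in> ?P 1"
      using F.mul_part[OF q(2) p(3)] F.mul_part[OF q(3) p(5)] F.mul_part[OF q(2) p(5)]
        F.mul_part[OF q(3) p(3)] by (simp_all add: part_def)
    with p show ?case
      by (intro exI[of _ "?m q0 x + ?m q1 y"] exI[of _ "?m q0 y + ?m q1 x"])
         (auto simp: q(1) free_mul_add_left free_mul_add_right algebra_simps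
           intro!: minus_one_one_ideal.add minus_one_one_ideal.mul_left F.subspace_add[OF F.part_subspace])
  next
    case (mul_right p q)
    then obtain x y where p: "p = x + y" "x \<in> ?T" "x \<in> ?P 0" "y \<in> ?T" "y \<in> ?P 1" by blast
    obtain q0 q1 where q: "q = q0 + q1" "q0 \<in> ?P 0" "q1 \<in> ?P 1" using split by blast
    let ?m = "mul free_superalg"
    have "?m x q0 \<in> ?P 0" "?m y q1 \<in> ?P 0" "?m y q0 \<in> ?P 1" "?m x q1 \<in> ?P 1"
      using F.mul_part[OF p(3) q(2)] F.mul_part[OF p(5) q(3)] F.mul_part[OF p(5) q(2)]
        F.mul_part[OF p(3) q(3)] by (simp_all add: part_def)
    with p show ?case
      by (intro exI[of _ "?m x q0 + ?m y q1"] exI[of _ "?m y q0 + ?m x q1"])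
         (auto simp: q(1) free_mul_add_left free_mul_add_right algebra_simps
           intro!: minus_one_one_ideal.add minus_one_one_ideal.mul_right F.subspace_add[OF F.part_subspace])
  qed
qed

lemma abs_free11_eq_iff: "abs_free11 p = abs_free11 q \<longleftrightarrow> p - q \<in> minus_one_one_ideal"
  using free11.abs_eq_iff .

lemma abs_free11_zero: "abs_free11 p = 0 \<longleftrightarrow> p \<in> minus_one_one_ideal"
  unfolding zero_free11_def abs_free11_eq_iff by simp

lemma abs_free11_surj: obtains p where "x = abs_free11 p"
  by (metis Quotient_abs_rep[OF Quotient_free11])

lemmas abs_free11_simps = plus_free11.abs_eq free11_scalar.abs_eq free11_mul.abs_eq

lemma free11_part: "part free11_superalg n = abs_free11 ` part free_superalg n"
  by (simp add: part_def free11_superalg_def)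

lemma free11_sel [simp]: "carrier free11_superalg = UNIV" "scalar free11_superalg = free11_scalar"
  "mul free11_superalg = free11_mul"
  by (simp_all add: free11_superalg_def)

lemma free11_superalgebra: "superalgebra (free11_superalg :: ('f::field, 'f free11) superalg)"
proof -
  let ?F = "free11_superalg :: ('f::field, 'f free11) superalg"
  interpret Q: vector_space "scalar ?F"
  proof (unfold free11_sel, unfold_locales)
    fix a b :: 'f and x y :: "'f free11"
    obtain p where x: "x = abs_free11 p" by (rule abs_free11_surj)
    obtain q where y: "y = abs_free11 q" by (rule abs_free11_surj)
    show "free11_scalar a (x + y) = free11_scalar a x + free11_scalar a y"
      "free11_scalar (a + b) x = free11_scalar a x + free11_scalar b x"
      "free11_scalar a (free11_scalar b x) = free11_scalar (a * b) x"
      "free11_scalar 1 x = x"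
      by (simp_all add: x y abs_free11_simps[symmetric] free_scalar_add F.scale_left_distrib)
         (simp_all add: x y abs_free11_simps free_scalar_add F.scale_left_distrib)
  qed
  have sub: "Q.subspace (part ?F n)" for n
    unfolding free11_part
  proof (rule Q.subspaceI)
    show "0 \<in> abs_free11 ` part free_superalg n"
      using F.subspace_0[OF F.part_subspace] by (metis imageI zero_free11_def)
  next
    fix x y :: "'f free11"
    assume "x \<in> abs_free11 ` part free_superalg n" "y \<in> abs_free11 ` part free_superalg n"
    then show "x + y \<in> abs_free11 ` part free_superalg n"
      by (auto simp: abs_free11_simps intro!: imageI F.subspace_add[OF F.part_subspace])
  next
    fix c and x :: "'f free11"
    assume "x \<in> abs_free11 ` part free_superalg n"
    then show "scalar ?F c x \<in> abs_free11 ` part free_superalg n"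
      by (auto simp: abs_free11_simps intro!: imageI F.subspace_scale[OF F.part_subspace])
  qed
  have ev: "even_part ?F = part ?F 0" and od: "odd_part ?F = part ?F 1"
    by (simp_all add: part_def)
  show ?thesis
  proof
    show "Q.subspace (carrier ?F)" using Q.subspace_UNIV by simp
    show "Q.subspace (even_part ?F)" "Q.subspace (odd_part ?F)"
      unfolding ev od by (rule sub)+
    have "abs_free11 p = 0"
      if p: "p \<in> part free_superalg 0" and q: "q \<in> part free_superalg 1"
        and eq: "abs_free11 p = abs_free11 q" for p q :: "monomial \<Rightarrow>\<^sub>0 'f"
    proof -
      from eq have "p - q \<in> minus_one_one_ideal" by (simp add: abs_free11_eq_iff)
      from ideal_graded[OF this] obtain x y where xy: "p - q = x + y"
        "x \<in> minus_one_one_ideal" "x \<in> part free_superalg 0" "y \<in> part free_superalg 1" by blast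
      then have "p - x = q + y" by (simp add: algebra_simps)
      moreover have "p - x \<in> part free_superalg 0" "q + y \<in> part free_superalg 1"
        using p q xy by (auto intro: F.subspace_diff[OF F.part_subspace] F.subspace_add[OF F.part_subspace])
      ultimately have "p - x \<in> even_part free_superalg \<inter> odd_part free_superalg"
        by (simp add: part_def)
      then have "p = x" by (simp add: F.direct)
      then show ?thesis using xy by (simp add: abs_free11_zero)
    qed
    then have "part ?F 0 \<inter> part ?F 1 \<subseteq> {0}" unfolding free11_part by auto
    then show "even_part ?F \<inter> odd_part ?F = {0}"
      unfolding ev od using Q.subspace_0[OF sub] by auto
    have "\<exists>a b. x = a + b \<and> a \<in> even_part ?F \<and> b \<in> odd_part ?F" for x
    proof -
      obtain p where x: "x = abs_free11 p" by (rule abs_free11_surj)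
      obtain a b where "p = a + b" "a \<in> even_part free_superalg" "b \<in> odd_part free_superalg"
      proof -
        have "p \<in> {x + y |x y. x \<in> even_part free_superalg \<and> y \<in> odd_part free_superalg}"
          unfolding F.carrier_eq[symmetric] by simp
        then show thesis using that by blast
      qed
      then show ?thesis
        by (intro exI[of _ "abs_free11 a"] exI[of _ "abs_free11 b"])
           (simp add: x plus_free11.abs_eq free11_superalg_def)
    qed
    then show "carrier ?F = {x + y |x y. x \<in> even_part ?F \<and> y \<in> odd_part ?F}" by auto
    show "mul ?F x y \<in> part ?F (i + j)" if "x \<in> part ?F i" "y \<in> part ?F j" for x y i j
      using that unfolding free11_part by (auto simp: free11_mul.abs_eq intro!: imageI F.mul_part)
    fix x y z :: "'f free11" and c :: 'f
    obtain p where x: "x = abs_free11 p" by (rule abs_free11_surj)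
    obtain q where y: "y = abs_free11 q" by (rule abs_free11_surj)
    obtain r where z: "z = abs_free11 r" by (rule abs_free11_surj)
    show "mul ?F (x + y) z = mul ?F x z + mul ?F y z" "mul ?F x (y + z) = mul ?F x y + mul ?F x z"
      "mul ?F (scalar ?F c x) y = scalar ?F c (mul ?F x y)"
      "mul ?F x (scalar ?F c y) = scalar ?F c (mul ?F x y)"
      by (simp_all add: x y z abs_free11_simps free_mul_add_left free_mul_add_right
          free_mul_scalar_left free_mul_scalar_right)
  qed simp
qed

lemma abs_free11_hom: "superalg_hom abs_free11 free_superalg free11_superalg"
  by (auto simp: superalg_hom_def abs_free11_simps free11_superalg_def)

theorem free11_minus_one_one: "minus_one_one_superalgebra (free11_superalg :: ('f::field, 'f free11) superalg)"
proof -
  let ?F = "free11_superalg :: ('f::field, 'f free11) superalg"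
  let ?E = "grassmann_envelope ?F" and ?G = "grassmann_envelope (free_superalg :: ('f, _) superalg)"
  interpret Q: superalgebra ?F by (rule free11_superalgebra)
  have z: "abs_free11 0 = (0 :: 'f free11)" by (simp add: zero_free11_def)
  have lift: "\<exists>p \<in> carrier ?G. u = Poly_Mapping.map abs_free11 p" if "u \<in> carrier ?E" for u
  proof -
    have "\<forall>A. \<exists>p. p \<in> part free_superalg (fcard A) \<and> Poly_Mapping.lookup u A = abs_free11 p"
      using that unfolding env_carrier free11_part by blast
    then obtain f where f: "\<And>A. f A \<in> part free_superalg (fcard A)"
      "\<And>A. Poly_Mapping.lookup u A = abs_free11 (f A)" by metis
    define p where "p = (\<Sum>A\<in>Poly_Mapping.keys u. Poly_Mapping.single A (f A))"
    have l: "Poly_Mapping.lookup p A = (if A \<in> Poly_Mapping.keys u then f A else 0)" for A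
      by (simp add: p_def lookup_sum lookup_single when_def)
    have "p \<in> carrier ?G"
      using f(1) F.subspace_0[OF F.part_subspace] by (auto simp: env_carrier l)
    moreover have "u = Poly_Mapping.map abs_free11 p"
      by (rule poly_mapping_eqI) (auto simp: lookup_map0 z l f(2)[symmetric] in_keys_iff)
    ultimately show ?thesis by blast
  qed
  note ha = env_hom_associator[OF free11_superalgebra free_carrier abs_free11_hom, simplified, symmetric]
  have ra: "associator ?E u v v = 0" if uv: "u \<in> carrier ?E" "v \<in> carrier ?E" for u v
  proof -
    from lift[OF uv(1)] lift[OF uv(2)] obtain p q where
      "p \<in> carrier ?G" "q \<in> carrier ?G" "u = Poly_Mapping.map abs_free11 p" "v = Poly_Mapping.map abs_free11 q"
      by blast
    then show ?thesis
      by (auto intro!: poly_mapping_eqI minus_one_one_ideal.right_alt simp: ha lookup_map0 z abs_free11_zero)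
  qed
  have cy: "associator ?E u v w + associator ?E v w u + associator ?E w u v = 0"
    if uvw: "u \<in> carrier ?E" "v \<in> carrier ?E" "w \<in> carrier ?E" for u v w
  proof -
    from lift[OF uvw(1)] lift[OF uvw(2)] lift[OF uvw(3)] obtain p q r where
      *: "p \<in> carrier ?G" "q \<in> carrier ?G" "r \<in> carrier ?G" "u = Poly_Mapping.map abs_free11 p"
      "v = Poly_Mapping.map abs_free11 q" "w = Poly_Mapping.map abs_free11 r"
      by blast
    show ?thesis
    proof (rule poly_mapping_eqI)
      fix A
      show "Poly_Mapping.lookup (associator ?E u v w + associator ?E v w u + associator ?E w u v) A =
        Poly_Mapping.lookup 0 A"
        using minus_one_one_ideal.cyclic[OF *(1-3), of A]
        by (simp add: *(4-6) ha lookup_add lookup_map0 z plus_free11.abs_eq abs_free11_zero)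
    qed
  qed
  show ?thesis
    unfolding minus_one_one_superalgebra_def minus_one_one_algebra_def
    using free11_superalgebra Q.env_algebra ra cy by blast
qed

lemma free11_gen_odd: "free11_gen \<in> odd_part free11_superalg"
  by (auto simp: free11_gen_def free11_superalg_def free_superalg_def intro!: imageI)


subsection \<open>The universal property of \<open>free11_superalg\<close>\<close>

primrec eval_monomial :: "('f, 'a, 'z) superalg_scheme \<Rightarrow> 'a \<Rightarrow> monomial \<Rightarrow> 'a" where
  "eval_monomial X a Gen = a"
| "eval_monomial X a (Prod s t) = mul X (eval_monomial X a s) (eval_monomial X a t)"

definition eval_free :: "('f::field, 'a::ab_group_add, 'z) superalg_scheme \<Rightarrow> 'a \<Rightarrow> (monomial \<Rightarrow>\<^sub>0 'f) \<Rightarrow> 'a" where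
  "eval_free X a p = ksum (\<lambda>t c. scalar X c (eval_monomial X a t)) p"

context superalgebra
begin

lemma eval_monomial_part: "a \<in> odd_part X \<Longrightarrow> eval_monomial X a t \<in> part X (monomial_degree t)"
proof (induction t)
  case Gen
  then show ?case by (simp add: part_def)
next
  case (Prod s t)
  then show ?case by (simp add: mul_part)
qed

lemma eval_monomial_carrier: "a \<in> odd_part X \<Longrightarrow> eval_monomial X a t \<in> carrier X"
  using eval_monomial_part part_carrier by blast

lemma eval_free_add: "eval_free X a (p + q) = eval_free X a p + eval_free X a q"
  unfolding eval_free_def by (rule ksum_add) (simp_all add: scale_left_distrib)

lemma eval_free_zero: "eval_free X a 0 = 0"
  by (simp add: eval_free_def)

lemma eval_free_single: "eval_free X a (Poly_Mapping.single t c) = scalar X c (eval_monomial X a t)"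
  unfolding eval_free_def by (rule ksum_single) simp

lemma eval_free_scalar: "eval_free X a (scalar free_superalg c p) = scalar X c (eval_free X a p)"
  unfolding eval_free_def
  by (simp add: ksum_free_scalar_arg ksum_hom[of "scalar X c"] scale_right_distrib)

lemma eval_free_part:
  assumes "a \<in> odd_part X" "p \<in> part free_superalg n"
  shows "eval_free X a p \<in> part X n"
  unfolding eval_free_def ksum_def
proof (intro subspace_sum[OF part_subspace] subspace_scale[OF part_subspace])
  fix t assume "t \<in> Poly_Mapping.keys p"
  then have "even (monomial_degree t) = even n" using assms(2) by (simp add: free_part)
  then show "eval_monomial X a t \<in> part X n"
    using eval_monomial_part[OF assms(1), of t] by (simp add: part_def)
qed

lemma eval_free_carrier: "a \<in> odd_part X \<Longrightarrow> eval_free X a p \<in> carrier X"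
  unfolding eval_free_def ksum_def
  by (intro subspace_sum[OF subspace_carrier] subspace_scale[OF subspace_carrier] eval_monomial_carrier)

lemma eval_free_mul:
  assumes a: "a \<in> odd_part X"
  shows "eval_free X a (mul free_superalg p q) = mul X (eval_free X a p) (eval_free X a q)"
proof (induction p rule: poly_mapping_add_induct)
  case zero
  then show ?case by (simp add: F.mul_zero_left eval_free_zero mul_zero_left eval_free_carrier a)
next
  case (single s c)
  show ?case
  proof (induction q rule: poly_mapping_add_induct)
    case zero
    then show ?case by (simp add: F.mul_zero_right eval_free_zero mul_zero_right eval_free_carrier a)
  next
    case (single t d)
    have "mul free_superalg (Poly_Mapping.single s c) (Poly_Mapping.single t d) =
        Poly_Mapping.single (Prod s t) (c * d)"
      unfolding free_mul by (subst ksum_single, simp, subst ksum_single) simp_all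
    then show ?case
      by (simp add: eval_free_single mul_scalar_left mul_scalar_right eval_monomial_carrier a
          subspace_scale[OF subspace_carrier] mult.commute)
  next
    case (plus p q)
    then show ?case
      by (simp add: F.mul_add_right eval_free_add mul_add_right eval_free_carrier a)
  qed
next
  case (plus p q)
  then show ?case
    by (simp add: F.mul_add_left eval_free_add mul_add_left eval_free_carrier a)
qed

lemma eval_free_hom: "a \<in> odd_part X \<Longrightarrow> superalg_hom (eval_free X a) free_superalg X"
  using eval_free_part[of a _ 0] eval_free_part[of a _ 1]
  by (auto simp: superalg_hom_def eval_free_add eval_free_scalar eval_free_mul part_def)

end

lemma eval_free_ideal:
  assumes X: "minus_one_one_superalgebra X" and a: "a \<in> odd_part X" and p: "p \<in> minus_one_one_ideal"
  shows "eval_free X a p = 0"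
proof -
  interpret superalgebra X using X by (simp add: minus_one_one_superalgebra_def)
  note h = eval_free_hom[OF a] and z = eval_free_zero[of a]
  note lk = lookup_map0[of "eval_free X a", OF z, symmetric]
  note ha = env_hom_associator[OF superalgebra_axioms free_carrier h eval_free_carrier[OF a]]
  note hc = env_hom_carrier[OF h z]
  have id: "minus_one_one_algebra (grassmann_envelope X)"
    using X by (simp add: minus_one_one_superalgebra_def)
  from p show ?thesis
  proof induction
    case (right_alt u v A)
    then have "associator (grassmann_envelope X) (Poly_Mapping.map (eval_free X a) u)
        (Poly_Mapping.map (eval_free X a) v) (Poly_Mapping.map (eval_free X a) v) = 0"
      using id hc by (simp add: minus_one_one_algebra_def)
    then show ?case by (simp add: lk ha)
  next
    case (cyclic u v w A)
    let ?m = "Poly_Mapping.map (eval_free X a)" and ?E = "grassmann_envelope X"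
    have "associator ?E (?m u) (?m v) (?m w) + associator ?E (?m v) (?m w) (?m u) +
        associator ?E (?m w) (?m u) (?m v) = 0"
      using id cyclic hc by (simp add: minus_one_one_algebra_def)
    from arg_cong[OF this, of "\<lambda>r. Poly_Mapping.lookup r A"]
    show ?case by (simp add: lookup_add eval_free_add lk ha)
  qed (simp_all add: eval_free_add eval_free_scalar eval_free_mul a mul_zero_left mul_zero_right eval_free_carrier)
qed

theorem free11_universal:
  fixes X :: "('f::field, 'a::ab_group_add, 'z) superalg_scheme"
  assumes X: "minus_one_one_superalgebra X" and a: "a \<in> odd_part X"
  shows "\<exists>!\<phi>. superalg_hom \<phi> free11_superalg X \<and> \<phi> free11_gen = a"
proof -
  interpret superalgebra X using X by (simp add: minus_one_one_superalgebra_def)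
  define \<phi> where "\<phi> x = eval_free X a (rep_free11 x)" for x
  have \<phi>: "\<phi> (abs_free11 p) = eval_free X a p" for p
  proof -
    have "abs_free11 (rep_free11 (abs_free11 p)) = abs_free11 p"
      by (rule Quotient_abs_rep[OF Quotient_free11])
    then have "rep_free11 (abs_free11 p) - p \<in> minus_one_one_ideal"
      by (simp add: abs_free11_eq_iff)
    from eval_free_ideal[OF X a this] show ?thesis
      using eval_free_add[of a "rep_free11 (abs_free11 p) - p" p] by (simp add: \<phi>_def)
  qed
  have "superalg_hom \<phi> free11_superalg X"
    unfolding superalg_hom_def
  proof (intro conjI ballI allI)
    fix x y :: "'f free11" and c
    obtain p where x: "x = abs_free11 p" by (rule abs_free11_surj)
    obtain q where y: "y = abs_free11 q" by (rule abs_free11_surj)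
    show "\<phi> (x + y) = \<phi> x + \<phi> y"
      "\<phi> (scalar free11_superalg c x) = scalar X c (\<phi> x)"
      "\<phi> (mul free11_superalg x y) = mul X (\<phi> x) (\<phi> y)"
      by (simp_all add: x y abs_free11_simps \<phi> eval_free_add eval_free_scalar eval_free_mul a)
  next
    show "\<phi> ` even_part free11_superalg \<subseteq> even_part X" "\<phi> ` odd_part free11_superalg \<subseteq> odd_part X"
      using eval_free_hom[OF a] by (auto simp: free11_superalg_def \<phi> superalg_hom_def)
  qed
  moreover have "\<phi> free11_gen = a"
    by (simp add: free11_gen_def \<phi> eval_free_single)
  moreover have "\<psi> = \<phi>" if h: "superalg_hom \<psi> free11_superalg X" and g: "\<psi> free11_gen = a" for \<psi>
  proof
    fix x
    have add: "\<psi> (x + y) = \<psi> x + \<psi> y" and sc: "\<psi> (free11_scalar c x) = scalar X c (\<psi> x)"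
      and ml: "\<psi> (free11_mul x y) = mul X (\<psi> x) (\<psi> y)" for x y c
      using h by (simp_all add: superalg_hom_def)
    have mon: "\<psi> (abs_free11 (Poly_Mapping.single t 1)) = eval_monomial X a t" for t
    proof (induction t)
      case Gen
      then show ?case using g by (simp add: free11_gen_def)
    next
      case (Prod s t)
      have "mul free_superalg (Poly_Mapping.single s 1) (Poly_Mapping.single t 1) =
          Poly_Mapping.single (Prod s t) (1::'f)"
        unfolding free_mul by (subst ksum_single, simp, subst ksum_single) simp_all
      then show ?case using Prod by (metis ml free11_mul.abs_eq eval_monomial.simps(2))
    qed
    have "\<psi> (abs_free11 p) = eval_free X a p" for p
    proof (induction p rule: poly_mapping_add_induct)
      case zero
      show ?case using add[of 0 0] by (simp add: eval_free_zero zero_free11_def[symmetric])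
    next
      case (single t c)
      have "Poly_Mapping.single t c = scalar free_superalg c (Poly_Mapping.single t 1)"
        by (simp add: free_scalar_single)
      then show ?case by (metis sc mon free11_scalar.abs_eq eval_free_single)
    next
      case (plus p q)
      then show ?case by (simp add: plus_free11.abs_eq[symmetric] add eval_free_add)
    qed
    then show "\<psi> x = \<phi> x" using \<phi> by (metis abs_free11_surj)
  qed
  ultimately show ?thesis by blast
qed


section \<open>The superalgebras $B(\Gamma,D,\gamma)$ and $B_0(\Phi[T],D,t_0)$\<close>

definition derivation :: "('f \<Rightarrow> 'g::comm_ring_1 \<Rightarrow> 'g) \<Rightarrow> ('g \<Rightarrow> 'g) \<Rightarrow> bool" where
  "derivation sc D \<longleftrightarrow>
     (\<forall>a b. D (a + b) = D a + D b) \<and> (\<forall>c a. D (sc c a) = sc c (D a)) \<and>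
     (\<forall>a b. D (a * b) = D a * b + a * D b)"

text \<open>The pair \<open>(a, b)\<close> stands for the element $a + \bar b$.\<close>

definition vector_type ::
  "('f \<Rightarrow> 'g::comm_ring_1 \<Rightarrow> 'g) \<Rightarrow> ('g \<Rightarrow> 'g) \<Rightarrow> 'g \<Rightarrow> ('f, 'g \<times> 'g) superalg" where
  "vector_type sc D \<gamma> =
     \<lparr>carrier = UNIV,
      scalar = (\<lambda>c (a, b). (sc c a, sc c b)),
      mul = (\<lambda>(a, b) (a', b').
        (a * a' + (\<gamma> * b * b' + 2 * D b * b' + b * D b'), a * b' + b * a')),
      even_part = {(a, 0) |a. True},
      odd_part = {(0, b) |b. True}\<rparr>"

text \<open>
  $\Phi[T]$: a monomial is a finitely supported exponent function on the indices of the variables,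
  and multiplication is convolution.
\<close>

type_synonym 'f polyT = "(nat \<Rightarrow>\<^sub>0 nat) \<Rightarrow>\<^sub>0 'f"

definition var :: "nat \<Rightarrow> 'f::field polyT" where
  "var i = Poly_Mapping.single (Poly_Mapping.single i 1) 1"

definition polyT_scalar :: "'f::field \<Rightarrow> 'f polyT \<Rightarrow> 'f polyT" where
  "polyT_scalar c = Poly_Mapping.map (\<lambda>d. c * d)"

text \<open>$D = \sum_i t_{i+1} \partial/\partial t_i$, the derivation with $D(t_i) = t_{i+1}$.\<close>

definition polyT_deriv :: "'f::field polyT \<Rightarrow> 'f polyT" where
  "polyT_deriv p = (\<Sum>m\<in>Poly_Mapping.keys p. \<Sum>i\<in>Poly_Mapping.keys m.
     Poly_Mapping.single (m - Poly_Mapping.single i 1 + Poly_Mapping.single (Suc i) 1)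
       (of_nat (Poly_Mapping.lookup m i) * Poly_Mapping.lookup p m))"

definition polyT0 :: "'f::field polyT set" where
  "polyT0 = {p. Poly_Mapping.lookup p 0 = 0}"

definition B0_superalg :: "('f::field, 'f polyT \<times> 'f polyT) superalg" where
  "B0_superalg = (vector_type polyT_scalar polyT_deriv (var 0))
     \<lparr>carrier := {(a, b) |a b. a \<in> polyT0},
      even_part := {(a, 0) |a. a \<in> polyT0},
      odd_part := {(0, b) |b. True}\<rparr>"


subsection \<open>\<open>polyT_deriv\<close> is the derivation with $D(t_i) = t_{i+1}$\<close>

lemma lookup_polyT_scalar [simp]:
  "Poly_Mapping.lookup (polyT_scalar c p) m = c * Poly_Mapping.lookup p m"
  by (simp add: polyT_scalar_def lookup_map0)

definition deriv_term :: "(nat \<Rightarrow>\<^sub>0 nat) \<Rightarrow> nat \<Rightarrow> 'f::field polyT" where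
  "deriv_term m i = Poly_Mapping.single (m - Poly_Mapping.single i 1 + Poly_Mapping.single (Suc i) 1)
     (of_nat (Poly_Mapping.lookup m i))"

lemma polyT_deriv_single:
  "polyT_deriv (Poly_Mapping.single m c) = Poly_Mapping.single 0 c * (\<Sum>i\<in>Poly_Mapping.keys m. deriv_term m i)"
proof (cases "c = 0")
  case False
  then show ?thesis
    by (simp add: polyT_deriv_def deriv_term_def sum_distrib_left mult_single mult.commute)
qed (simp add: polyT_deriv_def)

lemma polyT_deriv_add: "polyT_deriv (p + q) = polyT_deriv p + polyT_deriv q"
proof -
  have eq: "polyT_deriv = ksum (\<lambda>m c. \<Sum>i\<in>Poly_Mapping.keys m.
     Poly_Mapping.single (m - Poly_Mapping.single i 1 + Poly_Mapping.single (Suc i) 1)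
       (of_nat (Poly_Mapping.lookup m i) * c))"
    by (rule ext) (simp add: polyT_deriv_def ksum_def)
  show ?thesis
    unfolding eq by (rule ksum_add) (simp_all add: distrib_left single_add sum.distrib)
qed

lemma deriv_term_add:
  "(deriv_term (m + n) i :: 'f::field polyT) =
   deriv_term m i * Poly_Mapping.single n 1 + Poly_Mapping.single m 1 * deriv_term n i"
proof -
  let ?e = "Poly_Mapping.single i (1::nat)" and ?s = "Poly_Mapping.single (Suc i) (1::nat)"
  have sub: "(m' + n') - ?e = (m' - ?e) + n'" if "Poly_Mapping.lookup m' i > 0" for m' n'
    by (rule poly_mapping_eqI) (use that in \<open>auto simp: lookup_add lookup_minus lookup_single when_def\<close>)
  have 1: "(Poly_Mapping.single (m + n - ?e + ?s) (of_nat (Poly_Mapping.lookup m i)) :: 'f polyT) =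
      Poly_Mapping.single (m - ?e + ?s + n) (of_nat (Poly_Mapping.lookup m i))"
    using sub[of m n] by (cases "Poly_Mapping.lookup m i = 0") (simp_all add: ac_simps)
  have 2: "(Poly_Mapping.single (m + n - ?e + ?s) (of_nat (Poly_Mapping.lookup n i)) :: 'f polyT) =
      Poly_Mapping.single (m + (n - ?e + ?s)) (of_nat (Poly_Mapping.lookup n i))"
    using sub[of n m] by (cases "Poly_Mapping.lookup n i = 0") (simp_all add: ac_simps)
  show ?thesis
    by (simp only: deriv_term_def lookup_add of_nat_add single_add 1 2 mult_single mult_1_right mult_1_left)
qed

lemma deriv_term_0: "i \<notin> Poly_Mapping.keys m \<Longrightarrow> deriv_term m i = 0"
  by (simp add: deriv_term_def in_keys_iff)

lemma deriv_terms_superset: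
  "finite S \<Longrightarrow> Poly_Mapping.keys m \<subseteq> S \<Longrightarrow>
   (\<Sum>i\<in>Poly_Mapping.keys m. deriv_term m i) = (\<Sum>i\<in>S. deriv_term m i)"
  by (rule sum.mono_neutral_left) (auto simp: deriv_term_0)

lemma deriv_terms_add:
  "(\<Sum>i\<in>Poly_Mapping.keys (m + n). deriv_term (m + n) i :: 'f::field polyT) =
   (\<Sum>i\<in>Poly_Mapping.keys m. deriv_term m i) * Poly_Mapping.single n 1 +
   Poly_Mapping.single m 1 * (\<Sum>i\<in>Poly_Mapping.keys n. deriv_term n i)"
proof -
  let ?S = "Poly_Mapping.keys m \<union> Poly_Mapping.keys n"
  have fin: "finite ?S" by simp
  note sup = deriv_terms_superset[OF fin]
  have "Poly_Mapping.keys (m + n) \<subseteq> ?S" by (rule Poly_Mapping.keys_add)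
  from sup[OF this] show ?thesis
    by (simp add: sup[of m] sup[of n] deriv_term_add sum.distrib sum_distrib_left sum_distrib_right)
qed

lemma polyT_deriv_0 [simp]: "polyT_deriv 0 = 0"
  by (simp add: polyT_deriv_def)

lemma polyT_deriv_mult: "polyT_deriv (p * q) = polyT_deriv p * q + p * polyT_deriv q"
proof (induction p rule: poly_mapping_add_induct)
  case zero
  show ?case by simp
next
  case (single m c)
  show ?case
  proof (induction q rule: poly_mapping_add_induct)
    case zero
    show ?case by simp
  next
    case (single n d)
    have s: "Poly_Mapping.single m' c' = Poly_Mapping.single 0 c' * Poly_Mapping.single m' (1::'a)"
      for m' :: "nat \<Rightarrow>\<^sub>0 nat" and c'
      by (simp add: mult_single)
    have "polyT_deriv (Poly_Mapping.single m c * Poly_Mapping.single n d) =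
      Poly_Mapping.single 0 c * Poly_Mapping.single 0 d *
      (\<Sum>i\<in>Poly_Mapping.keys (m + n). deriv_term (m + n) i)"
      by (simp add: mult_single polyT_deriv_single)
    also have "\<dots> = polyT_deriv (Poly_Mapping.single m c) * Poly_Mapping.single n d +
      Poly_Mapping.single m c * polyT_deriv (Poly_Mapping.single n d)"
      unfolding polyT_deriv_single deriv_terms_add unfolding s[of m c] s[of n d]
      by (simp only: algebra_simps)
    finally show ?case .
  qed (simp add: polyT_deriv_add algebra_simps)
qed (simp add: polyT_deriv_add algebra_simps)

lemma polyT_deriv_scalar: "polyT_deriv (polyT_scalar c p) = polyT_scalar c (polyT_deriv p)"
proof -
  have s: "polyT_scalar c q = Poly_Mapping.single 0 c * q" for q
  proof (induction q rule: poly_mapping_add_induct)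
    case (plus p q)
    have "polyT_scalar c (p + q) = polyT_scalar c p + polyT_scalar c q"
      by (rule poly_mapping_eqI) (simp add: lookup_add distrib_left)
    with plus show ?case by (simp add: distrib_left)
  qed (auto intro!: poly_mapping_eqI simp: mult_single lookup_single when_def)
  have "polyT_deriv (Poly_Mapping.single 0 c) = 0"
    by (simp add: polyT_deriv_single)
  then show ?thesis by (simp add: s polyT_deriv_mult)
qed

theorem derivation_polyT_deriv: "derivation polyT_scalar polyT_deriv"
  by (simp add: derivation_def polyT_deriv_add polyT_deriv_scalar polyT_deriv_mult)

theorem polyT_deriv_var: "polyT_deriv (var i) = var (Suc i)"
  by (simp add: var_def polyT_deriv_single deriv_term_def mult_single)

end

theory Submission
  imports Defs
begin

text \<open>
  The homomorphism from the free superalgebra to $B_0$ sending the generator to $\bar 1$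
  is surjective because $D(a) = \bar a \times \bar 1 - \bar 1 \times \bar a$.  Both sides are graded
  by the degree in the generator, and the kernel is shown to vanish degree by degree.  If it vanishes
  below degree \<open>n\<close>, then a product of total degree \<open>n\<close> in the free superalgebra depends only on the
  images of its two factors, so composing it with a linear functional gives a bilinear form \<open>f\<close> on
  $B_0$.  In an associator $(xy)z - x(yz)$ of total degree \<open>n\<close> the outer product is evaluated by \<open>f\<close>
  and the inner one in $B_0$, so \<open>f\<close> satisfies the two superidentities as a cocycle.  Every such
  cocycle is a coboundary, $f(u, v) = L(u \times v)$, because the two superidentities determine it
  from its values on products with $\bar 1$.  Hence an element of degree \<open>n > 1\<close> in the kernel is
  annihilated by every linear functional.
\<close>

text \<open>The ideal is generated by values at arbitrary elements of the Grassmann envelope, so its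
  homogeneity in the generator degree cannot be read off from its definition. The proof does without
  it: degree components are taken in the free nonassociative superalgebra, and the superidentities
  are shown to hold in the quotient after a component has been extracted.

  Linear functionals turn relations in a quotient with no known basis into equations between field
  elements. The functional \<open>L\<close> is then forced: on odd elements by products with the
  generator, on variables by expressing t_0 and D(t_i) through odd products, on longer monomials by
  the even-even part of the form. That the last prescription is consistent amounts to symmetry and
  associativity of that part.

  Invertibility of 2 is used whenever a linearised identity is halved. Invertibility of 3 enters
  through cyclic sums: at three equal odd arguments the cyclic identity reads 3 (x, x, x) =
  0.\<close>

section \<open>Superidentities\<close>

definition inversions :: "nat fset \<Rightarrow> nat fset \<Rightarrow> (nat \<times> nat) set" where
  "inversions A B = {(a, b). a |\<in>| A \<and> b |\<in>| B \<and> b < a}"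

lemma finite_inversions [simp]: "finite (inversions A B)"
  by (rule finite_subset[of _ "fset A \<times> fset B"]) (auto simp: inversions_def)

lemma grassmann_sign_inversions:
  "grassmann_sign A B = (if A |\<inter>| B = {||} then (-1) ^ card (inversions A B) else 0)"
  by (simp add: grassmann_sign_def inversions_def)

lemma grassmann_sign_union_left:
  assumes "A |\<inter>| B = {||}"
  shows "grassmann_sign (A |\<union>| B) C = (grassmann_sign A C * grassmann_sign B C :: 'f::field)"
proof (cases "(A |\<union>| B) |\<inter>| C = {||}")
  case True
  then have d: "A |\<inter>| C = {||}" "B |\<inter>| C = {||}" by auto
  have "inversions (A |\<union>| B) C = inversions A C \<union> inversions B C"
    by (auto simp: inversions_def)
  moreover have "inversions A C \<inter> inversions B C = {}"
    using assms by (auto simp: inversions_def)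
  ultimately show ?thesis
    using True d by (simp add: grassmann_sign_inversions card_Un_disjoint power_add)
next
  case False
  then have "A |\<inter>| C \<noteq> {||} \<or> B |\<inter>| C \<noteq> {||}" by auto
  then show ?thesis using False by (auto simp: grassmann_sign_inversions)
qed

lemma grassmann_sign_union_right:
  assumes "B |\<inter>| C = {||}"
  shows "grassmann_sign A (B |\<union>| C) = (grassmann_sign A B * grassmann_sign A C :: 'f::field)"
proof (cases "A |\<inter>| (B |\<union>| C) = {||}")
  case True
  then have d: "A |\<inter>| B = {||}" "A |\<inter>| C = {||}" by auto
  have "inversions A (B |\<union>| C) = inversions A B \<union> inversions A C"
    by (auto simp: inversions_def)
  moreover have "inversions A B \<inter> inversions A C = {}"
    using assms by (auto simp: inversions_def)
  ultimately show ?thesis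
    using True d by (simp add: grassmann_sign_inversions card_Un_disjoint power_add)
next
  case False
  then have "A |\<inter>| B \<noteq> {||} \<or> A |\<inter>| C \<noteq> {||}" by auto
  then show ?thesis using False by (auto simp: grassmann_sign_inversions)
qed

text \<open>For disjoint sets every pair of \<open>A\<close> and \<open>B\<close> is an inversion in
  exactly one of the two orders, so the two inversion numbers add up to
  \<open>fcard A * fcard B\<close>.\<close>

lemma grassmann_sign_swap:
  "grassmann_sign B A = ((-1) ^ (fcard A * fcard B) * grassmann_sign A B :: 'f::field)"
proof (cases "A |\<inter>| B = {||}")
  case True
  then have True': "B |\<inter>| A = {||}" by auto
  have "inversions A B \<union> prod.swap ` inversions B A = fset A \<times> fset B"
  proof
    show "fset A \<times> fset B \<subseteq> inversions A B \<union> prod.swap ` inversions B A"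
    proof
      fix x assume x: "x \<in> fset A \<times> fset B"
      then obtain a b where ab: "x = (a, b)" "a |\<in>| A" "b |\<in>| B" by auto
      with True have "a \<noteq> b" by auto
      then consider "b < a" | "a < b" by linarith
      then show "x \<in> inversions A B \<union> prod.swap ` inversions B A"
      proof cases
        case 2
        then have "(b, a) \<in> inversions B A" using ab by (simp add: inversions_def)
        then show ?thesis using ab(1) by (force simp: image_iff)
      qed (use ab in \<open>simp add: inversions_def\<close>)
    qed
  qed (auto simp: inversions_def)
  moreover have "inversions A B \<inter> prod.swap ` inversions B A = {}"
    by (auto simp: inversions_def)
  ultimately have "card (inversions A B) + card (prod.swap ` inversions B A) = card (fset A \<times> fset B)"
    by (metis card_Un_disjoint finite_imageI finite_inversions)
  then have c: "fcard A * fcard B = card (inversions A B) + card (inversions B A)"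
    by (simp add: card_image fcard.rep_eq card_cartesian_product)
  have "(-1 :: 'f) ^ n * (-1) ^ n = 1" for n
    by (simp add: power_mult_distrib[symmetric])
  then show ?thesis
    unfolding c using True True'
    by (simp add: grassmann_sign_inversions power_add mult.assoc mult.left_commute)
next
  case False
  then have "B |\<inter>| A \<noteq> {||}" by auto
  with False show ?thesis by (simp add: grassmann_sign_inversions)
qed

text \<open>The coefficient in the product of three basis vectors. In this form both bracketings
  reduce to it, which is the associativity of the Grassmann algebra, and a permutation of the
  arguments only swaps factors.\<close>

definition grassmann_sign3 :: "nat fset \<Rightarrow> nat fset \<Rightarrow> nat fset \<Rightarrow> 'f::field" where
  "grassmann_sign3 A B C = grassmann_sign A B * grassmann_sign A C * grassmann_sign B C"

lemma grassmann_sign3_left: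
  "grassmann_sign A B * grassmann_sign (A |\<union>| B) C = grassmann_sign3 A B C"
proof (cases "A |\<inter>| B = {||}")
  case True
  then show ?thesis by (simp add: grassmann_sign_union_left grassmann_sign3_def mult.assoc)
qed (simp add: grassmann_sign3_def grassmann_sign_def)

lemma grassmann_sign3_right:
  "grassmann_sign B C * grassmann_sign A (B |\<union>| C) = grassmann_sign3 A B C"
proof (cases "B |\<inter>| C = {||}")
  case True
  then show ?thesis by (simp add: grassmann_sign_union_right grassmann_sign3_def ac_simps)
qed (simp add: grassmann_sign3_def grassmann_sign_def)

lemma grassmann_sign3_swap:
  "grassmann_sign3 A C B = (-1) ^ (fcard B * fcard C) * grassmann_sign3 A B C"
  unfolding grassmann_sign3_def grassmann_sign_swap[of C B] by (simp add: ac_simps)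

lemma grassmann_sign3_cycle:
  "grassmann_sign3 B C A = (-1) ^ (fcard A * (fcard B + fcard C)) * grassmann_sign3 A B C"
  unfolding grassmann_sign3_def grassmann_sign_swap[of B A] grassmann_sign_swap[of C A]
  by (simp add: ac_simps power_add distrib_left)

section \<open>Identities of the envelope and graded identities of the superalgebra\<close>

text \<open>The identity (x, y, y) = 0 is quadratic in y, so it is linearised before the sign for
  exchanging homogeneous y and z is inserted.\<close>

definition super_right_alternative :: "('f::field, 'a::ab_group_add, 'z) superalg_scheme \<Rightarrow> bool" where
  "super_right_alternative X \<longleftrightarrow>
     (\<forall>i j k. \<forall>x\<in>part X i. \<forall>y\<in>part X j. \<forall>z\<in>part X k.
        associator X x y z + scalar X ((-1) ^ (j * k)) (associator X x z y) = 0)"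

definition super_cyclic :: "('f::field, 'a::ab_group_add, 'z) superalg_scheme \<Rightarrow> bool" where
  "super_cyclic X \<longleftrightarrow>
     (\<forall>i j k. \<forall>x\<in>part X i. \<forall>y\<in>part X j. \<forall>z\<in>part X k.
        associator X x y z + scalar X ((-1) ^ (i * (j + k))) (associator X y z x) +
        scalar X ((-1) ^ (k * (i + j))) (associator X z x y) = 0)"

context algebra
begin

lemma associator_add:
  assumes "x \<in> carrier A" "y \<in> carrier A" "z \<in> carrier A" "w \<in> carrier A"
  shows "associator A (x + w) y z = associator A x y z + associator A w y z"
    and "associator A x (y + w) z = associator A x y z + associator A x w z"
    and "associator A x y (z + w) = associator A x y z + associator A x y w"
  using assms by (simp_all add: associator_def mul_add_left mul_add_right mul_closed)

lemma associator_zero: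
  assumes "x \<in> carrier A" "y \<in> carrier A"
  shows "associator A 0 x y = 0" "associator A x 0 y = 0" "associator A x y 0 = 0"
  using assms by (simp_all add: associator_def mul_zero_left mul_zero_right mul_closed zero_carrier)

lemma associator_sum:
  assumes "\<And>i. i \<in> S \<Longrightarrow> u i \<in> carrier A" "x \<in> carrier A" "y \<in> carrier A"
  shows "associator A (sum u S) x y = (\<Sum>i\<in>S. associator A (u i) x y)"
    and "associator A x (sum u S) y = (\<Sum>i\<in>S. associator A x (u i) y)"
    and "associator A x y (sum u S) = (\<Sum>i\<in>S. associator A x y (u i))"
proof -
  have c: "sum u T \<in> carrier A" if "T \<subseteq> S" for T
    using that assms(1) by (intro subspace_sum[OF subspace_carrier]) auto
  have "associator A (sum u T) x y = (\<Sum>i\<in>T. associator A (u i) x y) \<and>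
    associator A x (sum u T) y = (\<Sum>i\<in>T. associator A x (u i) y) \<and>
    associator A x y (sum u T) = (\<Sum>i\<in>T. associator A x y (u i))" if "T \<subseteq> S" for T
    using that
  proof (induction T rule: infinite_finite_induct)
    case (insert i T)
    then show ?case
      using c[of T] assms by (simp add: associator_add)
  qed (simp_all add: associator_zero assms)
  then show "associator A (sum u S) x y = (\<Sum>i\<in>S. associator A (u i) x y)"
    "associator A x (sum u S) y = (\<Sum>i\<in>S. associator A x (u i) y)"
    "associator A x y (sum u S) = (\<Sum>i\<in>S. associator A x y (u i))" by simp_all
qed

end

context superalgebra
begin

lemma env_mul_single:
  assumes "a \<in> carrier X" "b \<in> carrier X"
  shows "mul (grassmann_envelope X) (Poly_Mapping.single A a) (Poly_Mapping.single B b) =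
    Poly_Mapping.single (A |\<union>| B) (scalar X (grassmann_sign A B) (mul X a b))"
proof -
  let ?h = "\<lambda>A a B b. Poly_Mapping.single (A |\<union>| B) (scalar X (grassmann_sign A B) (mul X a b))"
  have r: "ksum (?h A a) (Poly_Mapping.single B b) = ?h A a B b" if "a \<in> carrier X" for a
    by (rule ksum_single) (simp add: mul_zero_right that)
  have "ksum (?h A 0) (Poly_Mapping.single B b) = 0"
    by (simp add: r zero_carrier mul_zero_left assms)
  then show ?thesis
    unfolding env_mul by (simp add: ksum_single r assms)
qed

lemma env_associator_single:
  assumes "a \<in> carrier X" "b \<in> carrier X" "c \<in> carrier X"
  shows "associator (grassmann_envelope X) (Poly_Mapping.single A a) (Poly_Mapping.single B b)
      (Poly_Mapping.single C c) =
    Poly_Mapping.single (A |\<union>| B |\<union>| C) (scalar X (grassmann_sign3 A B C) (associator X a b c))"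
proof -
  have "scalar X (grassmann_sign A B) (mul X a b) \<in> carrier X"
    "scalar X (grassmann_sign B C) (mul X b c) \<in> carrier X"
    using assms by (auto intro: subspace_scale[OF subspace_carrier] mul_closed)
  then show ?thesis
    using assms
    by (simp add: associator_def env_mul_single mul_scalar_left mul_scalar_right mul_closed
        grassmann_sign3_left grassmann_sign3_right mult.commute scale_right_diff_distrib single_diff
        sup_assoc)
qed

lemma env_single_carrier:
  "a \<in> part X (fcard A) \<Longrightarrow> Poly_Mapping.single A a \<in> carrier (grassmann_envelope X)"
  using subspace_0[OF part_subspace] by (auto simp: env_carrier lookup_single when_def)

text \<open>The envelope identities are tested on elementary tensors whose Grassmann factors have a
  nonzero product; the common sign can then be cancelled.\<close>

lemma minus_one_one_super_identities:
  assumes "minus_one_one_superalgebra X"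
  shows "super_right_alternative X" "super_cyclic X"
proof -
  let ?E = "grassmann_envelope X"
  interpret E: algebra ?E by (rule env_algebra)
  have E: "minus_one_one_algebra ?E" using assms by (simp add: minus_one_one_superalgebra_def)
  \<comment> \<open>An even argument is paired with 1, an odd one with the single generator of index
    \<open>m\<close>. Using the indices 0, 1, 2 keeps the three sets disjoint.\<close>
  define S where "S m i = (if even i then {||} else {|m|})" for m i :: nat
  have Sp: "part X (fcard (S m i)) = part X i" and Sc: "(-1::'f) ^ fcard (S m i) = (-1) ^ i" for m i
    by (auto simp: S_def part_def fcard.rep_eq)
  have sg: "grassmann_sign3 (S 0 i) (S 1 j) (S 2 k) \<noteq> (0::'f)" for i j k
    by (auto simp: S_def grassmann_sign3_def grassmann_sign_def)
  have gen: "Poly_Mapping.single (S m i) x \<in> carrier ?E" if "x \<in> part X i" for m i x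
    using that by (intro env_single_carrier) (simp add: Sp)
  have sign: "(-1::'f) ^ (fcard (S m i) * fcard (S n j)) = (-1) ^ (i * j)" for m i n j
    by (metis Sc mult.commute power_mult)
  have sign2: "(-1::'f) ^ (fcard (S m i) * (fcard (S n j) + fcard (S l k))) = (-1) ^ (i * (j + k))"
    for m i n j l k
    by (simp add: distrib_left power_add sign)
  show "super_right_alternative X"
    unfolding super_right_alternative_def
  proof (intro allI ballI)
    fix i j k x y z assume *: "x \<in> part X i" "y \<in> part X j" "z \<in> part X k"
    define u v w where "u = Poly_Mapping.single (S 0 i) x" "v = Poly_Mapping.single (S 1 j) y"
      "w = Poly_Mapping.single (S 2 k) z"
    have uvw: "u \<in> carrier ?E" "v \<in> carrier ?E" "w \<in> carrier ?E"
      by (simp_all add: u_v_w_def gen *)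
    \<comment> \<open>Polarisation: expanding at \<open>v + w\<close> leaves the two mixed
      associators.\<close>
    then have "associator ?E u (v + w) (v + w) = 0" "associator ?E u v v = 0" "associator ?E u w w = 0"
      using E E.subspace_add[OF E.subspace_carrier] by (simp_all add: minus_one_one_algebra_def)
    then have "associator ?E u v w + associator ?E u w v = 0"
      using uvw E.subspace_add[OF E.subspace_carrier] by (simp add: E.associator_add add.commute)
    moreover have U: "S 0 i |\<union>| S 2 k |\<union>| S 1 j = S 0 i |\<union>| S 1 j |\<union>| S 2 k" by auto
    moreover have c: "grassmann_sign3 (S 0 i) (S 2 k) (S 1 j) =
        (-1) ^ (j * k) * (grassmann_sign3 (S 0 i) (S 1 j) (S 2 k) :: 'f)"
      unfolding grassmann_sign3_swap[of "S 0 i" "S 2 k"] sign ..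
    ultimately have "Poly_Mapping.single (S 0 i |\<union>| S 1 j |\<union>| S 2 k)
        (scalar X (grassmann_sign3 (S 0 i) (S 1 j) (S 2 k))
          (associator X x y z + scalar X ((-1) ^ (j * k)) (associator X x z y))) = 0"
      unfolding u_v_w_def using *
      by (simp add: env_associator_single part_carrier single_add scale_right_distrib mult.commute)
    then show "associator X x y z + scalar X ((-1) ^ (j * k)) (associator X x z y) = 0"
      using sg[of i j k] by (metis scale_eq_0_iff lookup_single_eq lookup_zero)
  qed
  show "super_cyclic X"
    unfolding super_cyclic_def
  proof (intro allI ballI)
    fix i j k x y z assume *: "x \<in> part X i" "y \<in> part X j" "z \<in> part X k"
    define u v w where "u = Poly_Mapping.single (S 0 i) x" "v = Poly_Mapping.single (S 1 j) y"
      "w = Poly_Mapping.single (S 2 k) z"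
    have uvw: "u \<in> carrier ?E" "v \<in> carrier ?E" "w \<in> carrier ?E"
      by (simp_all add: u_v_w_def gen *)
    have U: "S 1 j |\<union>| S 2 k |\<union>| S 0 i = S 0 i |\<union>| S 1 j |\<union>| S 2 k"
      "S 2 k |\<union>| S 0 i |\<union>| S 1 j = S 0 i |\<union>| S 1 j |\<union>| S 2 k" by auto
    have c1: "grassmann_sign3 (S 1 j) (S 2 k) (S 0 i) =
        (-1) ^ (i * (j + k)) * (grassmann_sign3 (S 0 i) (S 1 j) (S 2 k) :: 'f)"
      unfolding grassmann_sign3_cycle[of "S 1 j"] sign2 ..
    have c2: "(-1) ^ (k * (i + j)) * grassmann_sign3 (S 2 k) (S 0 i) (S 1 j) =
        (grassmann_sign3 (S 0 i) (S 1 j) (S 2 k) :: 'f)"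
      unfolding grassmann_sign3_cycle[of "S 0 i" "S 1 j" "S 2 k"] sign2 ..
    have c2': "grassmann_sign3 (S 2 k) (S 0 i) (S 1 j) =
        (-1) ^ (k * (i + j)) * (grassmann_sign3 (S 0 i) (S 1 j) (S 2 k) :: 'f)"
      unfolding c2[symmetric] mult.assoc[symmetric] by (simp add: power_mult_distrib[symmetric])
    from uvw have "associator ?E u v w + associator ?E v w u + associator ?E w u v = 0"
      using E by (simp add: minus_one_one_algebra_def)
    then have "Poly_Mapping.single (S 0 i |\<union>| S 1 j |\<union>| S 2 k) (scalar X (grassmann_sign3 (S 0 i) (S 1 j) (S 2 k))
        (associator X x y z + scalar X ((-1) ^ (i * (j + k))) (associator X y z x) +
        scalar X ((-1) ^ (k * (i + j))) (associator X z x y))) = 0"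
      unfolding u_v_w_def using * U c1 c2'
      by (simp add: env_associator_single part_carrier single_add scale_right_distrib mult.commute)
    then show "associator X x y z + scalar X ((-1) ^ (i * (j + k))) (associator X y z x) +
        scalar X ((-1) ^ (k * (i + j))) (associator X z x y) = 0"
      using sg[of i j k] by (metis scale_eq_0_iff lookup_single_eq lookup_zero)
  qed
qed

lemma env_sum:
  assumes "u \<in> carrier (grassmann_envelope X)"
  shows "u = (\<Sum>A\<in>Poly_Mapping.keys u. Poly_Mapping.single A (Poly_Mapping.lookup u A))"
    and "Poly_Mapping.single A (Poly_Mapping.lookup u A) \<in> carrier (grassmann_envelope X)"
proof -
  show "u = (\<Sum>A\<in>Poly_Mapping.keys u. Poly_Mapping.single A (Poly_Mapping.lookup u A))"
    using ksum_id[of u] by (simp add: ksum_def)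
  show "Poly_Mapping.single A (Poly_Mapping.lookup u A) \<in> carrier (grassmann_envelope X)"
    by (rule env_single_carrier) (use assms in \<open>simp add: env_carrier\<close>)
qed

lemma env_associator_expand:
  assumes "u \<in> carrier (grassmann_envelope X)" "v \<in> carrier (grassmann_envelope X)"
    "w \<in> carrier (grassmann_envelope X)"
  shows "associator (grassmann_envelope X) u v w =
    (\<Sum>A\<in>Poly_Mapping.keys u. \<Sum>B\<in>Poly_Mapping.keys v. \<Sum>C\<in>Poly_Mapping.keys w.
      Poly_Mapping.single (A |\<union>| B |\<union>| C) (scalar X (grassmann_sign3 A B C)
        (associator X (Poly_Mapping.lookup u A) (Poly_Mapping.lookup v B) (Poly_Mapping.lookup w C))))"
proof -
  let ?E = "grassmann_envelope X"
  interpret E: algebra ?E by (rule env_algebra)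
  let ?s = "\<lambda>u A. Poly_Mapping.single A (Poly_Mapping.lookup u A)"
  note c = env_sum(2)[OF assms(1)] env_sum(2)[OF assms(2)] env_sum(2)[OF assms(3)]
  have "associator ?E u v w = (\<Sum>A\<in>Poly_Mapping.keys u. associator ?E (?s u A) v w)"
    by (subst (1) env_sum(1)[OF assms(1)]) (simp add: E.associator_sum c assms)
  also have "\<dots> = (\<Sum>A\<in>Poly_Mapping.keys u. \<Sum>B\<in>Poly_Mapping.keys v. associator ?E (?s u A) (?s v B) w)"
    by (subst (1) env_sum(1)[OF assms(2)]) (simp add: E.associator_sum c assms)
  also have "\<dots> = (\<Sum>A\<in>Poly_Mapping.keys u. \<Sum>B\<in>Poly_Mapping.keys v. \<Sum>C\<in>Poly_Mapping.keys w.
      associator ?E (?s u A) (?s v B) (?s w C))"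
    by (subst (1) env_sum(1)[OF assms(3)]) (simp add: E.associator_sum c assms)
  finally show ?thesis
    using assms by (simp add: env_associator_single env_lookup_carrier)
qed

text \<open>Both identities are expanded over basis vectors of the Grassmann algebra, where the sign
  rules match each group of terms with one superidentity.\<close>

lemma minus_one_one_superalgebraI:
  assumes two: "(2::'f) \<noteq> 0" and ra: "super_right_alternative X" and cy: "super_cyclic X"
  shows "minus_one_one_superalgebra X"
proof -
  let ?E = "grassmann_envelope X"
  interpret E: algebra ?E by (rule env_algebra)
  let ?l = Poly_Mapping.lookup
  have pt: "?l u A \<in> part X (fcard A)" if "u \<in> carrier ?E" for u A
    using that by (simp add: env_carrier)
  have "associator ?E u v v = 0" if uv: "u \<in> carrier ?E" "v \<in> carrier ?E" for u v
  proof -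
    define T where "T A B C = Poly_Mapping.single (A |\<union>| B |\<union>| C) (scalar X (grassmann_sign3 A B C)
        (associator X (?l u A) (?l v B) (?l v C)))" for A B C
    have TT: "T A B C + T A C B = 0" for A B C
    proof -
      have "T A B C + T A C B = Poly_Mapping.single (A |\<union>| B |\<union>| C) (scalar X (grassmann_sign3 A B C)
        (associator X (?l u A) (?l v B) (?l v C) +
         scalar X ((-1) ^ (fcard B * fcard C)) (associator X (?l u A) (?l v C) (?l v B))))"
        by (simp add: T_def grassmann_sign3_swap[of A C B] single_add scale_right_distrib ac_simps)
      also have "associator X (?l u A) (?l v B) (?l v C) +
         scalar X ((-1) ^ (fcard B * fcard C)) (associator X (?l u A) (?l v C) (?l v B)) = 0"
        using ra pt[OF uv(1)] pt[OF uv(2)] unfolding super_right_alternative_def by blast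
      finally show ?thesis by simp
    qed
    \<comment> \<open>Doubling the sum lets every term, diagonal ones included, be paired with its
      transpose in \<open>B\<close> and \<open>C\<close>; the factor 2 is cancelled at the
      end.\<close>
    have "associator ?E u v v + associator ?E u v v =
      (\<Sum>A\<in>Poly_Mapping.keys u. (\<Sum>B\<in>Poly_Mapping.keys v. \<Sum>C\<in>Poly_Mapping.keys v. T A B C) +
         (\<Sum>B\<in>Poly_Mapping.keys v. \<Sum>C\<in>Poly_Mapping.keys v. T A B C))"
      by (simp add: env_associator_expand uv T_def sum.distrib)
    also have "\<dots> = (\<Sum>A\<in>Poly_Mapping.keys u. (\<Sum>B\<in>Poly_Mapping.keys v. \<Sum>C\<in>Poly_Mapping.keys v. T A B C) +
         (\<Sum>B\<in>Poly_Mapping.keys v. \<Sum>C\<in>Poly_Mapping.keys v. T A C B))"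
      by (subst (2) sum.swap) simp
    also have "\<dots> = 0"
      by (simp add: sum.distrib[symmetric] TT)
    finally have dbl: "associator ?E u v v + associator ?E u v v = 0" .
    have "scalar X 2 (?l (associator ?E u v v) A) = 0" for A
      using arg_cong[OF dbl, of "\<lambda>p. ?l p A"] scale_left_distrib[of 1 1] by (simp add: lookup_add)
    then show ?thesis using two by (intro poly_mapping_eqI) simp
  qed
  moreover have "associator ?E u v w + associator ?E v w u + associator ?E w u v = 0"
    if uvw: "u \<in> carrier ?E" "v \<in> carrier ?E" "w \<in> carrier ?E" for u v w
  proof -
    define T where "T A B C u v w = Poly_Mapping.single (A |\<union>| B |\<union>| C) (scalar X (grassmann_sign3 A B C)
        (associator X (?l u A) (?l v B) (?l w C)))" for A B C u v w
    have TT: "T A B C u v w + T B C A v w u + T C A B w u v = 0" for A B C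
    proof -
      have U: "B |\<union>| C |\<union>| A = A |\<union>| B |\<union>| C" "C |\<union>| A |\<union>| B = A |\<union>| B |\<union>| C" by auto
      have c: "grassmann_sign3 C A B = (-1) ^ (fcard C * (fcard A + fcard B)) * (grassmann_sign3 A B C :: 'f)"
        unfolding grassmann_sign3_cycle[of A B C] mult.assoc[symmetric]
        by (simp add: power_mult_distrib[symmetric])
      have "T A B C u v w + T B C A v w u + T C A B w u v =
        Poly_Mapping.single (A |\<union>| B |\<union>| C) (scalar X (grassmann_sign3 A B C)
        (associator X (?l u A) (?l v B) (?l w C) +
         scalar X ((-1) ^ (fcard A * (fcard B + fcard C))) (associator X (?l v B) (?l w C) (?l u A)) +
         scalar X ((-1) ^ (fcard C * (fcard A + fcard B))) (associator X (?l w C) (?l u A) (?l v B))))"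
        by (simp add: T_def grassmann_sign3_cycle[of B] c U single_add scale_right_distrib mult.commute)
      then show ?thesis
        using cy pt uvw by (simp add: super_cyclic_def)
    qed
    have 1: "associator ?E v w u = (\<Sum>A\<in>Poly_Mapping.keys u. \<Sum>B\<in>Poly_Mapping.keys v. \<Sum>C\<in>Poly_Mapping.keys w. T B C A v w u)"
      unfolding env_associator_expand[OF uvw(2,3,1)] T_def
      by (subst (2) sum.swap, subst (1) sum.swap, rule refl)
    have 2: "associator ?E w u v = (\<Sum>A\<in>Poly_Mapping.keys u. \<Sum>B\<in>Poly_Mapping.keys v. \<Sum>C\<in>Poly_Mapping.keys w. T C A B w u v)"
      unfolding env_associator_expand[OF uvw(3,1,2)] T_def
      by (subst (1) sum.swap, subst (2) sum.swap, rule refl)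
    have "associator ?E u v w + associator ?E v w u + associator ?E w u v =
      (\<Sum>A\<in>Poly_Mapping.keys u. \<Sum>B\<in>Poly_Mapping.keys v. \<Sum>C\<in>Poly_Mapping.keys w.
        T A B C u v w + T B C A v w u + T C A B w u v)"
      unfolding 1 2 unfolding env_associator_expand[OF uvw] by (simp add: T_def sum.distrib)
    then show ?thesis by (simp add: TT)
  qed
  ultimately show ?thesis
    unfolding minus_one_one_superalgebra_def minus_one_one_algebra_def
    using superalgebra_axioms env_algebra by blast
qed

end

section \<open>Differential polynomials\<close>

lemma polyT_scalar_eq: "polyT_scalar c p = Poly_Mapping.single 0 c * p"
proof (induction p rule: poly_mapping_add_induct)
  case (plus p q)
  have "polyT_scalar c (p + q) = polyT_scalar c p + polyT_scalar c q"
    by (rule poly_mapping_eqI) (simp add: lookup_add distrib_left)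
  with plus show ?case by (simp add: distrib_left)
qed (auto intro!: poly_mapping_eqI simp: mult_single lookup_single when_def)

lemma polyT_scalar_simps:
  "polyT_scalar c (p + q) = polyT_scalar c p + polyT_scalar c q"
  "polyT_scalar c (p - q) = polyT_scalar c p - polyT_scalar c q"
  "polyT_scalar (c + d) p = polyT_scalar c p + polyT_scalar d p"
  "polyT_scalar c (polyT_scalar d p) = polyT_scalar (c * d) p"
  "polyT_scalar 1 p = p"
  "polyT_scalar c 0 = 0"
  "polyT_scalar c p * q = polyT_scalar c (p * q)"
  "q * polyT_scalar c p = polyT_scalar c (q * p)"
proof -
  show "polyT_scalar c (polyT_scalar d p) = polyT_scalar (c * d) p"
    by (simp add: polyT_scalar_eq mult.assoc[symmetric] mult_single)
  show "q * polyT_scalar c p = polyT_scalar c (q * p)"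
    by (simp add: polyT_scalar_eq mult.left_commute)
qed (simp_all add: polyT_scalar_eq distrib_left right_diff_distrib distrib_right single_add mult.assoc)

lemma polyT_deriv_one [simp]: "polyT_deriv 1 = 0"
  using polyT_deriv_single[of 0 1] by simp

lemma single_eq_0_iff: "Poly_Mapping.single k v = 0 \<longleftrightarrow> v = 0"
  by (metis lookup_single_eq lookup_zero single_zero)

lemma monomial_add_eq_0_iff: "m + n = 0 \<longleftrightarrow> m = 0 \<and> n = (0 :: nat \<Rightarrow>\<^sub>0 nat)"
  by (auto simp: poly_mapping_eq_iff lookup_add fun_eq_iff)

lemma lookup_0_mult: "Poly_Mapping.lookup (p * q) 0 = Poly_Mapping.lookup p 0 * Poly_Mapping.lookup (q :: 'f::field polyT) 0"
proof (induction p rule: poly_mapping_add_induct)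
  case (single m c)
  show ?case
  proof (induction q rule: poly_mapping_add_induct)
    case (single n d)
    show ?case by (simp add: mult_single lookup_single when_def monomial_add_eq_0_iff)
  qed (simp_all add: lookup_add distrib_left)
qed (simp_all add: lookup_add distrib_right)

lemma lookup_0_deriv [simp]: "Poly_Mapping.lookup (polyT_deriv p) 0 = 0"
  unfolding polyT_deriv_def lookup_sum
  by (intro sum.neutral ballI) (simp add: lookup_single when_def monomial_add_eq_0_iff single_eq_0_iff)

lemma polyT0_simps [simp]:
  "0 \<in> polyT0"
  "var i \<in> polyT0"
  "polyT_deriv p \<in> polyT0"
  "p \<in> polyT0 \<Longrightarrow> p * q \<in> polyT0"
  "q \<in> polyT0 \<Longrightarrow> p * q \<in> polyT0"
  "p \<in> polyT0 \<Longrightarrow> q \<in> polyT0 \<Longrightarrow> p + q \<in> polyT0"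
  "p \<in> polyT0 \<Longrightarrow> q \<in> polyT0 \<Longrightarrow> p - q \<in> polyT0"
  "p \<in> polyT0 \<Longrightarrow> polyT_scalar c p \<in> polyT0"
  by (simp_all add: polyT0_def lookup_0_mult lookup_add lookup_minus var_def lookup_single when_def
      single_eq_0_iff)

lemma single_in_polyT0 [simp]: "Poly_Mapping.single m c \<in> polyT0 \<longleftrightarrow> m = 0 \<longrightarrow> c = 0"
  by (auto simp: polyT0_def lookup_single when_def)

definition const_part :: "'f::field polyT \<Rightarrow> 'f polyT" where
  "const_part p = polyT_scalar (Poly_Mapping.lookup p 0) 1"

lemma const_part_simps:
  "const_part (p + q) = const_part p + const_part q"
  "const_part (polyT_scalar c p) = polyT_scalar c (const_part p)"
  by (simp_all add: const_part_def lookup_add polyT_scalar_simps)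

lemma diff_const_part [simp]: "p - const_part p \<in> polyT0"
  by (simp add: polyT0_def const_part_def lookup_minus)

lemma const_part_polyT0 [simp]: "p \<in> polyT0 \<Longrightarrow> const_part p = 0"
  by (auto simp: polyT0_def const_part_def intro!: poly_mapping_eqI)

lemma polyT_const_cases:
  obtains c q where "p = polyT_scalar c 1 + q" "q \<in> polyT0"
  using that[of "Poly_Mapping.lookup p 0" "p - const_part p"] by (simp add: const_part_def[symmetric])

lemma single_remove:
  assumes "i \<in> Poly_Mapping.keys m"
  shows "Poly_Mapping.single m c =
    var i * Poly_Mapping.single (m - Poly_Mapping.single i 1) (c::'f::field)"
proof -
  have "Poly_Mapping.single i 1 + (m - Poly_Mapping.single i 1) = m"
    using assms by (intro poly_mapping_eqI)
      (auto simp: lookup_add lookup_minus lookup_single when_def in_keys_iff)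
  then show ?thesis by (simp add: var_def mult_single)
qed

lemma polyT0_monomial_induct [consumes 1, case_names single add]:
  assumes "p \<in> polyT0"
    and single: "\<And>m c. m \<noteq> 0 \<Longrightarrow> P (Poly_Mapping.single m c)"
    and add: "\<And>p q. p \<in> polyT0 \<Longrightarrow> q \<in> polyT0 \<Longrightarrow> P p \<Longrightarrow> P q \<Longrightarrow> P (p + q)"
  shows "P (p :: 'f::field polyT)"
proof -
  have "P (\<Sum>m\<in>S. Poly_Mapping.single m (Poly_Mapping.lookup p m)) \<and>
      (\<Sum>m\<in>S. Poly_Mapping.single m (Poly_Mapping.lookup p m)) \<in> polyT0" if "0 \<notin> S" "finite S" for S
    using that(2,1)
  proof (induction S)
    case empty
    \<comment> \<open>The zero polynomial arises as a nonconstant monomial with coefficient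
      0.\<close>
    show ?case using single[of "Poly_Mapping.single 0 1" 0] by (simp add: single_eq_0_iff)
  next
    case (insert m S)
    then have "m \<noteq> 0" "0 \<notin> S" by auto
    then show ?case using insert single[of m] add by simp
  qed
  moreover have "0 \<notin> Poly_Mapping.keys p" using assms(1) by (simp add: polyT0_def in_keys_iff)
  moreover have "(\<Sum>m\<in>Poly_Mapping.keys p. Poly_Mapping.single m (Poly_Mapping.lookup p m)) = p"
    using ksum_id[of p] unfolding ksum_def .
  ultimately show ?thesis by (metis finite_keys)
qed

text \<open>Splits into linear and decomposable terms. The product case carries no hypothesis on
  \<open>q\<close>: the intended properties are proved on decomposable elements directly.\<close>

lemma polyT0_induct [consumes 1, case_names var mult add]:
  assumes "p \<in> polyT0"
    and var: "\<And>i c. P (polyT_scalar c (var i))"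
    and mult: "\<And>i q. q \<in> polyT0 \<Longrightarrow> P (var i * q)"
    and add: "\<And>p q. p \<in> polyT0 \<Longrightarrow> q \<in> polyT0 \<Longrightarrow> P p \<Longrightarrow> P q \<Longrightarrow> P (p + q)"
  shows "P (p :: 'f::field polyT)"
  using assms(1)
proof (induction p rule: polyT0_monomial_induct)
  case (single m c)
  then have "Poly_Mapping.keys m \<noteq> {}" by simp
  then obtain i where i: "i \<in> Poly_Mapping.keys m" by blast
  show ?case
  proof (cases "m - Poly_Mapping.single i 1 = 0")
    case True
    then show ?thesis
      using var[of c i] unfolding single_remove[OF i] True polyT_scalar_eq by (simp only: mult.commute)
  next
    case False
    then show ?thesis
      unfolding single_remove[OF i] by (intro mult) simp
  qed
qed (rule add)

definition odd_mul :: "'f::field polyT \<Rightarrow> 'f polyT \<Rightarrow> 'f polyT" where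
  "odd_mul a b = var 0 * a * b + 2 * polyT_deriv a * b + a * polyT_deriv b"

lemma odd_mul_alt: "odd_mul a b = var 0 * a * b + 2 * (polyT_deriv a * b) + a * polyT_deriv b"
  by (simp add: odd_mul_def algebra_simps)

lemma odd_mul_polyT0 [simp]: "odd_mul a b \<in> polyT0"
  by (simp add: odd_mul_alt)

section \<open>Cocycles on $B_0$ are coboundaries\<close>

locale polyT_bilinear =
  fixes f :: "'f::field polyT \<Rightarrow> 'f polyT \<Rightarrow> 'f"
  assumes add_left: "f (a + b) c = f a c + f b c"
    and add_right: "f a (b + c) = f a b + f a c"
    and scalar_left: "f (polyT_scalar k a) b = k * f a b"
    and scalar_right: "f a (polyT_scalar k b) = k * f a b"
begin

lemma zero_left [simp]: "f 0 a = 0" using scalar_left[of 0 0 a] by (simp add: polyT_scalar_simps)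
lemma zero_right [simp]: "f a 0 = 0" using scalar_right[of a 0 0] by (simp add: polyT_scalar_simps)
lemma diff_left: "f (a - b) c = f a c - f b c" using add_left[of "a - b" b c] by (simp add: algebra_simps)
lemma diff_right: "f a (b - c) = f a b - f a c" using add_right[of a "b - c" c] by (simp add: algebra_simps)

lemma double_left: "f (2 * a) b = 2 * f a b" using add_left[of a a b] by simp
lemma double_right: "f a (2 * b) = 2 * f a b" using add_right[of a b b] by simp

lemmas bilinear = add_left add_right scalar_left scalar_right diff_left diff_right double_left double_right

end

text \<open>
  The bilinear maps \<open>p, q, r, s\<close> are the restrictions of one bilinear form on $B_0$ to even-even,
  even-odd, odd-even and odd-odd arguments; the assumptions are the superidentities with the
  outer product in each associator replaced by this form.
\<close>

locale vector_type_cocycle =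
  p: polyT_bilinear p + q: polyT_bilinear q + r: polyT_bilinear r + s: polyT_bilinear s
  for p q r s :: "'f::field polyT \<Rightarrow> 'f polyT \<Rightarrow> 'f" +
  assumes two: "(2::'f) \<noteq> 0" and three: "(3::'f) \<noteq> 0"
    and ra_eeo: "a \<in> polyT0 \<Longrightarrow> b \<in> polyT0 \<Longrightarrow> q (a * b) c + r (a * c) b = 2 * q a (b * c)"
    and ra_oee: "a \<in> polyT0 \<Longrightarrow> b \<in> polyT0 \<Longrightarrow> r (c * a) b + r (c * b) a = 2 * r c (a * b)"
    and ra_ooo: "q (odd_mul a b) c - q (odd_mul a c) b = r a (polyT_deriv b * c - b * polyT_deriv c)"
    and cyclic_ooo: "q (odd_mul a b) c + q (odd_mul b c) a + q (odd_mul c a) b =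
      r a (odd_mul b c) + r b (odd_mul c a) + r c (odd_mul a b)"
    and ra_eee: "a \<in> polyT0 \<Longrightarrow> b \<in> polyT0 \<Longrightarrow> c \<in> polyT0 \<Longrightarrow> p (a * b) c + p (a * c) b = 2 * p a (b * c)"
    and ra_eoo: "a \<in> polyT0 \<Longrightarrow> s (a * b) c - s (a * c) b = p a (polyT_deriv b * c - b * polyT_deriv c)"
    and ra_oeo: "a \<in> polyT0 \<Longrightarrow> s (a * b) c + p (odd_mul b c) a = 2 * s b (a * c)"
    and cyclic_eoo: "a \<in> polyT0 \<Longrightarrow>
      s (a * b) c - p a (odd_mul b c) + p (odd_mul b c) a - s b (c * a) - s (c * a) b + s c (a * b) = 0"
begin

lemmas bilinear = p.bilinear q.bilinear r.bilinear s.bilinear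

section \<open>Mixed arguments: both defects vanish\<close>

lemma two_mult: "2 * (x::'f) = 0 \<Longrightarrow> x = 0" using two by simp
lemma three_mult: "3 * (x::'f) = 0 \<Longrightarrow> x = 0" using three by simp

text \<open>
  The failure of the form on mixed arguments to be the coboundary of $\bar a \mapsto f(a, \bar 1)$.
  It vanishes on variables because $h(D a, b) = - h(a, D b)$ gives $h(t_0, t_n) = \pm h(t_n, t_0)$
  while the cyclic identity gives $h(t_0, t_n) = 2 h(t_n, t_0)$.
\<close>

definition h :: "'f polyT \<Rightarrow> 'f polyT \<Rightarrow> 'f" where "h a b = q a b - q (a * b) 1"
text \<open>Right alternativity expresses \<open>r a b\<close> through \<open>q\<close> only for
  \<open>a\<close> without constant term. The left odd argument 1 remains, and \<open>k\<close>
  measures its defect.\<close>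

definition k :: "'f polyT \<Rightarrow> 'f" where "k a = r 1 a - q a 1"

lemma h_bilinear: "polyT_bilinear h"
  by unfold_locales (simp_all add: h_def bilinear polyT_scalar_simps algebra_simps)

sublocale h: polyT_bilinear h by (rule h_bilinear)

lemma k_linear: "k (a + b) = k a + k b" "k (polyT_scalar c a) = c * k a" "k (2 * a) = 2 * k a"
  by (simp_all add: k_def bilinear right_diff_distrib)

lemma q_eq: "q a b = q (a * b) 1 + h a b"
  by (simp add: h_def)

lemma r_eq: "a \<in> polyT0 \<Longrightarrow> b \<in> polyT0 \<Longrightarrow> r a b = q (a * b) 1 + 2 * h a b"
  using ra_eeo[of a b 1] by (simp add: h_def algebra_simps)

lemma r_one: "r 1 a = q a 1 + k a"
  by (simp add: k_def)

lemma h_mult_mult: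
  assumes "a \<in> polyT0" "b \<in> polyT0" "c \<in> polyT0"
  shows "h (a * b) c + 2 * h (a * c) b = 2 * h a (b * c)"
proof -
  have "q (a * (b * c)) 1 + h (a * b) c + (q (a * (b * c)) 1 + 2 * h (a * c) b) =
      2 * (q (a * (b * c)) 1 + h a (b * c))"
    using ra_eeo[of a b c] assms by (simp add: r_eq q_eq[of "a * b" c] q_eq[of a "b * c"] ac_simps)
  then show ?thesis by algebra
qed

text \<open>The right side of \<open>h_mult_mult\<close> is symmetric in \<open>b\<close> and
  \<open>c\<close>; comparing the left sides gives x + 2y = y + 2x.\<close>

lemma h_mult_swap:
  assumes "a \<in> polyT0" "b \<in> polyT0" "c \<in> polyT0"
  shows "h (a * b) c = h (a * c) b"
  using h_mult_mult[of a b c] h_mult_mult[of a c b] assms by (simp add: mult.commute[of c b]) algebra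

lemma h_mult_right:
  assumes "a \<in> polyT0" "b \<in> polyT0" "c \<in> polyT0"
  shows "2 * h a (b * c) = 3 * h (a * b) c"
  using h_mult_mult[of a b c] h_mult_swap[of a b c] assms by algebra

lemma k_mult: "a \<in> polyT0 \<Longrightarrow> b \<in> polyT0 \<Longrightarrow> k (a * b) = h a b + h b a"
proof -
  assume a: "a \<in> polyT0" "b \<in> polyT0"
  have "(q (a * b) 1 + 2 * h a b) + (q (a * b) 1 + 2 * h b a) = 2 * (q (a * b) 1 + k (a * b))"
    using ra_oee[of a b 1] a by (simp add: r_eq r_one mult.commute[of b a])
  then have "2 * (k (a * b) - (h a b + h b a)) = 0" by algebra
  from two_mult[OF this] show ?thesis by simp
qed

text \<open>Right alternativity at the odd arguments \<open>a\<close>, \<open>b\<close>, 1. Once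
  \<open>h_mult_var0\<close> removes the first term, D becomes skew with respect to
  \<open>h\<close>.\<close>

lemma h_leibniz:
  assumes "a \<in> polyT0"
  shows "h (var 0 * a) b + 2 * h (polyT_deriv a) b + 2 * h a (polyT_deriv b) = 0"
proof -
  have "q (var 0 * a * b) 1 + 2 * q (polyT_deriv a * b) 1 + q (a * polyT_deriv b) 1
    - (q (var 0 * a * b) 1 + h (var 0 * a) b + 2 * (q (polyT_deriv a * b) 1 + h (polyT_deriv a) b)) =
      q (a * polyT_deriv b) 1 + 2 * h a (polyT_deriv b)"
    using ra_ooo[of a b 1] assms
    by (simp add: odd_mul_alt bilinear r_eq q_eq[of "var 0 * a" b] q_eq[of "polyT_deriv a" b])
  then show ?thesis by algebra
qed

lemma k_deriv: "k (polyT_deriv b) = - h (var 0) b"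
proof -
  have "q (var 0 * b) 1 + q (polyT_deriv b) 1 - (q (var 0 * b) 1 + h (var 0) b) =
      q (polyT_deriv b) 1 + k (polyT_deriv b)"
    using ra_ooo[of 1 b 1] by (simp add: odd_mul_alt bilinear r_one q_eq[of "var 0" b])
  then show ?thesis by algebra
qed

lemma k_var0: "k (var 0) = 0"
proof -
  have "q (var 0) 1 + q (var 0) 1 + q (var 0) 1 =
      (q (var 0) 1 + k (var 0)) + (q (var 0) 1 + k (var 0)) + (q (var 0) 1 + k (var 0))"
    using cyclic_ooo[of 1 1 1] by (simp only: odd_mul_alt r_one polyT_deriv_one mult_1_right mult_zero_right add_0_right)
  then have "3 * k (var 0) = 0" by algebra
  then show ?thesis by (rule three_mult)
qed

lemma h_var0_left:
  assumes "a \<in> polyT0"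
  shows "h (var 0) a = 2 * h a (var 0)"
proof -
  have "q (var 0 * a) 1 + 2 * q (polyT_deriv a) 1 + (q (var 0 * a) 1 + h (var 0) a) +
      (q (var 0 * a) 1 + q (polyT_deriv a) 1) =
    (q (var 0 * a) 1 + 2 * h a (var 0)) + (q (var 0 * a) 1 + k (var 0 * a) + (q (polyT_deriv a) 1 + k (polyT_deriv a)))
     + (q (var 0 * a) 1 + k (var 0 * a) + 2 * (q (polyT_deriv a) 1 + k (polyT_deriv a)))"
    using cyclic_ooo[of a 1 1] assms
    by (simp add: odd_mul_alt bilinear r_one r_eq q_eq[of "var 0" a] mult.commute[of a "var 0"])
  moreover have "k (var 0 * a) = h (var 0) a + h a (var 0)"
    using assms by (simp add: k_mult)
  ultimately have "2 * (h (var 0) a - 2 * h a (var 0)) = 0"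
    using k_deriv[of a] by algebra
  from two_mult[OF this] show ?thesis by simp
qed

text \<open>With x = \<open>h (var 0 * b) c\<close>, the swap rule and \<open>h_var0_left\<close>
  give \<open>h (var 0) (b * c)\<close> = 2x, while \<open>h_mult_right\<close> says that twice this
  value is 3x. Hence 4x = 3x.\<close>

lemma h_mult_var0:
  assumes "b \<in> polyT0" "c \<in> polyT0"
  shows "h (var 0 * b) c = 0"
proof -
  have "h (b * c) (var 0) = h (var 0 * b) c"
    using h_mult_swap[of b c "var 0"] assms by (simp add: mult.commute)
  moreover have "h (var 0) (b * c) = 2 * h (b * c) (var 0)"
    using assms by (intro h_var0_left) simp
  moreover have "2 * h (var 0) (b * c) = 3 * h (var 0 * b) c"
    using assms by (intro h_mult_right) simp_all
  ultimately have "2 * (2 * h (var 0 * b) c) - 3 * h (var 0 * b) c = 0" by (simp only: diff_self)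
  moreover have "h (var 0 * b) c = 2 * (2 * h (var 0 * b) c) - 3 * h (var 0 * b) c" by algebra
  ultimately show ?thesis by metis
qed

lemma h_deriv:
  assumes "a \<in> polyT0" "b \<in> polyT0"
  shows "h (polyT_deriv a) b = - h a (polyT_deriv b)"
proof -
  have "2 * (h (polyT_deriv a) b + h a (polyT_deriv b)) = 0"
    using h_leibniz[of a b] h_mult_var0[of a b] assms by (simp add: algebra_simps)
  from two_mult[OF this] show ?thesis by (simp add: eq_neg_iff_add_eq_0)
qed

lemma h_var_shift: "h (var i) (var j) = (-1) ^ j * h (var (i + j)) (var 0)"
proof (induction j arbitrary: i)
  case (Suc j)
  have "h (var i) (var (Suc j)) = - h (var (Suc i)) (var j)"
    using h_deriv[of "var i" "var j"] by (simp add: polyT_deriv_var)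
  then show ?case using Suc[of "Suc i"] by simp
qed simp

lemma h_var: "h (var i) (var j) = 0"
proof -
  have "h (var n) (var 0) = 0" for n
  proof -
    have eq: "h (var 0) (var n) = 2 * h (var n) (var 0)" "h (var 0) (var n) = (-1) ^ n * h (var n) (var 0)"
      using h_var0_left[of "var n"] h_var_shift[of 0 n] by simp_all
    show ?thesis
    \<comment> \<open>For x = \<open>h (var n) (var 0)\<close> the two equations read 2x = x or 2x =
      -x; the second needs 3 to be invertible.\<close>
    proof (cases "even n")
      case True
      then have "h (var 0) (var n) = h (var n) (var 0)" using eq(2) by simp
      then show ?thesis using eq(1) by (metis add_cancel_right_left mult_2)
    next
      case False
      then have "h (var 0) (var n) = - h (var n) (var 0)" using eq(2) by simp
      then have "3 * h (var n) (var 0) = 0" using eq(1) by algebra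
      then show ?thesis by (rule three_mult)
    qed
  qed
  then show ?thesis by (simp add: h_var_shift[of i j])
qed

text \<open>By the Leibniz rule \<open>var (Suc i) * b\<close> is a derivative minus a multiple of
  \<open>var i\<close>, and \<open>h_deriv\<close> moves the derivative to the other argument. This
  passes from t_0 to all variables.\<close>

lemma h_mult_var: "b \<in> polyT0 \<Longrightarrow> c \<in> polyT0 \<Longrightarrow> h (var i * b) c = 0"
proof (induction i arbitrary: b c)
  case 0
  then show ?case by (rule h_mult_var0)
next
  case (Suc i)
  have "var (Suc i) * b = polyT_deriv (var i * b) - var i * polyT_deriv b"
    by (simp add: polyT_deriv_mult polyT_deriv_var)
  then show ?case using Suc by (simp add: h.bilinear h_deriv)
qed

lemma h_zero: "a \<in> polyT0 \<Longrightarrow> b \<in> polyT0 \<Longrightarrow> h a b = 0"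
proof (induction a arbitrary: b rule: polyT0_induct)
  case (var i c)
  then have "h (var i) b = 0"
  proof (induction b rule: polyT0_induct)
    case (mult j b)
    then have "2 * h (var i) (var j * b) = 0"
      using h_mult_right[of "var i" "var j" b] h_mult_var[of "var j" b i] by simp
    then show ?case by (rule two_mult)
  qed (simp_all add: h.bilinear h_var)
  then show ?case by (simp add: h.bilinear)
qed (simp_all add: h.bilinear h_mult_var)

lemma k_zero: "a \<in> polyT0 \<Longrightarrow> k a = 0"
proof (induction a rule: polyT0_induct)
  case (var i c)
  show ?case
  proof (cases i)
    case 0
    then show ?thesis by (simp add: k_linear k_var0)
  next
    case (Suc j)
    then show ?thesis
      using k_deriv[of "var j"] by (simp add: k_linear polyT_deriv_var h_var)
  qed
qed (simp_all add: k_linear k_mult h_zero)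

lemma even_odd:
  assumes "a \<in> polyT0"
  shows "q a b = q (a * b) 1" "r b a = q (a * b) 1"
proof -
  obtain c b' where b: "b = polyT_scalar c 1 + b'" "b' \<in> polyT0" by (rule polyT_const_cases)
  have "q a b' = q (a * b') 1"
    using h_zero[of a b'] assms b(2) by (simp add: h_def)
  then show "q a b = q (a * b) 1"
    by (simp add: b(1) bilinear polyT_scalar_simps distrib_left)
  show "r b a = q (a * b) 1"
    using assms b(2) h_zero[of b' a] k_zero[of a]
    by (simp add: b(1) bilinear polyT_scalar_simps distrib_left r_eq r_one mult.commute)
qed

section \<open>Arguments of equal parity: \<open>p\<close> is symmetric and associative\<close>

lemma s_eq: "a \<in> polyT0 \<Longrightarrow> s a b = s (a * b) 1 - p a (polyT_deriv b)"
  using ra_eoo[of a b 1] by (simp add: algebra_simps)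

lemma s_one: "a \<in> polyT0 \<Longrightarrow> 2 * s 1 a = s a 1 + p (var 0) a"
  using ra_oeo[of a 1 1] by (simp add: odd_mul_alt)

lemma s_mult:
  assumes "a \<in> polyT0" "b \<in> polyT0"
  shows "s (a * b) 1 = p (var 0 * b) a + 2 * p (polyT_deriv b) a + 2 * p b (polyT_deriv a)"
proof -
  have "s (a * b) 1 + (p (var 0 * b) a + 2 * p (polyT_deriv b) a) = 2 * (s (a * b) 1 - p b (polyT_deriv a))"
    using ra_oeo[of a b 1] assms s_eq[of b a] by (simp add: odd_mul_alt bilinear mult.commute[of b a])
  then show ?thesis by algebra
qed

text \<open>Both \<open>s a c\<close> and \<open>2 * s 1 (a * c)\<close> are expressed through
  \<open>s (a * c) 1\<close>, which cancels and leaves a relation in \<open>p\<close> alone.\<close>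

lemma p_deriv_swap:
  assumes "a \<in> polyT0" "c \<in> polyT0"
  shows "p (var 0) (a * c) + p a (polyT_deriv c) = p (var 0 * c) a + p (polyT_deriv c) a"
proof -
  have "s (a * c) 1 - p a (polyT_deriv c) + (p (var 0 * c) a + p (polyT_deriv c) a) =
      s (a * c) 1 + p (var 0) (a * c)"
    using ra_oeo[of a 1 c] assms s_eq[of a c] s_one[of "a * c"] by (simp add: odd_mul_alt bilinear)
  then show ?thesis by algebra
qed

lemma p_var0_mult3:
  assumes "a \<in> polyT0" "c \<in> polyT0"
  shows "3 * p (var 0) (a * c) = p (var 0 * c) a + 2 * p a (var 0 * c)"
proof -
  \<comment> \<open>The cyclic identity at \<open>a\<close>, 1, \<open>c\<close> is doubled because
    \<open>s_one\<close> determines only twice \<open>s 1 (a * c)\<close>.\<close>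
  have "2 * ((s (a * c) 1 - p a (polyT_deriv c)) - (p a (var 0 * c) + p a (polyT_deriv c))
      + (p (var 0 * c) a + p (polyT_deriv c) a) - s (a * c) 1 + (s (a * c) 1 - p c (polyT_deriv a)))
      - (s (a * c) 1 + p (var 0) (a * c)) = 0"
    using arg_cong[OF cyclic_eoo[of a 1 c], of "\<lambda>x. 2 * x"] assms s_eq[of a c] s_eq[of c a] s_one[of "a * c"]
    by (simp add: odd_mul_alt bilinear mult.commute[of c a] algebra_simps)
  then show ?thesis using s_mult[OF assms] p_deriv_swap[OF assms] by algebra
qed

text \<open>The two expansions of \<open>s (b * c) 1\<close> by \<open>s_mult\<close> agree; after
  \<open>p_deriv_swap\<close> removes the derivatives, their equality says that
  \<open>p (var 0 * b) c\<close> is symmetric in \<open>b\<close> and \<open>c\<close>. Right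
  alternativity on even arguments then yields the claim.\<close>

lemma p_var0_mult:
  assumes "b \<in> polyT0" "c \<in> polyT0"
  shows "p (var 0 * b) c = p (var 0) (b * c)"
proof -
  have "p (var 0 * b) c = p (var 0 * c) b"
    using s_mult[of b c] s_mult[of c b] p_deriv_swap[of b c] p_deriv_swap[of c b] assms
    by (simp add: mult.commute[of c b]) algebra
  then have "2 * (p (var 0 * b) c - p (var 0) (b * c)) = 0"
    using ra_eee[of "var 0" b c] assms by simp
  then show ?thesis using two by simp
qed

lemma p_commute_var0_mult:
  assumes "a \<in> polyT0" "c \<in> polyT0"
  shows "p a (var 0 * c) = p (var 0 * c) a"
proof -
  have "2 * (p a (var 0 * c) - p (var 0 * c) a) = 0"
    using p_var0_mult3[of a c] p_var0_mult[of c a] assms by (simp add: mult.commute[of c a]) algebra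
  then show ?thesis using two by simp
qed

lemma p_commute_deriv:
  assumes "a \<in> polyT0" "c \<in> polyT0"
  shows "p a (polyT_deriv c) = p (polyT_deriv c) a"
  using p_deriv_swap[of a c] p_var0_mult[of c a] assms by (simp add: mult.commute[of c a])

lemma p_commute_var: "a \<in> polyT0 \<Longrightarrow> p a (var i) = p (var i) a"
proof (cases i)
  case 0
  assume "a \<in> polyT0"
  then show ?thesis using cyclic_eoo[of a 1 1] 0 by (simp add: odd_mul_alt algebra_simps)
next
  case (Suc j)
  assume "a \<in> polyT0"
  then show ?thesis using p_commute_deriv[of a "var j"] Suc by (simp add: polyT_deriv_var)
qed

text \<open>The Leibniz rule again reduces \<open>var (Suc i)\<close> to \<open>var i\<close>, now
  with \<open>p_commute_deriv\<close> for the derivative.\<close>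

lemma p_commute_var_mult: "a \<in> polyT0 \<Longrightarrow> b \<in> polyT0 \<Longrightarrow> p a (var i * b) = p (var i * b) a"
proof (induction i arbitrary: b)
  case 0
  then show ?case by (rule p_commute_var0_mult)
next
  case (Suc i)
  have "var (Suc i) * b = polyT_deriv (var i * b) - var i * polyT_deriv b"
    by (simp add: polyT_deriv_mult polyT_deriv_var)
  then show ?case using Suc by (simp add: bilinear p_commute_deriv)
qed

lemma p_commute:
  assumes "a \<in> polyT0" "b \<in> polyT0"
  shows "p a b = p b a"
  using assms(2)
  by (induction b rule: polyT0_induct) (simp_all add: assms(1) bilinear p_commute_var p_commute_var_mult)

text \<open>By symmetry only X = \<open>p (a * b) c\<close>, Y = \<open>p (b * c) a\<close> and Z =
  \<open>p (c * a) b\<close> occur. Cyclic instances of right alternativity give X + Z = 2Y, X + Y =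
  2Z and Y + Z = 2X, so their differences are killed by 3.\<close>

lemma p_assoc:
  assumes "a \<in> polyT0" "b \<in> polyT0" "c \<in> polyT0"
  shows "p (a * b) c = p a (b * c)"
proof -
  have "3 * (p (a * b) c - p a (b * c)) = 0"
    using ra_eee[of a b c] ra_eee[of b c a] ra_eee[of c a b] assms
      p_commute[of "b * c" a] p_commute[of "c * a" b] p_commute[of "a * b" c]
    by (simp add: mult.commute[of c b] mult.commute[of c a] mult.commute[of b a]) algebra
  then show ?thesis using three by simp
qed

section \<open>Construction of the coboundary on even elements\<close>

text \<open>The values are forced: t_0 is the square of the odd unit \<open>(0, 1)\<close>, and t_i
  for positive \<open>i\<close> is
  \<open>odd_mul (var (i - 1)) 1 - odd_mul 1 (var (i - 1))\<close>.\<close>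

definition coboundary_var :: "nat \<Rightarrow> 'f" where
  "coboundary_var i = (if i = 0 then s 1 1 else s (var (i - 1)) 1 - s 1 (var (i - 1)))"

text \<open>
  Splitting off the least variable is an arbitrary choice: any other one gives the same value
  because \<open>p\<close> is symmetric and associative.
\<close>

definition coboundary_monomial :: "(nat \<Rightarrow>\<^sub>0 nat) \<Rightarrow> 'f" where
  "coboundary_monomial m = (let i = Min (Poly_Mapping.keys m) in
     if m = Poly_Mapping.single i 1 then coboundary_var i
     else p (var i) (Poly_Mapping.single (m - Poly_Mapping.single i 1) 1))"

definition coboundary :: "'f polyT \<Rightarrow> 'f" where
  "coboundary = ksum (\<lambda>m c. c * coboundary_monomial m)"

lemma coboundary_single: "coboundary (Poly_Mapping.single m c) = c * coboundary_monomial m"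
  by (simp add: coboundary_def ksum_single)

lemma coboundary_add: "coboundary (a + b) = coboundary a + coboundary b"
  unfolding coboundary_def by (rule ksum_add) (simp_all add: distrib_right)

lemma coboundary_simps:
  "coboundary (a + b) = coboundary a + coboundary b"
  "coboundary (a - b) = coboundary a - coboundary b"
  "coboundary (2 * a) = 2 * coboundary a"
  "coboundary (polyT_scalar c a) = c * coboundary a"
proof -
  show "coboundary (a - b) = coboundary a - coboundary b"
    using coboundary_add[of "a - b" b] by (simp add: algebra_simps)
  show "coboundary (2 * a) = 2 * coboundary a"
    using coboundary_add[of a a] by simp
  show "coboundary (polyT_scalar c a) = c * coboundary a"
  proof (induction a rule: poly_mapping_add_induct)
    case (single m d)
    then show ?case
      by (simp add: polyT_scalar_eq mult_single coboundary_single mult.assoc)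
  qed (simp_all add: polyT_scalar_simps coboundary_add distrib_left, simp add: coboundary_def)
qed (rule coboundary_add)

lemma coboundary_var: "coboundary (var i) = coboundary_var i"
  by (simp add: var_def coboundary_single coboundary_monomial_def)

text \<open>Associativity of \<open>p\<close> moves every factor except one \<open>var i\<close> to
  the right argument.\<close>

lemma p_single_remove:
  assumes "m \<noteq> 0" "n \<noteq> 0" "i \<in> Poly_Mapping.keys m"
  shows "p (Poly_Mapping.single m 1) (Poly_Mapping.single n 1) =
    p (var i) (Poly_Mapping.single (m + n - Poly_Mapping.single i 1) 1)"
proof -
  let ?e = "Poly_Mapping.single i (1::nat)"
  have mn: "m - ?e + n = m + n - ?e"
    using assms(3) by (intro poly_mapping_eqI)
      (auto simp: lookup_add lookup_minus lookup_single when_def in_keys_iff)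
  have "p (var i * Poly_Mapping.single (m - ?e) 1) (Poly_Mapping.single n 1) =
      p (var i) (Poly_Mapping.single (m - ?e) 1 * Poly_Mapping.single n 1)"
  proof (cases "m - ?e = 0")
    case False
    then show ?thesis using assms(2) by (intro p_assoc) simp_all
  qed simp
  then show ?thesis
    unfolding single_remove[OF assms(3), of 1] by (simp only: mult_single mn mult_1_right)
qed

lemma p_single:
  assumes m: "m \<noteq> 0" and n: "n \<noteq> 0"
  shows "p (Poly_Mapping.single m 1) (Poly_Mapping.single n 1) = coboundary_monomial (m + n)"
proof -
  let ?i = "Min (Poly_Mapping.keys (m + n))"
  let ?e = "Poly_Mapping.single ?i (1::nat)"
  have "m + n \<noteq> 0" using m by (simp add: monomial_add_eq_0_iff)
  then have "Poly_Mapping.keys (m + n) \<noteq> {}" by simp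
  then have "?i \<in> Poly_Mapping.keys (m + n)" by (intro Min_in) simp_all
  then have cases: "?i \<in> Poly_Mapping.keys m \<or> ?i \<in> Poly_Mapping.keys n"
    by (auto simp: in_keys_iff lookup_add)
  have split: "a = ?e + (a - ?e)" if "?i \<in> Poly_Mapping.keys a" for a
    using that by (intro poly_mapping_eqI)
      (auto simp: lookup_add lookup_minus lookup_single when_def in_keys_iff)
  \<comment> \<open>A product of two nonconstant monomials is not a variable, so
    \<open>coboundary_monomial\<close> takes its second branch.\<close>
  have "m + n \<noteq> ?e"
  proof
    assume e: "m + n = ?e"
    from cases show False
    proof
      assume "?i \<in> Poly_Mapping.keys m"
      from e split[OF this] have "m - ?e + n = 0"
        by (metis add.assoc add.right_neutral add_left_cancel)
      then show False using n by (simp add: monomial_add_eq_0_iff)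
    next
      assume "?i \<in> Poly_Mapping.keys n"
      from e split[OF this] have "n - ?e + m = 0"
        by (metis add.assoc add.commute add.right_neutral add_left_cancel)
      then show False using m by (simp add: monomial_add_eq_0_iff)
    qed
  qed
  then have eq: "coboundary_monomial (m + n) = p (var ?i) (Poly_Mapping.single (m + n - ?e) 1)"
    by (simp add: coboundary_monomial_def Let_def)
  from cases show ?thesis
  proof
    assume "?i \<in> Poly_Mapping.keys m"
    then show ?thesis using p_single_remove[OF m n] eq by simp
  next
    assume "?i \<in> Poly_Mapping.keys n"
    then have "p (Poly_Mapping.single n 1) (Poly_Mapping.single m 1) = coboundary_monomial (m + n)"
      using p_single_remove[OF n m] eq by (simp add: add.commute)
    then show ?thesis using m n p_commute[of "Poly_Mapping.single m 1" "Poly_Mapping.single n 1"] by simp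
  qed
qed

lemma even_even:
  assumes "a \<in> polyT0" "b \<in> polyT0"
  shows "p a b = coboundary (a * b)"
  using assms(1)
proof (induction a rule: polyT0_monomial_induct)
  case (single m c)
  from assms(2) show ?case
  proof (induction b rule: polyT0_monomial_induct)
    case (single n d)
    have s: "Poly_Mapping.single m' c' = polyT_scalar c' (Poly_Mapping.single m' 1)"
      for m' :: "nat \<Rightarrow>\<^sub>0 nat" and c' :: 'f
      by (simp add: polyT_scalar_eq mult_single)
    show ?case
      using p_single[OF \<open>m \<noteq> 0\<close> \<open>n \<noteq> 0\<close>]
      by (simp add: s[of m c] s[of n d] bilinear polyT_scalar_simps coboundary_simps mult_single coboundary_single)
  qed (simp add: bilinear coboundary_simps distrib_left)
qed (simp add: bilinear coboundary_simps distrib_right)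

text \<open>On variables this solves the linear system formed by \<open>s_one\<close> and the
  definition of \<open>coboundary_var\<close>; on decomposable elements it is
  \<open>s_mult\<close>.\<close>

lemma s_one_right:
  assumes "a \<in> polyT0"
  shows "s a 1 = coboundary (var 0 * a) + 2 * coboundary (polyT_deriv a)"
  using assms
proof (induction a rule: polyT0_induct)
  case (var i c)
  have "coboundary (var (Suc i)) = s (var i) 1 - s 1 (var i)"
    by (simp add: coboundary_var coboundary_var_def)
  moreover have "2 * s 1 (var i) = s (var i) 1 + coboundary (var 0 * var i)"
    using s_one[of "var i"] by (simp add: even_even)
  ultimately have "s (var i) 1 = coboundary (var 0 * var i) + 2 * coboundary (var (Suc i))"
    by algebra
  then show ?case
    by (simp add: bilinear polyT_scalar_simps coboundary_simps polyT_deriv_scalar polyT_deriv_var distrib_left)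
next
  case (mult i b)
  then show ?case
    using s_mult[of "var i" b]
    by (simp add: even_even polyT_deriv_mult coboundary_simps distrib_left mult.commute mult.left_commute add.assoc)
qed (simp add: bilinear coboundary_simps polyT_deriv_add distrib_left)

lemma s_one_left:
  assumes "a \<in> polyT0"
  shows "s 1 a = coboundary (odd_mul 1 a)"
proof -
  have "2 * s 1 a = coboundary (var 0 * a) + 2 * coboundary (polyT_deriv a) + coboundary (var 0 * a)"
    using s_one[OF assms] s_one_right[OF assms] assms by (simp add: even_even)
  then have "2 * (s 1 a - (coboundary (var 0 * a) + coboundary (polyT_deriv a))) = 0" by algebra
  from two_mult[OF this] show ?thesis by (simp add: odd_mul_alt coboundary_simps)
qed

text \<open>For \<open>a\<close> without constant term, \<open>s_eq\<close> moves \<open>b\<close>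
  into the first argument: 2 D(ab) - a D(b) = 2 D(a) b + a D(b) reproduces the asymmetric product.
  The constant part of \<open>a\<close> is covered by the case of left argument 1.\<close>

lemma odd_odd: "s a b = coboundary (odd_mul a b)"
proof -
  have 1: "s a b = coboundary (odd_mul a b)" if "a \<in> polyT0" for a
  proof -
    have "s a b = coboundary (var 0 * (a * b)) + 2 * coboundary (polyT_deriv (a * b)) - coboundary (a * polyT_deriv b)"
      using s_eq[OF that, of b] that by (simp add: s_one_right even_even)
    then show ?thesis
      by (simp add: odd_mul_alt polyT_deriv_mult coboundary_simps mult.assoc)
  qed
  have 2: "s 1 b = coboundary (odd_mul 1 b)"
  proof -
    obtain c b' where b: "b = polyT_scalar c 1 + b'" "b' \<in> polyT0" by (rule polyT_const_cases)
    have "s 1 1 = coboundary (var 0)" by (simp add: coboundary_var coboundary_var_def)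
    then show ?thesis
      using s_one_left[OF b(2)]
      by (simp add: b(1) odd_mul_alt bilinear coboundary_simps polyT_scalar_simps polyT_deriv_add
          polyT_deriv_scalar distrib_left)
  qed
  obtain c a' where a: "a = polyT_scalar c 1 + a'" "a' \<in> polyT0" by (rule polyT_const_cases)
  show ?thesis
    using 1[OF a(2)] 2
    by (simp add: a(1) odd_mul_alt bilinear coboundary_simps polyT_scalar_simps polyT_deriv_add
          polyT_deriv_scalar distrib_left distrib_right)
qed

end

section \<open>$B_0$ is a $(-1,1)$-superalgebra\<close>

lemma B0_simps [simp]:
  "x \<in> carrier B0_superalg \<longleftrightarrow> fst x \<in> polyT0"
  "x \<in> even_part B0_superalg \<longleftrightarrow> fst x \<in> polyT0 \<and> snd x = 0"
  "x \<in> odd_part B0_superalg \<longleftrightarrow> fst x = 0"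
  "scalar B0_superalg c (a, b) = (polyT_scalar c a, polyT_scalar c b)"
  by (cases x; auto simp: B0_superalg_def vector_type_def)+

lemma B0_mul [simp]:
  "mul B0_superalg (a, b) (a', b') = (a * a' + odd_mul b b', a * b' + b * a')"
  by (simp add: B0_superalg_def vector_type_def odd_mul_def)

lemma odd_mul_simps:
  "odd_mul (a + b) c = odd_mul a c + odd_mul b c"
  "odd_mul a (b + c) = odd_mul a b + odd_mul a c"
  "odd_mul (polyT_scalar k a) b = polyT_scalar k (odd_mul a b)"
  "odd_mul a (polyT_scalar k b) = polyT_scalar k (odd_mul a b)"
  "odd_mul 0 a = 0" "odd_mul a 0 = 0"
  by (simp_all add: odd_mul_def polyT_deriv_add polyT_deriv_scalar polyT_scalar_simps algebra_simps)

lemma B0_superalgebra: "superalgebra (B0_superalg :: ('f::field, _) superalg)"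
proof -
  interpret vector_space "scalar (B0_superalg :: ('f::field, _) superalg)"
    by unfold_locales (auto simp: polyT_scalar_simps)
  show ?thesis
  proof
    show "carrier (B0_superalg :: ('f, _) superalg) =
        {x + y |x y. x \<in> even_part B0_superalg \<and> y \<in> odd_part B0_superalg}"
    proof (intro set_eqI iffI)
      fix x :: "'f polyT \<times> 'f polyT" assume "x \<in> carrier B0_superalg"
      then show "x \<in> {x + y |x y. x \<in> even_part B0_superalg \<and> y \<in> odd_part B0_superalg}"
        by (intro CollectI exI[of _ "(fst x, 0)"] exI[of _ "(0, snd x)"]) simp
    qed auto
  qed (auto simp: subspace_def part_def polyT_scalar_simps odd_mul_simps algebra_simps zero_prod_def split: if_splits)
qed

lemma B0_part_cases:
  assumes "x \<in> part B0_superalg i"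
  obtains a where "even i" "a \<in> polyT0" "x = (a, 0)" | a where "odd i" "x = (0, a)"
  using assms by (cases x) (auto simp: part_def split: if_splits)

lemma minus_one_power_parity: "(-1) ^ n = (if even n then 1 else - 1 :: 'f::field)"
  by simp

lemma polyT_scalar_minus_one: "polyT_scalar (- 1) a = - a"
  by (rule poly_mapping_eqI) simp

lemma B0_minus_one_one:
  assumes "(2::'f::field) \<noteq> 0"
  shows "minus_one_one_superalgebra (B0_superalg :: ('f, _) superalg)"
proof -
  interpret superalgebra "B0_superalg :: ('f, _) superalg" by (rule B0_superalgebra)
  have "super_right_alternative (B0_superalg :: ('f, _) superalg)"
    unfolding super_right_alternative_def
  proof (intro allI ballI)
    fix i j k and x y z :: "'f polyT \<times> 'f polyT"
    assume "x \<in> part B0_superalg i" "y \<in> part B0_superalg j" "z \<in> part B0_superalg k"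
    \<comment> \<open>In each of the eight parity patterns the Leibniz rule leaves an identity in a
      commutative ring.\<close>
    then show "associator B0_superalg x y z +
        scalar B0_superalg ((-1) ^ (j * k)) (associator B0_superalg x z y) = 0"
      by (elim B0_part_cases; simp add: associator_def minus_one_power_parity polyT_scalar_minus_one
          polyT_scalar_simps odd_mul_def polyT_deriv_mult polyT_deriv_add algebra_simps zero_prod_def)
  qed
  moreover have "super_cyclic (B0_superalg :: ('f, _) superalg)"
    unfolding super_cyclic_def
  proof (intro allI ballI)
    fix i j k and x y z :: "'f polyT \<times> 'f polyT"
    assume "x \<in> part B0_superalg i" "y \<in> part B0_superalg j" "z \<in> part B0_superalg k"
    then show "associator B0_superalg x y z +
        scalar B0_superalg ((-1) ^ (i * (j + k))) (associator B0_superalg y z x) +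
        scalar B0_superalg ((-1) ^ (k * (i + j))) (associator B0_superalg z x y) = 0"
      by (elim B0_part_cases; simp add: associator_def minus_one_power_parity polyT_scalar_minus_one
          polyT_scalar_simps odd_mul_def polyT_deriv_mult polyT_deriv_add algebra_simps zero_prod_def)
  qed
  ultimately show ?thesis using assms by (intro minus_one_one_superalgebraI)
qed

section \<open>The grading by degree\<close>

definition weight :: "(nat \<Rightarrow>\<^sub>0 nat) \<Rightarrow> nat" where
  "weight m = ksum (\<lambda>i e. Suc i * e) m"

lemma weight_add: "weight (m + n) = weight m + weight n"
  unfolding weight_def by (rule ksum_add) (simp_all add: algebra_simps)

lemma weight_single: "weight (Poly_Mapping.single i e) = Suc i * e"
  by (simp add: weight_def ksum_single)

lemma weight_0 [simp]: "weight 0 = 0"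
  by (simp add: weight_def)

text \<open>
  The monomial $t_0^{e_0} t_1^{e_1} \cdots$ has degree $2 \sum_i (i + 1) e_i$ in the generator
  $\bar 1$, and its copy in the odd part has one degree more; the second argument below is
  this offset.
\<close>

definition isobaric :: "nat \<Rightarrow> nat \<Rightarrow> 'f::field polyT \<Rightarrow> bool" where
  "isobaric n k a \<longleftrightarrow> (\<forall>m\<in>Poly_Mapping.keys a. 2 * weight m + k = n)"

lemma isobaric_shift: "isobaric (n + 2) (k + 2) a = isobaric n k a"
  by (auto simp: isobaric_def)

lemma isobaric_0 [simp]: "isobaric n k 0"
  by (simp add: isobaric_def)

lemma isobaric_add: "isobaric n k a \<Longrightarrow> isobaric n k b \<Longrightarrow> isobaric n k (a + b)"
  using Poly_Mapping.keys_add[of a b] by (auto simp: isobaric_def)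

lemma isobaric_scalar: "isobaric n k a \<Longrightarrow> isobaric n k (polyT_scalar c a)"
  by (auto simp: isobaric_def in_keys_iff)

lemma isobaric_mult: "isobaric n k a \<Longrightarrow> isobaric n' k' b \<Longrightarrow> isobaric (n + n') (k + k') (a * b)"
  using keys_mult[of a b] by (fastforce simp: isobaric_def weight_add)

lemma isobaric_single: "isobaric (2 * weight m) 0 (Poly_Mapping.single m c)"
  by (simp add: isobaric_def)

lemma isobaric_sum: "(\<And>i. i \<in> S \<Longrightarrow> isobaric n k (f i)) \<Longrightarrow> isobaric n k (sum f S)"
  by (induction S rule: infinite_finite_induct) (simp_all add: isobaric_add)

lemma weight_remove:
  assumes "i \<in> Poly_Mapping.keys m"
  shows "weight m = weight (m - Poly_Mapping.single i 1) + Suc i"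
proof -
  have "m - Poly_Mapping.single i 1 + Poly_Mapping.single i 1 = m"
    using assms by (intro poly_mapping_eqI)
      (auto simp: lookup_add lookup_minus lookup_single when_def in_keys_iff)
  then show ?thesis
    using weight_add[of "m - Poly_Mapping.single i 1" "Poly_Mapping.single i 1"] by (simp add: weight_single)
qed

lemma isobaric_deriv:
  assumes "isobaric n k a"
  shows "isobaric (n + 2) k (polyT_deriv a)"
  unfolding polyT_deriv_def
proof (intro isobaric_sum)
  fix m i assume m: "m \<in> Poly_Mapping.keys a" and i: "i \<in> Poly_Mapping.keys m"
  have "2 * weight m + k = n" using assms m by (simp add: isobaric_def)
  then have "2 * weight (m - Poly_Mapping.single i 1 + Poly_Mapping.single (Suc i) 1) + k = n + 2"
    using weight_remove[OF i] by (simp add: weight_add weight_single)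
  then show "isobaric (n + 2) k (Poly_Mapping.single
      (m - Poly_Mapping.single i 1 + Poly_Mapping.single (Suc i) 1)
      (of_nat (Poly_Mapping.lookup m i) * Poly_Mapping.lookup a m))"
    by (simp add: isobaric_def)
qed

text \<open>Each summand gains 2 in degree from t_0 or D, and the offsets of the two odd factors add
  up to 2. \<open>isobaric_shift\<close> cancels one against the other.\<close>

lemma isobaric_odd_mul:
  assumes a: "isobaric n 1 a" and b: "isobaric n' 1 b"
  shows "isobaric (n + n') 0 (odd_mul a b)"
proof -
  have v: "isobaric 2 0 (var 0 :: 'a polyT)"
    using isobaric_single[of "Poly_Mapping.single 0 1" 1] by (simp add: var_def weight_single)
  have "isobaric (n + n' + 2) (0 + 2) (var 0 * a * b)"
    using isobaric_mult[OF isobaric_mult[OF v a] b] by (simp add: ac_simps numeral_2_eq_2)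
  moreover have "isobaric (n + n' + 2) (0 + 2) (polyT_deriv a * b)"
    using isobaric_mult[OF isobaric_deriv[OF a] b] by (simp add: ac_simps numeral_2_eq_2)
  moreover have "isobaric (n + n' + 2) (0 + 2) (a * polyT_deriv b)"
    using isobaric_mult[OF a isobaric_deriv[OF b]] by (simp add: ac_simps numeral_2_eq_2)
  ultimately show ?thesis
    unfolding isobaric_shift odd_mul_alt mult_2 by (intro isobaric_add)
qed

definition B0_homogeneous :: "nat \<Rightarrow> 'f::field polyT \<times> 'f polyT \<Rightarrow> bool" where
  "B0_homogeneous n u \<longleftrightarrow> isobaric n 0 (fst u) \<and> isobaric n 1 (snd u)"

lemma B0_homogeneous_mul:
  assumes "B0_homogeneous m u" "B0_homogeneous n v"
  shows "B0_homogeneous (m + n) (mul B0_superalg u v)"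
proof (cases u, cases v)
  fix a b a' b' assume "u = (a, b)" "v = (a', b')"
  then show ?thesis
    using assms isobaric_mult[of m 0 a n 0 a'] isobaric_mult[of m 0 a n 1 b'] isobaric_mult[of m 1 b n 0 a']
    by (simp add: B0_homogeneous_def isobaric_add isobaric_odd_mul)
qed

section \<open>Degree components in the free superalgebra\<close>

lemma monomial_degree_pos: "0 < monomial_degree t"
  by (induction t) simp_all

lemma monomial_degree_1: "monomial_degree t = 1 \<longleftrightarrow> t = Gen"
proof (cases t)
  case (Prod u v)
  then show ?thesis using monomial_degree_pos[of u] monomial_degree_pos[of v] by simp
qed simp

text \<open>Restricting the single terms to monomials of \<open>p\<close> lets them inherit
  properties of its support, such as parity or the absence of \<open>Gen\<close>.\<close>

lemma poly_mapping_keys_induct [case_names zero single plus]: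
  fixes p :: "'k \<Rightarrow>\<^sub>0 'v::ab_group_add"
  assumes "P 0" "\<And>t c. t \<in> Poly_Mapping.keys p \<Longrightarrow> P (Poly_Mapping.single t c)"
    "\<And>p q. P p \<Longrightarrow> P q \<Longrightarrow> P (p + q)"
  shows "P p"
proof -
  have "P (\<Sum>t\<in>S. Poly_Mapping.single t (Poly_Mapping.lookup p t))"
    if "finite S" "S \<subseteq> Poly_Mapping.keys p" for S
    using that by (induction S) (simp_all add: assms)
  then show ?thesis by (metis finite_keys ksum_def ksum_id order_refl)
qed

definition proj :: "nat \<Rightarrow> (monomial \<Rightarrow>\<^sub>0 'f::field) \<Rightarrow> (monomial \<Rightarrow>\<^sub>0 'f)" where
  "proj n = ksum (\<lambda>t c. if monomial_degree t = n then Poly_Mapping.single t c else 0)"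

lemma proj_single:
  "proj n (Poly_Mapping.single t c) = (if monomial_degree t = n then Poly_Mapping.single t c else 0)"
  unfolding proj_def by (rule ksum_single) simp

lemma proj_0 [simp]: "proj n 0 = 0"
  by (simp add: proj_def)

lemma proj_add: "proj n (p + q) = proj n p + proj n q"
  unfolding proj_def by (rule ksum_add) (simp_all add: single_add)

lemma proj_diff: "proj n (p - q) = proj n p - proj n q"
  using proj_add[of n "p - q" q] by simp

lemma lookup_proj: "Poly_Mapping.lookup (proj n p) t =
    (if monomial_degree t = n then Poly_Mapping.lookup p t else 0)"
  by (induction p rule: poly_mapping_add_induct)
     (simp_all add: proj_single proj_add lookup_add lookup_single when_def)

lemma proj_scalar: "proj n (scalar free_superalg c p) = scalar free_superalg c (proj n p)"
  by (rule poly_mapping_eqI) (simp add: lookup_proj)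

lemma proj_proj [simp]: "proj n (proj n p) = proj n p"
  by (rule poly_mapping_eqI) (simp add: lookup_proj)

lemma free_mul_single:
  "mul free_superalg (Poly_Mapping.single s c) (Poly_Mapping.single t d) =
    Poly_Mapping.single (Prod s t) (c * d)"
  unfolding free_mul by (subst ksum_single, simp, subst ksum_single) simp_all

text \<open>The truncated subtraction is harmless: if \<open>t\<close> has degree at least
  \<open>n\<close>, the index is 0, and there is no monomial of degree 0.\<close>

lemma proj_mul_single_right:
  "proj n (mul free_superalg p (Poly_Mapping.single t c)) =
    mul free_superalg (proj (n - monomial_degree t) p) (Poly_Mapping.single t c)"
proof (induction p rule: poly_mapping_add_induct)
  case (single s d)
  have "monomial_degree s + monomial_degree t = n \<longleftrightarrow> monomial_degree s = n - monomial_degree t"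
    using monomial_degree_pos[of s] by auto
  then show ?case by (simp add: free_mul_single proj_single F.mul_zero_left)
qed (simp_all add: proj_add free_mul_add_left F.mul_zero_left)

lemma proj_mul_single_left:
  "proj n (mul free_superalg (Poly_Mapping.single t c) p) =
    mul free_superalg (Poly_Mapping.single t c) (proj (n - monomial_degree t) p)"
proof (induction p rule: poly_mapping_add_induct)
  case (single s d)
  have "monomial_degree t + monomial_degree s = n \<longleftrightarrow> monomial_degree s = n - monomial_degree t"
    using monomial_degree_pos[of s] by auto
  then show ?case by (simp add: free_mul_single proj_single F.mul_zero_right)
qed (simp_all add: proj_add free_mul_add_right F.mul_zero_right)

lemma abs_free11_hom_simps:
  "abs_free11 0 = 0"
  "abs_free11 (p + q) = abs_free11 p + abs_free11 q"
  "abs_free11 (p - q) = abs_free11 p - abs_free11 q"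
  "abs_free11 (scalar free_superalg c p) = free11_scalar c (abs_free11 p)"
  "abs_free11 (mul free_superalg p q) = free11_mul (abs_free11 p) (abs_free11 q)"
  "abs_free11 (associator free_superalg p q r) =
    associator free11_superalg (abs_free11 p) (abs_free11 q) (abs_free11 r)"
  by (simp_all add: abs_free11_simps zero_free11_def minus_free11.abs_eq associator_def)

lemma proj_associator_single:
  "proj n (associator free_superalg (Poly_Mapping.single s a) (Poly_Mapping.single t b) (Poly_Mapping.single r c)) =
    (if monomial_degree s + monomial_degree t + monomial_degree r = n
     then associator free_superalg (Poly_Mapping.single s a) (Poly_Mapping.single t b) (Poly_Mapping.single r c)
     else 0)"
  by (simp add: associator_def free_mul_single proj_diff proj_single add.assoc)

lemma single_part:
  "p \<in> part free_superalg i \<Longrightarrow> t \<in> Poly_Mapping.keys p \<Longrightarrow> Poly_Mapping.single t c \<in> part free_superalg i"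
  by (simp add: free_part)

lemma free_associator_additive:
  "associator free_superalg 0 q r = 0" "associator free_superalg q 0 r = 0" "associator free_superalg q r 0 = 0"
  "associator free_superalg (p + p') q r = associator free_superalg p q r + associator free_superalg p' q r"
  "associator free_superalg q (p + p') r = associator free_superalg q p r + associator free_superalg q p' r"
  "associator free_superalg q r (p + p') = associator free_superalg q r p + associator free_superalg q r p'"
  by (simp_all add: F.associator_zero F.associator_add)

text \<open>On monomials both associators have the same total degree, so \<open>proj n\<close> keeps
  or kills them together. Multilinearity extends this to all homogeneous arguments.\<close>

lemma abs_proj_super_right_alternative:
  assumes "p \<in> part free_superalg i" "q \<in> part free_superalg j" "r \<in> part free_superalg k"
  shows "abs_free11 (proj n (associator free_superalg p q r +
    scalar free_superalg ((-1) ^ (j * k)) (associator free_superalg p r q))) = (0 :: 'f::field free11)"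
proof -
  interpret Q: superalgebra "free11_superalg :: ('f, _) superalg" by (rule free11_superalgebra)
  note Q.minus_one_one_super_identities(1)[OF free11_minus_one_one]
  then have id: "associator free11_superalg x y z +
      scalar free11_superalg ((-1) ^ (j * k)) (associator free11_superalg x z y) = 0"
    if "x \<in> part free11_superalg i" "y \<in> part free11_superalg j" "z \<in> part free11_superalg k"
    for x y z :: "'f free11"
    using that unfolding super_right_alternative_def by blast
  note simps = free_associator_additive proj_add proj_scalar free_scalar_add abs_free11_hom_simps
    F.scale_right_distrib
  have "abs_free11 (proj n (associator free_superalg p q r)) +
    free11_scalar ((-1) ^ (j * k)) (abs_free11 (proj n (associator free_superalg p r q))) = 0"
    (is "?P p q r")
  proof (induction p rule: poly_mapping_keys_induct)
    case (single s a)
    note p = single_part[OF assms(1) single, of a]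
    show ?case
    proof (induction q rule: poly_mapping_keys_induct)
      case (single t b)
      note q = single_part[OF assms(2) single, of b]
      show ?case
      proof (induction r rule: poly_mapping_keys_induct)
        case (single u c)
        note r = single_part[OF assms(3) single, of c]
        show ?case
          using id[of "abs_free11 (Poly_Mapping.single s a)" "abs_free11 (Poly_Mapping.single t b)"
              "abs_free11 (Poly_Mapping.single u c)"] p q r Q.scale_zero_right
          by (simp add: proj_associator_single free11_part abs_free11_hom_simps ac_simps)
      next
        case (plus r r')
        from arg_cong2[OF plus, of "(+)"] show ?case
          using Q.scale_right_distrib by (simp add: simps algebra_simps)
      qed (use Q.scale_zero_right in \<open>simp add: simps\<close>)
    next
      case (plus q q')
      from arg_cong2[OF plus, of "(+)"] show ?case
        using Q.scale_right_distrib by (simp add: simps algebra_simps)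
    qed (use Q.scale_zero_right in \<open>simp add: simps\<close>)
  next
    case (plus p p')
    from arg_cong2[OF plus, of "(+)"] show ?case
      using Q.scale_right_distrib by (simp add: simps algebra_simps)
  qed (use Q.scale_zero_right in \<open>simp add: simps\<close>)
  then show ?thesis by (simp add: simps)
qed

lemma abs_proj_super_cyclic:
  assumes "p \<in> part free_superalg i" "q \<in> part free_superalg j" "r \<in> part free_superalg k"
  shows "abs_free11 (proj n (associator free_superalg p q r +
    scalar free_superalg ((-1) ^ (i * (j + k))) (associator free_superalg q r p) +
    scalar free_superalg ((-1) ^ (k * (i + j))) (associator free_superalg r p q))) = (0 :: 'f::field free11)"
proof -
  interpret Q: superalgebra "free11_superalg :: ('f, _) superalg" by (rule free11_superalgebra)
  note Q.minus_one_one_super_identities(2)[OF free11_minus_one_one]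
  then have id: "associator free11_superalg x y z +
      scalar free11_superalg ((-1) ^ (i * (j + k))) (associator free11_superalg y z x) +
      scalar free11_superalg ((-1) ^ (k * (i + j))) (associator free11_superalg z x y) = 0"
    if "x \<in> part free11_superalg i" "y \<in> part free11_superalg j" "z \<in> part free11_superalg k"
    for x y z :: "'f free11"
    using that unfolding super_cyclic_def by blast
  note simps = free_associator_additive proj_add proj_scalar free_scalar_add abs_free11_hom_simps
    F.scale_right_distrib
  have "abs_free11 (proj n (associator free_superalg p q r)) +
    free11_scalar ((-1) ^ (i * (j + k))) (abs_free11 (proj n (associator free_superalg q r p))) +
    free11_scalar ((-1) ^ (k * (i + j))) (abs_free11 (proj n (associator free_superalg r p q))) = 0"
  proof (induction p rule: poly_mapping_keys_induct)
    case (single s a)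
    note p = single_part[OF assms(1) single, of a]
    show ?case
    proof (induction q rule: poly_mapping_keys_induct)
      case (single t b)
      note q = single_part[OF assms(2) single, of b]
      show ?case
      proof (induction r rule: poly_mapping_keys_induct)
        case (single u c)
        note r = single_part[OF assms(3) single, of c]
        have *: "monomial_degree t + monomial_degree u + monomial_degree s =
            monomial_degree s + monomial_degree t + monomial_degree u"
          "monomial_degree u + monomial_degree s + monomial_degree t =
            monomial_degree s + monomial_degree t + monomial_degree u" by simp_all
        show ?case
          using id[of "abs_free11 (Poly_Mapping.single s a)" "abs_free11 (Poly_Mapping.single t b)"
              "abs_free11 (Poly_Mapping.single u c)"] p q r Q.scale_zero_right
          by (simp add: proj_associator_single free11_part abs_free11_hom_simps *)
      next
        case (plus r r')
        from arg_cong2[OF plus, of "(+)"] show ?case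
          using Q.scale_right_distrib by (simp add: simps algebra_simps)
      qed (use Q.scale_zero_right in \<open>simp add: simps\<close>)
    next
      case (plus q q')
      from arg_cong2[OF plus, of "(+)"] show ?case
        using Q.scale_right_distrib by (simp add: simps algebra_simps)
    qed (use Q.scale_zero_right in \<open>simp add: simps\<close>)
  next
    case (plus p p')
    from arg_cong2[OF plus, of "(+)"] show ?case
      using Q.scale_right_distrib by (simp add: simps algebra_simps)
  qed (use Q.scale_zero_right in \<open>simp add: simps\<close>)
  then show ?thesis by (simp add: simps)
qed

section \<open>The canonical homomorphism\<close>

lemma B0_part: "x \<in> part B0_superalg i \<longleftrightarrow> (if even i then fst x \<in> polyT0 \<and> snd x = 0 else fst x = 0)"
  by (simp add: part_def)

lemma free_split:
  obtains x y where "p = x + y" "x \<in> part free_superalg 0" "y \<in> part free_superalg 1"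
proof -
  have "p \<in> {x + y |x y. x \<in> even_part free_superalg \<and> y \<in> odd_part free_superalg}"
    unfolding F.carrier_eq[symmetric] by simp
  then show thesis using that by (auto simp: part_def)
qed

lemma isobaric_lookup:
  "isobaric n k a \<Longrightarrow> Poly_Mapping.lookup a m = 0 \<or> 2 * weight m + k = n"
  unfolding isobaric_def by (cases "m \<in> Poly_Mapping.keys a") (auto simp: in_keys_iff)

locale canonical_hom =
  fixes \<phi> :: "'f::field free11 \<Rightarrow> 'f polyT \<times> 'f polyT"
  assumes hom: "superalg_hom \<phi> free11_superalg B0_superalg"
    and gen: "\<phi> free11_gen = (0, 1)"
    and two: "(2::'f) \<noteq> 0" and three: "(3::'f) \<noteq> 0"
begin

definition E :: "(monomial \<Rightarrow>\<^sub>0 'f) \<Rightarrow> 'f polyT \<times> 'f polyT" where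
  "E p = \<phi> (abs_free11 p)"

lemma E_add: "E (p + q) = E p + E q"
  and E_scalar: "E (scalar free_superalg c p) = scalar B0_superalg c (E p)"
  and E_mul: "E (mul free_superalg p q) = mul B0_superalg (E p) (E q)"
  using hom by (simp_all add: E_def superalg_hom_def abs_free11_hom_simps)

lemma E_0 [simp]: "E 0 = 0"
  using E_add[of 0 0] by simp

lemma E_diff: "E (p - q) = E p - E q"
  using E_add[of "p - q" q] by simp

lemma E_gen: "E (Poly_Mapping.single Gen 1) = (0, 1)"
  using gen by (simp add: E_def free11_gen_def)

lemma E_part: "p \<in> part free_superalg i \<Longrightarrow> E p \<in> part B0_superalg i"
  using hom unfolding superalg_hom_def
  by (auto simp: E_def part_def free11_superalg_def image_subset_iff simp del: B0_simps)

lemma E_carrier: "fst (E p) \<in> polyT0"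
proof -
  obtain x y where "p = x + y" "x \<in> part free_superalg 0" "y \<in> part free_superalg 1"
    by (rule free_split)
  then show ?thesis
    using E_part[of x 0] E_part[of y 1] by (simp add: E_add B0_part)
qed

lemma E_surj:
  shows E_surj_even: "a \<in> polyT0 \<Longrightarrow> (a, 0) \<in> range E"
    and E_surj_odd: "(0, b) \<in> range E"
proof -
  have addE: "u + v \<in> range E" if "u \<in> range E" "v \<in> range E" for u v
    using that by (elim rangeE) (simp add: E_add[symmetric])
  have mul: "mul B0_superalg u v \<in> range E" if "u \<in> range E" "v \<in> range E" for u v
    using that by (elim rangeE) (simp add: E_mul[symmetric])
  have scalar: "scalar B0_superalg c u \<in> range E" if "u \<in> range E" for u c
    using that by (elim rangeE) (simp add: E_scalar[symmetric])
  have one: "(0, 1) \<in> range E" using E_gen[symmetric] by simp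
  have bar: "(0, a) \<in> range E" if "(a, 0) \<in> range E" for a
    using mul[OF that one] by (simp add: odd_mul_simps)
  have deriv: "(polyT_deriv a, 0) \<in> range E" if a: "(0, a) \<in> range E" for a
  proof -
    have "(odd_mul a 1, 0) \<in> range E" "(odd_mul 1 a, 0) \<in> range E"
      using mul[OF a one] mul[OF one a] by simp_all
    then have "(odd_mul a 1, 0) + scalar B0_superalg (-1) (odd_mul 1 a, 0) \<in> range E"
      by (intro addE scalar)
    then show ?thesis by (simp add: odd_mul_alt polyT_scalar_minus_one algebra_simps)
  qed
  have var: "(var i, 0) \<in> range E" for i
  proof (induction i)
    case 0
    show ?case using mul[OF one one] by (simp add: odd_mul_alt)
  next
    case (Suc i)
    show ?case using deriv[OF bar[OF Suc]] by (simp add: polyT_deriv_var)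
  qed
  have single: "(Poly_Mapping.single m c, 0) \<in> range E" if "m \<noteq> 0" for m c
    using that
  proof (induction "weight m" arbitrary: m rule: less_induct)
    case less
    then have "Poly_Mapping.keys m \<noteq> {}" by simp
    then obtain i where i: "i \<in> Poly_Mapping.keys m" by blast
    show ?case
    proof (cases "m - Poly_Mapping.single i 1 = 0")
      case True
      have "Poly_Mapping.single m c = polyT_scalar c (var i)"
        unfolding single_remove[OF i] True polyT_scalar_eq by (simp only: mult.commute)
      then show ?thesis using scalar[OF var, of c i] by (simp add: polyT_scalar_simps)
    next
      case False
      then have "(Poly_Mapping.single (m - Poly_Mapping.single i 1) c, 0) \<in> range E"
        using less weight_remove[OF i] by simp
      from mul[OF var this, of i] show ?thesis
        unfolding single_remove[OF i] by (simp add: odd_mul_simps)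
    qed
  qed
  show even: "(a, 0) \<in> range E" if "a \<in> polyT0" for a
    using that
  proof (induction a rule: polyT0_monomial_induct)
    case (add p q)
    then show ?case using addE[of "(p, 0)" "(q, 0)"] by simp
  qed (rule single)
  show "(0, b) \<in> range E"
  proof -
    obtain c b' where b: "b = polyT_scalar c 1 + b'" "b' \<in> polyT0" by (rule polyT_const_cases)
    have "scalar B0_superalg c (0, 1) + (0, b') \<in> range E"
      by (intro addE scalar one bar even b(2))
    then show ?thesis by (simp add: b(1) polyT_scalar_simps)
  qed
qed

lemma E_lift_part:
  assumes "x \<in> part B0_superalg i"
  obtains p where "p \<in> part free_superalg i" "E p = x"
proof -
  have "x \<in> range E"
    using assms E_surj_even[of "fst x"] E_surj_odd[of "snd x"]
    by (cases x, cases "even i") (simp_all add: B0_part)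
  then obtain p where p: "E p = x" by (metis rangeE)
  obtain y z where yz: "p = y + z" "y \<in> part free_superalg 0" "z \<in> part free_superalg 1"
    by (rule free_split)
  show thesis
  proof (cases "even i")
    case True
    have "E z = 0"
      using E_part[OF yz(2)] E_part[OF yz(3)] assms True p[symmetric]
      by (simp add: yz(1) E_add B0_part prod_eq_iff)
    then have "E y = x" using p by (simp add: yz(1) E_add)
    then show thesis using that[of y] yz True by (simp add: part_def)
  next
    case False
    have "E y = 0"
      using E_part[OF yz(2)] E_part[OF yz(3)] assms False p[symmetric]
      by (simp add: yz(1) E_add B0_part prod_eq_iff)
    then have "E z = x" using p by (simp add: yz(1) E_add)
    then show thesis using that[of z] yz False by (simp add: part_def)
  qed
qed

lemma E_homogeneous: "B0_homogeneous (monomial_degree t) (E (Poly_Mapping.single t c))"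
proof -
  have "B0_homogeneous (monomial_degree t) (E (Poly_Mapping.single t 1))"
  proof (induction t)
    case Gen
    show ?case using isobaric_single[of 0 1] by (simp add: E_gen B0_homogeneous_def isobaric_def)
  next
    case (Prod s t)
    from B0_homogeneous_mul[OF this] show ?case
      by (simp add: E_mul[symmetric] free_mul_single)
  qed
  moreover have "Poly_Mapping.single t c = scalar free_superalg c (Poly_Mapping.single t 1)"
    by (simp add: free_scalar_single)
  ultimately show ?thesis
    by (cases "E (Poly_Mapping.single t 1)") (simp add: E_scalar B0_homogeneous_def isobaric_scalar)
qed

text \<open>\<open>E\<close> respects the two gradings. The statement is coefficientwise, which
  avoids a projection on \<open>B0_superalg\<close>.\<close>

lemma lookup_E_proj:
  "Poly_Mapping.lookup (fst (E (proj n p))) m =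
     (if n = 2 * weight m then Poly_Mapping.lookup (fst (E p)) m else 0) \<and>
   Poly_Mapping.lookup (snd (E (proj n p))) m =
     (if n = 2 * weight m + 1 then Poly_Mapping.lookup (snd (E p)) m else 0)"
proof (induction p rule: poly_mapping_add_induct)
  case (single t c)
  have "isobaric (monomial_degree t) 0 (fst (E (Poly_Mapping.single t c)))"
    "isobaric (monomial_degree t) 1 (snd (E (Poly_Mapping.single t c)))"
    using E_homogeneous[of t c] by (simp_all add: B0_homogeneous_def)
  note ib = this[THEN isobaric_lookup, of m]
  show ?case
  proof (cases "monomial_degree t = n")
    case True
    have proj: "proj n (Poly_Mapping.single t c) = Poly_Mapping.single t c"
      using True by (simp add: proj_single)
    have if_eq: "L = (if n = 2 * w + k then L else 0)" if "L = 0 \<or> 2 * w + k = n" for L :: 'f and w k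
      using that by auto
    show ?thesis
      unfolding proj using if_eq[OF ib(1)[unfolded True]] if_eq[OF ib(2)[unfolded True]]
      by (simp only: add_0_right simp_thms)
  next
    case False
    have proj: "proj n (Poly_Mapping.single t c) = 0"
      using False by (simp add: proj_single)
    have if_eq: "0 = (if n = 2 * w + k then L else 0)" if "L = 0 \<or> 2 * w + k = monomial_degree t"
      for L :: 'f and w k
      using that False by auto
    show ?thesis
      unfolding proj using if_eq[OF ib(1)] if_eq[OF ib(2)]
      by (simp only: E_0 fst_zero snd_zero lookup_zero add_0_right simp_thms)
  qed
qed (simp_all add: proj_add E_add lookup_add)

lemma E_proj_eq_0: "E p = 0 \<Longrightarrow> E (proj n p) = 0"
proof (rule prod_eqI; rule poly_mapping_eqI)
  fix m assume "E p = 0"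
  then show "Poly_Mapping.lookup (fst (E (proj n p))) m = Poly_Mapping.lookup (fst 0) m"
    "Poly_Mapping.lookup (snd (E (proj n p))) m = Poly_Mapping.lookup (snd 0) m"
    using lookup_E_proj[of n p m] by simp_all
qed

end

lemma free11_linear_functional:
  fixes z :: "'f::field free11"
  assumes "z \<noteq> 0"
  obtains l :: "'f free11 \<Rightarrow> 'f"
  where "\<And>x y. l (x + y) = l x + l y" "\<And>c x. l (free11_scalar c x) = c * l x" "l z \<noteq> 0"
proof -
  interpret Q: superalgebra "free11_superalg :: ('f, _) superalg" by (rule free11_superalgebra)
  have "vector_space (free11_scalar :: 'f \<Rightarrow> _)" using Q.vector_space_axioms by simp
  moreover have "vector_space ((*) :: 'f \<Rightarrow> 'f \<Rightarrow> 'f)" by unfold_locales (simp_all add: algebra_simps)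
  ultimately interpret P: vector_space_pair "free11_scalar :: 'f \<Rightarrow> _" "(*) :: 'f \<Rightarrow> 'f \<Rightarrow> 'f"
    by (simp add: vector_space_pair_def)
  have "P.vs1.independent {z}" using assms by simp
  from P.linear_independent_extend[OF this, of "\<lambda>_. 1"] obtain l where
    l: "Vector_Spaces.linear free11_scalar (*) l" "l z = 1" by auto
  interpret l: Vector_Spaces.linear free11_scalar "(*)" l by (rule l(1))
  show thesis using that[of l] l(2) by (simp add: l.add l.scale)
qed

section \<open>Injectivity\<close>

text \<open>\<open>inj_below\<close> is the induction hypothesis for \<open>kernel_degree\<close>;
  \<open>l\<close> will be a functional chosen to detect a hypothetical kernel element.\<close>

locale canonical_hom_degree = canonical_hom \<phi>
  for \<phi> :: "'f::field free11 \<Rightarrow> 'f polyT \<times> 'f polyT" +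
  fixes n :: nat and l :: "'f free11 \<Rightarrow> 'f"
  assumes n_pos: "0 < n"
    and l_add: "l (x + y) = l x + l y"
    and l_scalar: "l (free11_scalar c x) = c * l x"
    and inj_below: "m < n \<Longrightarrow> E (proj m p) = 0 \<Longrightarrow> abs_free11 (proj m p) = 0"
begin

lemma l_0 [simp]: "l 0 = 0" using l_add[of 0 0] by (metis add.right_neutral add_left_cancel)
lemma l_diff: "l (x - y) = l x - l y" using l_add[of "x - y" y] by simp

definition ldeg :: "(monomial \<Rightarrow>\<^sub>0 'f) \<Rightarrow> 'f" where
  "ldeg p = l (abs_free11 (proj n p))"

lemma ldeg_simps:
  "ldeg 0 = 0"
  "ldeg (p + q) = ldeg p + ldeg q"
  "ldeg (p - q) = ldeg p - ldeg q"
  "ldeg (scalar free_superalg c p) = c * ldeg p"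
  by (simp_all add: ldeg_def abs_free11_hom_simps proj_add proj_diff proj_scalar l_add l_diff l_scalar)

lemma ldeg_mul_0_left:
  assumes "E p = 0"
  shows "ldeg (mul free_superalg p q) = 0"
proof (induction q rule: poly_mapping_add_induct)
  case (single t c)
  \<comment> \<open>The other factor has positive degree, so only a component of \<open>p\<close> of
    degree below \<open>n\<close> contributes.\<close>
  have "abs_free11 (proj (n - monomial_degree t) p) = 0"
    using n_pos monomial_degree_pos[of t] by (intro inj_below E_proj_eq_0 assms) simp
  moreover have "free11_mul 0 y = 0" for y :: "'f free11"
    using algebra.mul_zero_left[OF superalgebra.axioms(1)[OF free11_superalgebra]] by simp
  ultimately show ?case
    by (simp add: ldeg_def proj_mul_single_right abs_free11_hom_simps)
qed (simp_all add: F.mul_zero_right free_mul_add_right ldeg_simps)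

lemma ldeg_mul_0_right:
  assumes "E q = 0"
  shows "ldeg (mul free_superalg p q) = 0"
proof (induction p rule: poly_mapping_add_induct)
  case (single t c)
  have "abs_free11 (proj (n - monomial_degree t) q) = 0"
    using n_pos monomial_degree_pos[of t] by (intro inj_below E_proj_eq_0 assms) simp
  moreover have "free11_mul y 0 = 0" for y :: "'f free11"
    using algebra.mul_zero_right[OF superalgebra.axioms(1)[OF free11_superalgebra]] by simp
  ultimately show ?case
    by (simp add: ldeg_def proj_mul_single_left abs_free11_hom_simps)
qed (simp_all add: F.mul_zero_left free_mul_add_left ldeg_simps)

lemma free_mul_diff:
  "mul free_superalg (p - p') q = mul free_superalg p q - mul free_superalg p' q"
  "mul free_superalg q (p - p') = mul free_superalg q p - mul free_superalg q p'"
  using free_mul_add_left[of "p - p'" p' q] free_mul_add_right[of q "p - p'" p'] by simp_all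

lemma ldeg_mul_cong:
  assumes "E p = E p'" "E q = E q'"
  shows "ldeg (mul free_superalg p q) = ldeg (mul free_superalg p' q')"
proof -
  have "ldeg (mul free_superalg (p - p') q) = 0" "ldeg (mul free_superalg p' (q - q')) = 0"
    using assms by (auto intro: ldeg_mul_0_left ldeg_mul_0_right simp: E_diff)
  then show ?thesis by (simp add: free_mul_diff ldeg_simps)
qed

text \<open>Dropping the constant term makes the lift, and hence the form, total and bilinear.\<close>

definition lift :: "'f polyT \<times> 'f polyT \<Rightarrow> (monomial \<Rightarrow>\<^sub>0 'f)" where
  "lift u = (SOME p. E p = (fst u - const_part (fst u), snd u))"

lemma E_lift: "E (lift u) = (fst u - const_part (fst u), snd u)"
proof -
  obtain p where p: "E p = (fst u - const_part (fst u), 0)"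
    using E_surj_even[of "fst u - const_part (fst u)"] by (metis diff_const_part rangeE)
  obtain q where q: "E q = (0, snd u)"
    using E_surj_odd[of "snd u"] by (metis rangeE)
  have "E (p + q) = (fst u - const_part (fst u), snd u)"
    by (simp add: E_add p q)
  then show ?thesis unfolding lift_def by (rule someI)
qed

definition form :: "'f polyT \<times> 'f polyT \<Rightarrow> 'f polyT \<times> 'f polyT \<Rightarrow> 'f" where
  "form u v = ldeg (mul free_superalg (lift u) (lift v))"

text \<open>Images under \<open>E\<close> have no constant term in the even component, so the lift
  of \<open>E p\<close> has the same image as \<open>p\<close>.\<close>

lemma form_E: "form (E p) (E q) = ldeg (mul free_superalg p q)"
  unfolding form_def using E_carrier by (intro ldeg_mul_cong) (simp_all add: E_lift)

lemma form_bilinear: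
  "form (u + u') v = form u v + form u' v"
  "form u (v + v') = form u v + form u v'"
  "form (scalar B0_superalg c u) v = c * form u v"
  "form u (scalar B0_superalg c v) = c * form u v"
proof -
  have add: "E (lift (u + u')) = E (lift u + lift u')" for u u'
    by (simp add: E_lift E_add const_part_simps)
  have scalar: "E (lift (scalar B0_superalg c u)) = E (scalar free_superalg c (lift u))" for c u
    by (cases u) (simp add: E_lift E_scalar const_part_simps polyT_scalar_simps)
  show "form (u + u') v = form u v + form u' v"
    using ldeg_mul_cong[OF add refl] by (simp add: form_def free_mul_add_left ldeg_simps)
  show "form u (v + v') = form u v + form u v'"
    using ldeg_mul_cong[OF refl add] by (simp add: form_def free_mul_add_right ldeg_simps)
  show "form (scalar B0_superalg c u) v = c * form u v"
    using ldeg_mul_cong[OF scalar refl] by (simp add: form_def free_mul_scalar_left ldeg_simps)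
  show "form u (scalar B0_superalg c v) = c * form u v"
    using ldeg_mul_cong[OF refl scalar] by (simp add: form_def free_mul_scalar_right ldeg_simps)
qed

definition form_assoc :: "'f polyT \<times> 'f polyT \<Rightarrow> 'f polyT \<times> 'f polyT \<Rightarrow> 'f polyT \<times> 'f polyT \<Rightarrow> 'f" where
  "form_assoc x y z = form (mul B0_superalg x y) z - form x (mul B0_superalg y z)"

lemma form_assoc_E: "form_assoc (E p) (E q) (E r) = ldeg (associator free_superalg p q r)"
  by (simp add: form_assoc_def associator_def E_mul[symmetric] form_E ldeg_simps)

lemma form_super_right_alternative:
  assumes "x \<in> part B0_superalg i" "y \<in> part B0_superalg j" "z \<in> part B0_superalg k"
  shows "form_assoc x y z + (-1) ^ (j * k) * form_assoc x z y = 0"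
proof -
  obtain p where p: "p \<in> part free_superalg i" "E p = x" using assms(1) by (rule E_lift_part)
  obtain q where q: "q \<in> part free_superalg j" "E q = y" using assms(2) by (rule E_lift_part)
  obtain r where r: "r \<in> part free_superalg k" "E r = z" using assms(3) by (rule E_lift_part)
  have "ldeg (associator free_superalg p q r +
      scalar free_superalg ((-1) ^ (j * k)) (associator free_superalg p r q)) = 0"
    unfolding ldeg_def using abs_proj_super_right_alternative[OF p(1) q(1) r(1)] by simp
  then show ?thesis
    by (simp only: ldeg_simps form_assoc_E[symmetric] p q r)
qed

lemma form_super_cyclic:
  assumes "x \<in> part B0_superalg i" "y \<in> part B0_superalg j" "z \<in> part B0_superalg k"
  shows "form_assoc x y z + (-1) ^ (i * (j + k)) * form_assoc y z x +
    (-1) ^ (k * (i + j)) * form_assoc z x y = 0"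
proof -
  obtain p where p: "p \<in> part free_superalg i" "E p = x" using assms(1) by (rule E_lift_part)
  obtain q where q: "q \<in> part free_superalg j" "E q = y" using assms(2) by (rule E_lift_part)
  obtain r where r: "r \<in> part free_superalg k" "E r = z" using assms(3) by (rule E_lift_part)
  have "ldeg (associator free_superalg p q r +
      scalar free_superalg ((-1) ^ (i * (j + k))) (associator free_superalg q r p) +
      scalar free_superalg ((-1) ^ (k * (i + j))) (associator free_superalg r p q)) = 0"
    unfolding ldeg_def using abs_proj_super_cyclic[OF p(1) q(1) r(1)] by simp
  then show ?thesis
    by (simp only: ldeg_simps form_assoc_E[symmetric] p q r)
qed

section \<open>The form satisfies the cocycle conditions\<close>

abbreviation "ee a b \<equiv> form (a, 0) (b, 0)"
abbreviation "eo a b \<equiv> form (a, 0) (0, b)"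
abbreviation "oe a b \<equiv> form (0, a) (b, 0)"
abbreviation "oo a b \<equiv> form (0, a) (0, b)"

lemma form_components_bilinear:
  "polyT_bilinear ee" "polyT_bilinear eo" "polyT_bilinear oe" "polyT_bilinear oo"
proof -
  have s: "(polyT_scalar c a, 0) = scalar B0_superalg c (a, 0)"
    "(0, polyT_scalar c a) = scalar B0_superalg c (0, a)" for c :: 'f and a
    by (simp_all add: polyT_scalar_simps)
  have a: "(a + b, 0) = (a, 0) + (b, 0 :: 'f polyT)" "(0, a + b) = (0 :: 'f polyT, a) + (0, b)"
    for a b :: "'f polyT"
    by simp_all
  show "polyT_bilinear ee" "polyT_bilinear eo" "polyT_bilinear oe" "polyT_bilinear oo"
    by unfold_locales (simp_all only: s a form_bilinear)
qed

lemma form_0: "form (0, 0) v = 0" "form u (0, 0) = 0"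
  using form_bilinear(3)[of 0 "(0, 0)" v] form_bilinear(4)[of u 0 "(0, 0)"]
  by (simp_all add: polyT_scalar_simps)

lemma cocycle: "vector_type_cocycle ee eo oe oo"
proof -
  interpret ee: polyT_bilinear ee by (rule form_components_bilinear)
  interpret eo: polyT_bilinear eo by (rule form_components_bilinear)
  interpret oe: polyT_bilinear oe by (rule form_components_bilinear)
  interpret oo: polyT_bilinear oo by (rule form_components_bilinear)
  note simps = form_assoc_def odd_mul_simps form_0 mult.commute
  have e: "(a, 0) \<in> part B0_superalg 0" if "a \<in> polyT0" for a :: "'f polyT"
    using that by (simp add: B0_part)
  have o: "(0, a) \<in> part B0_superalg 1" for a :: "'f polyT"
    by (simp add: B0_part)
  \<comment> \<open>Right alternativity with two odd arguments on the right involves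
    \<open>odd_mul b c - odd_mul c b\<close>; the multiples of t_0 cancel in it.\<close>
  have odd_mul_diff: "odd_mul b c - odd_mul c b = polyT_deriv b * c - b * polyT_deriv c" for b c :: "'f polyT"
    by (simp add: odd_mul_def algebra_simps)
  show ?thesis
  proof
    show "(2::'f) \<noteq> 0" "(3::'f) \<noteq> 0" by (rule two, rule three)
    fix a b c :: "'f polyT"
    show "eo (a * b) c + oe (a * c) b = 2 * eo a (b * c)" if "a \<in> polyT0" "b \<in> polyT0"
      using form_super_right_alternative[OF e[OF that(1)] e[OF that(2)] o[of c]]
      by (simp add: simps algebra_simps)
    show "oe (c * a) b + oe (c * b) a = 2 * oe c (a * b)" if "a \<in> polyT0" "b \<in> polyT0"
      using form_super_right_alternative[OF o[of c] e[OF that(1)] e[OF that(2)]]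
      by (simp add: simps algebra_simps)
    show "ee (a * b) c + ee (a * c) b = 2 * ee a (b * c)" if "a \<in> polyT0" "b \<in> polyT0" "c \<in> polyT0"
      using form_super_right_alternative[OF e[OF that(1)] e[OF that(2)] e[OF that(3)]]
      by (simp add: simps algebra_simps)
    show "eo (odd_mul a b) c - eo (odd_mul a c) b = oe a (polyT_deriv b * c - b * polyT_deriv c)"
      using form_super_right_alternative[OF o[of a] o[of b] o[of c]]
      unfolding odd_mul_diff[symmetric] oe.diff_right
      by (simp add: form_assoc_def odd_mul_simps algebra_simps)
    show "eo (odd_mul a b) c + eo (odd_mul b c) a + eo (odd_mul c a) b =
        oe a (odd_mul b c) + oe b (odd_mul c a) + oe c (odd_mul a b)"
      using form_super_cyclic[OF o[of a] o[of b] o[of c]]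
      by (simp add: form_assoc_def odd_mul_simps algebra_simps)
    show "oo (a * b) c - oo (a * c) b = ee a (polyT_deriv b * c - b * polyT_deriv c)" if "a \<in> polyT0"
      using form_super_right_alternative[OF e[OF that] o[of b] o[of c]]
      unfolding odd_mul_diff[symmetric] ee.diff_right
      by (simp add: form_assoc_def odd_mul_simps algebra_simps)
    show "oo (a * b) c + ee (odd_mul b c) a = 2 * oo b (a * c)" if "a \<in> polyT0"
      using form_super_right_alternative[OF o[of b] e[OF that] o[of c]]
      by (simp add: form_assoc_def odd_mul_simps algebra_simps)
    show "oo (a * b) c - ee a (odd_mul b c) + ee (odd_mul b c) a - oo b (c * a) - oo (c * a) b + oo c (a * b) = 0"
      if "a \<in> polyT0"
      using form_super_cyclic[OF e[OF that] o[of b] o[of c]]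
      by (simp add: form_assoc_def odd_mul_simps algebra_simps)
  qed
qed

interpretation c: vector_type_cocycle ee eo oe oo by (rule cocycle)

text \<open>The odd component of a product in $B_0$ has no constant term, so products do not
  constrain the value at \<open>(0, 1)\<close>. Accordingly \<open>ldeg_eq_L\<close> excludes
  \<open>Gen\<close>.\<close>

definition L :: "'f polyT \<times> 'f polyT \<Rightarrow> 'f" where
  "L u = c.coboundary (fst u) + eo (snd u) 1"

lemma L_add: "L (u + v) = L u + L v"
  by (simp add: L_def c.coboundary_simps c.q.add_left)

lemma L_0 [simp]: "L 0 = 0"
  using L_add[of 0 0] by (metis add.right_neutral add_left_cancel)

text \<open>\<open>form\<close> discards constant terms of even components whereas
  \<open>mul\<close> keeps them, hence the two hypotheses.\<close>

lemma form_eq_L: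
  assumes "fst u \<in> polyT0" "fst v \<in> polyT0"
  shows "form u v = L (mul B0_superalg u v)"
proof -
  obtain a b a' b' where uv: "u = (a, b)" "v = (a', b')" by (cases u, cases v)
  with assms have polyT0: "a \<in> polyT0" "a' \<in> polyT0" by simp_all
  have "form u v = form ((a, 0) + (0, b)) ((a', 0) + (0, b'))" by (simp add: uv)
  also have "\<dots> = ee a a' + oe b a' + (eo a b' + oo b b')"
    by (simp only: form_bilinear(1,2))
  also have "\<dots> = c.coboundary (a * a') + eo (a' * b) 1 + (eo (a * b') 1 + c.coboundary (odd_mul b b'))"
    by (intro arg_cong2[of _ _ _ _ "(+)"] c.even_even c.even_odd c.odd_odd polyT0)
  also have "\<dots> = L (mul B0_superalg u v)"
    by (simp only: uv B0_mul L_def fst_conv snd_conv c.coboundary_add c.q.add_left mult.commute[of b a'] ac_simps)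
  finally show ?thesis .
qed

lemma ldeg_eq_L:
  assumes "Gen \<notin> Poly_Mapping.keys p"
  shows "ldeg p = L (E p)"
proof (induction p rule: poly_mapping_keys_induct)
  case zero
  show ?case by (simp add: ldeg_simps)
next
  case (single t a)
  then obtain u v where t: "t = Prod u v" using assms by (cases t) auto
  have "Poly_Mapping.single t a = mul free_superalg (Poly_Mapping.single u a) (Poly_Mapping.single v 1)"
    by (simp add: free_mul_single t)
  then show ?case
    by (metis E_mul form_E form_eq_L E_carrier)
qed (simp add: ldeg_simps E_add L_add)

lemma l_eq_0:
  assumes "1 < n" "E (proj n p) = 0"
  shows "l (abs_free11 (proj n p)) = 0"
proof -
  have "Gen \<notin> Poly_Mapping.keys (proj n p)"
    using assms(1) by (simp add: in_keys_iff lookup_proj)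
  from ldeg_eq_L[OF this] show ?thesis
    using assms(2) by (simp add: ldeg_def)
qed

end

section \<open>Induction on the degree\<close>

context canonical_hom
begin

lemma kernel_degree: "E (proj n p) = 0 \<Longrightarrow> abs_free11 (proj n p) = 0"
proof (induction n arbitrary: p rule: less_induct)
  case (less n)
  consider "n = 0" | "n = 1" | "1 < n" by linarith
  then show ?case
  proof cases
    case 1
    have "proj 0 p = 0"
      by (rule poly_mapping_eqI) (metis lookup_proj lookup_zero monomial_degree_pos less_irrefl)
    then show ?thesis using 1 by (simp add: abs_free11_hom_simps)
  next
    case 2
    \<comment> \<open>The generator is the only monomial of degree 1, and its image
      \<open>(0, 1)\<close> is nonzero.\<close>
    define c where "c = Poly_Mapping.lookup p Gen"
    have eq: "proj 1 p = scalar free_superalg c (Poly_Mapping.single Gen 1)"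
    proof (rule poly_mapping_eqI)
      fix t
      show "Poly_Mapping.lookup (proj 1 p) t =
          Poly_Mapping.lookup (scalar free_superalg c (Poly_Mapping.single Gen 1)) t"
        by (simp only: lookup_proj monomial_degree_1)
           (simp add: c_def lookup_single when_def)
    qed
    then have "polyT_scalar c 1 = 0"
      using less.prems 2 by (simp add: E_scalar E_gen prod_eq_iff)
    from arg_cong[OF this, of "\<lambda>p. Poly_Mapping.lookup p 0"] have "c = 0"
      by (simp add: lookup_one)
    then have "proj 1 p = 0" unfolding eq by simp
    then show ?thesis using 2 by (simp add: abs_free11_hom_simps)
  next
    case 3
    show ?thesis
    proof (rule ccontr)
      assume nonzero: "abs_free11 (proj n p) \<noteq> 0"
      show False
      proof (rule free11_linear_functional[OF nonzero])
        fix l :: "'f free11 \<Rightarrow> 'f"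
        assume l: "\<And>x y. l (x + y) = l x + l y" "\<And>c x. l (free11_scalar c x) = c * l x"
          "l (abs_free11 (proj n p)) \<noteq> 0"
        interpret canonical_hom_degree \<phi> n l
          using 3 less.IH by unfold_locales (auto simp: l(1,2))
        show False using l_eq_0[OF 3 less.prems] l(3) by simp
      qed
    qed
  qed
qed

lemma sum_proj: "\<exists>N. p = (\<Sum>n<N. proj n p)"
proof -
  \<comment> \<open>Inserting 0 keeps the maximum defined when \<open>p\<close> is zero.\<close>
  define N where "N = Suc (Max (insert 0 (monomial_degree ` Poly_Mapping.keys p)))"
  have "Poly_Mapping.lookup p t = (\<Sum>n<N. Poly_Mapping.lookup (proj n p) t)" for t
  proof (cases "t \<in> Poly_Mapping.keys p")
    case True
    then have "monomial_degree t < N" by (simp add: N_def less_Suc_eq_le)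
    then show ?thesis by (simp add: lookup_proj)
  next
    case False
    then show ?thesis by (simp add: lookup_proj in_keys_iff)
  qed
  then show ?thesis by (intro exI[of _ N] poly_mapping_eqI) (simp add: lookup_sum)
qed

lemma kernel: "E p = 0 \<Longrightarrow> abs_free11 p = 0"
proof -
  assume "E p = 0"
  then have 0: "abs_free11 (proj n p) = 0" for n by (intro kernel_degree E_proj_eq_0)
  obtain N where N: "p = (\<Sum>n<N. proj n p)" using sum_proj by blast
  have "abs_free11 (\<Sum>n<M. proj n p) = 0" for M
    by (induction M) (simp_all add: abs_free11_hom_simps 0)
  then show ?thesis using N by metis
qed

lemma isomorphism: "superalg_iso \<phi> free11_superalg B0_superalg"
proof -
  have "inj \<phi>"
  proof (rule injI)
    fix x y assume xy: "\<phi> x = \<phi> y"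
    obtain p where x: "x = abs_free11 p" by (rule abs_free11_surj)
    obtain q where y: "y = abs_free11 q" by (rule abs_free11_surj)
    have "E (p - q) = 0" using xy by (simp add: E_diff) (simp add: E_def x y)
    from kernel[OF this] show "x = y" by (simp add: x y abs_free11_hom_simps)
  qed
  moreover have "range \<phi> = carrier B0_superalg"
  proof (intro equalityI subsetI)
    fix u assume "u \<in> range \<phi>"
    then obtain x where "u = \<phi> x" by blast
    moreover obtain p where "x = abs_free11 p" by (rule abs_free11_surj)
    ultimately show "u \<in> carrier B0_superalg" using E_carrier[of p] by (simp add: E_def)
  next
    fix u :: "'f polyT \<times> 'f polyT" assume "u \<in> carrier B0_superalg"
    then have "(fst u, 0) \<in> range E" "(0, snd u) \<in> range E"
      using E_surj_even[of "fst u"] E_surj_odd[of "snd u"] by simp_all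
    then obtain p q where "E p = (fst u, 0)" "E q = (0, snd u)" by (metis rangeE)
    then have "E (p + q) = u" by (simp add: E_add)
    then show "u \<in> range \<phi>" unfolding E_def by blast
  qed
  ultimately show ?thesis using hom by (simp add: superalg_iso_def bij_betw_def)
qed

end

theorem theorem3p1:
  assumes "CHAR('f::field) \<noteq> 2" and "CHAR('f) \<noteq> 3"
  shows "\<exists>\<phi>. superalg_iso \<phi> (free11_superalg :: ('f, 'f free11) superalg) B0_superalg \<and>
           \<phi> free11_gen = (0, 1)"
proof -
  have "\<not> CHAR('f) dvd 2"
  proof
    assume "CHAR('f) dvd 2"
    moreover from dvd_imp_le[OF this] have "CHAR('f) = 0 \<or> CHAR('f) = 1 \<or> CHAR('f) = 2" by linarith
    ultimately show False using assms by auto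
  qed
  moreover have "\<not> CHAR('f) dvd 3"
  proof
    assume "CHAR('f) dvd 3"
    moreover from dvd_imp_le[OF this]
    have "CHAR('f) = 0 \<or> CHAR('f) = 1 \<or> CHAR('f) = 2 \<or> CHAR('f) = 3" by linarith
    ultimately show False using assms by auto
  qed
  ultimately have char: "(2::'f) \<noteq> 0" "(3::'f) \<noteq> 0"
    using of_nat_eq_0_iff_char_dvd[of 2, where ?'a = 'f] of_nat_eq_0_iff_char_dvd[of 3, where ?'a = 'f]
    by simp_all
  have "(0, 1) \<in> odd_part (B0_superalg :: ('f, _) superalg)" by simp
  from free11_universal[OF B0_minus_one_one[OF char(1)] this]
  obtain \<phi> :: "'f free11 \<Rightarrow> 'f polyT \<times> 'f polyT"
    where \<phi>: "superalg_hom \<phi> free11_superalg B0_superalg" "\<phi> free11_gen = (0, 1)" by blast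
  interpret canonical_hom \<phi> by unfold_locales (fact \<phi> char)+
  show ?thesis using isomorphism \<phi>(2) by blast
qed

end
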